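(* There exists $\rho_0>0$ such that the following holds for every $\rho\geq\rho_0$. Let $u_0\in L^2(\mathbb{R})\cap\dot H^{\rho}(\mathbb{R})$ be a (real-valued) initial data and let $u\in L^\infty_t(L^2_x)\cap L^2_t(\mathcal{N}_x)$ be an associated weak solution of the equation $$\partial_t u=-(-\Delta)^{\frac12}\mathcal{M}(u)+\partial_x\left(\frac{u^2}{2}\right),\qquad u(0,x)=u_0(x),\quad x\in\mathbb{R}.$$ Assume moreover that $u\in L^\infty_t(L^\infty_x)$. Then $u$ is unique: if $v\in L^\infty_t(L^2_x)\cap L^2_t(\mathcal{N}_x)\cap L^\infty_t(L^\infty_x)$ is also a weak solution of this equation with the same initial data $u_0$, then $v=u$.
   Context: The operators are Fourier multipliers on $\mathbb{R}$: $\widehat{(-\Delta)^{a}f}(\xi)=|\xi|^{2a}\widehat f(\xi)$, and $\widehat{\mathcal{M}(f)}(\xi)=\mathfrak{m}(\xi)\widehat f(\xi)$ with $\mathfrak{m}(\xi)=\sqrt{(1+\xi^2)\frac{\tanh(\xi)}{\xi}}$ (so $\mathfrak m(0)=1$). $\mathcal{M}^{\frac12}$ is the multiplier with symbol $\mathfrak{m}(\xi)^{\frac12}$. The functional $\|\cdot\|_{\mathcal{N}}$ is $\|f\|_{\mathcal{N}}=\left(\int_{\mathbb{R}}\left|(-\Delta)^{\frac14}\mathcal{M}^{\frac12}(f)\right|^2dx\right)^{\frac12}$, where $(-\Delta)^{\frac14}\mathcal{M}^{\frac12}$ has symbol $|\xi|^{\frac12}\mathfrak m(\xi)^{\frac12}$,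 and $\mathcal{N}(\mathbb{R})$ is the set of real functions $f$ with $\|f\|_{\mathcal{N}}<+\infty$. For $\sigma>0$, $\dot H^\sigma(\mathbb{R})$ is the homogeneous Sobolev space with $\|f\|_{\dot H^\sigma}=\|(-\Delta)^{\frac{\sigma}{2}}f\|_{L^2}$. The notation $L^p_t(X_x)$ means $L^p\big((0,+\infty),X(\mathbb{R})\big)$. A weak solution is understood in the usual distributional sense: for all $\phi\in C_c^\infty([0,+\infty)\times\mathbb{R})$, $$\int_0^{+\infty}\!\!\int_{\mathbb{R}}\Big(u\,\partial_t\phi-u\,(-\Delta)^{\frac12}\mathcal{M}(\phi)-\frac{u^2}{2}\partial_x\phi\Big)dx\,dt+\int_{\mathbb{R}}u_0(x)\phi(0,x)\,dx=0.$$ *)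

theory Defs
  imports "HOL-Analysis.Analysis"
begin

text \<open>
  Elements of Lebesgue spaces are represented by Borel functions (every Lebesgue class contains
  one); equality in such a space is equality almost everywhere.
\<close>

definition L2 :: "(real \<Rightarrow> 'a::{banach, second_countable_topology}) set" where
  "L2 = {f \<in> borel_measurable lborel. integrable lborel (\<lambda>x. (norm (f x))\<^sup>2)}"

definition L2_norm :: "(real \<Rightarrow> 'a::{banach, second_countable_topology}) \<Rightarrow> real" where
  "L2_norm f = sqrt (LINT x|lborel. (norm (f x))\<^sup>2)"

text \<open>
  The Fourier transform on \<open>L2\<close> is the \<open>L2\<close>-limit of the transforms of the truncations to
  \<open>[-n, n]\<close>.  The kernel is \<open>exp (- \<i> \<xi> x)\<close>, without a factor \<open>2 \<pi>\<close>: this is the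
  convention for which the Laplacian has symbol \<open>- \<xi>\<^sup>2\<close>.
\<close>

definition is_fourier :: "(real \<Rightarrow> complex) \<Rightarrow> (real \<Rightarrow> complex) \<Rightarrow> bool" where
  "is_fourier f F \<longleftrightarrow> f \<in> L2 \<and> F \<in> L2 \<and>
     (\<lambda>n. \<integral>\<^sup>+ \<xi>. ennreal ((cmod (F \<xi> - (LINT x:{- real n..real n}|lborel. cis (- (\<xi> * x)) * f x)))\<^sup>2)
        \<partial>lborel) \<longlonglongrightarrow> 0"

text \<open>
  The symbols below are real and even, so the multipliers map real functions to real functions.
  The multiplier is an unbounded operator on real \<open>L2\<close>, determined up to null sets on its
  domain and unspecified outside of it.
\<close>

definition is_multiplier_image :: "(real \<Rightarrow> real) \<Rightarrow> (real \<Rightarrow> real) \<Rightarrow> (real \<Rightarrow> real) \<Rightarrow> bool" where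
  "is_multiplier_image \<sigma> f h \<longleftrightarrow>
     (\<exists>F. is_fourier (\<lambda>x. complex_of_real (f x)) F \<and>
          is_fourier (\<lambda>x. complex_of_real (h x)) (\<lambda>\<xi>. complex_of_real (\<sigma> \<xi>) * F \<xi>))"

definition multiplier_domain :: "(real \<Rightarrow> real) \<Rightarrow> (real \<Rightarrow> real) set" where
  "multiplier_domain \<sigma> = {f. \<exists>h. is_multiplier_image \<sigma> f h}"

definition multiplier :: "(real \<Rightarrow> real) \<Rightarrow> (real \<Rightarrow> real) \<Rightarrow> real \<Rightarrow> real" where
  "multiplier \<sigma> f = (SOME h. is_multiplier_image \<sigma> f h)"

definition multiplier_norm :: "(real \<Rightarrow> real) \<Rightarrow> (real \<Rightarrow> real) \<Rightarrow> ennreal" where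
  "multiplier_norm \<sigma> f =
     (if f \<in> multiplier_domain \<sigma> then ennreal (L2_norm (multiplier \<sigma> f)) else \<infinity>)"

text \<open>\<open>lap_symbol a\<close> is the symbol of \<open>(-\<Delta>)\<^sup>a\<close>, and \<open>m_symbol\<close> that of \<open>\<M>\<close>.\<close>

definition lap_symbol :: "real \<Rightarrow> real \<Rightarrow> real" where
  "lap_symbol a \<xi> = \<bar>\<xi>\<bar> powr (2 * a)"

definition m_symbol :: "real \<Rightarrow> real" where
  "m_symbol \<xi> = (if \<xi> = 0 then 1 else sqrt ((1 + \<xi>\<^sup>2) * (tanh \<xi> / \<xi>)))"

text \<open>
  The two homogeneous spaces are only ever intersected with \<open>L2\<close>, so they are defined inside
  \<open>L2\<close>.
\<close>

definition H_dot_norm :: "real \<Rightarrow> (real \<Rightarrow> real) \<Rightarrow> ennreal" where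
  "H_dot_norm s = multiplier_norm (lap_symbol (s / 2))"

definition H_dot :: "real \<Rightarrow> (real \<Rightarrow> real) set" where
  "H_dot s = {f. H_dot_norm s f < \<infinity>}"

definition N_norm :: "(real \<Rightarrow> real) \<Rightarrow> ennreal" where
  "N_norm = multiplier_norm (\<lambda>\<xi>. lap_symbol (1/4) \<xi> * m_symbol \<xi> powr (1/2))"

definition N_space :: "(real \<Rightarrow> real) set" where
  "N_space = {f. N_norm f < \<infinity>}"

abbreviation time :: "real measure" where
  "time \<equiv> restrict_space lborel {0<..}"

text \<open>
  A function \<open>u\<close> of time and space is written \<open>u t x\<close>; its values at \<open>t \<le> 0\<close> are irrelevant.
\<close>

definition time_space_measurable :: "(real \<Rightarrow> real \<Rightarrow> real) \<Rightarrow> bool" where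
  "time_space_measurable u \<longleftrightarrow> (\<lambda>(t, x). u t x) \<in> borel_measurable (time \<Otimes>\<^sub>M lborel)"

definition Linf_L2 :: "(real \<Rightarrow> real \<Rightarrow> real) set" where
  "Linf_L2 = {u. time_space_measurable u \<and> (\<exists>C. AE t in time. u t \<in> L2 \<and> L2_norm (u t) \<le> C)}"

definition L2_N :: "(real \<Rightarrow> real \<Rightarrow> real) set" where
  "L2_N = {u. time_space_measurable u \<and> (AE t in time. u t \<in> N_space) \<and>
              (\<integral>\<^sup>+ t. (N_norm (u t))\<^sup>2 \<partial>time) < \<infinity>}"

definition Linf_Linf :: "(real \<Rightarrow> real \<Rightarrow> real) set" where
  "Linf_Linf = {u. time_space_measurable u \<and> (\<exists>C. AE t in time. AE x in lborel. \<bar>u t x\<bar> \<le> C)}"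

primrec C_k :: "nat \<Rightarrow> (real \<Rightarrow> real \<Rightarrow> real) \<Rightarrow> bool" where
  "C_k 0 \<phi> \<longleftrightarrow> continuous_on UNIV (\<lambda>(t, x). \<phi> t x)"
| "C_k (Suc k) \<phi> \<longleftrightarrow>
     (\<exists>\<phi>t \<phi>x. (\<forall>t x. ((\<lambda>s. \<phi> s x) has_real_derivative \<phi>t t x) (at t)) \<and>
              (\<forall>t x. ((\<lambda>y. \<phi> t y) has_real_derivative \<phi>x t x) (at x)) \<and>
              C_k k \<phi>t \<and> C_k k \<phi>x)"

text \<open>
  A test function on \<open>[0, \<infinity>) \<times> \<real>\<close>, smooth up to the boundary, is the restriction of a smooth
  compactly supported function on the plane; below, such a function is only evaluated at
  \<open>t \<ge> 0\<close>.
\<close>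

definition test_function :: "(real \<Rightarrow> real \<Rightarrow> real) \<Rightarrow> bool" where
  "test_function \<phi> \<longleftrightarrow> (\<forall>k. C_k k \<phi>) \<and> compact (closure {(t, x). \<phi> t x \<noteq> 0})"

text \<open>
  The integrals are iterated, the inner one being over space: it does not depend on the
  representative that \<open>multiplier\<close> selects at each time.
\<close>

definition weak_solution :: "(real \<Rightarrow> real) \<Rightarrow> (real \<Rightarrow> real \<Rightarrow> real) \<Rightarrow> bool" where
  "weak_solution u0 u \<longleftrightarrow>
     (\<forall>\<phi>. test_function \<phi> \<longrightarrow>
        (LINT t|time. (LINT x|lborel.
            u t x * deriv (\<lambda>s. \<phi> s x) t
          - u t x * multiplier (\<lambda>\<xi>. lap_symbol (1/2) \<xi> * m_symbol \<xi>) (\<phi> t) x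
          - (u t x)\<^sup>2 / 2 * deriv (\<phi> t) x))
        + (LINT x|lborel. u0 x * \<phi> 0 x) = 0)"

end

theory Submission
  imports Defs "HOL-Probability.Probability" "HOL-Computational_Algebra.Polynomial"
begin

text \<open>
  The difference \<open>w\<close> of two bounded solutions solves a linear equation with source \<open>\<partial>\<^sub>x g / 2\<close>, where
  \<open>g = (u + v) w\<close> and hence \<open>\<bar>g\<bar> \<le> M \<bar>w\<bar>\<close>.  Write \<open>\<sigma>(\<xi>) = \<bar>\<xi>\<bar> m(\<xi>)\<close>.  After a Laplace transform in time at
  \<open>l + \<i> s\<close> and a Fourier transform in space the equation reads \<open>(l + \<i> s + \<sigma>(\<xi>)) W = \<i> \<xi> G / 2\<close>.  As \<open>\<sigma>\<close>
  grows like \<open>\<bar>\<xi>\<bar>\<close> to the power \<open>3/2\<close>, a large \<open>l\<close> gives \<open>M \<bar>\<xi>\<bar> \<le> l + \<sigma>(\<xi>)\<close>, so the norm of \<open>M W\<close> is at most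
  half that of \<open>G\<close> for every \<open>s\<close>.  Plancherel in \<open>s\<close> turns this into the same inequality between the
  weighted space-time norms of \<open>M w\<close> and \<open>g\<close>, which forces \<open>w = 0\<close>.
\<close>

section \<open>Square-integrable functions\<close>

text \<open>An energy estimate would take w as its own test function, and a weak solution has no
  time derivative to justify that. The Laplace transform needs only test functions
  \<open>\<eta> t * f x\<close>, and leaves an algebraic inequality at each frequency. It holds for
  all s at once because the modulus of the factor l + i s + \<sigma>(\<xi>) is at least its real
  part. The margin comes from the 1/2 in front of the nonlinearity: the same M bounds |u + v| and is
  beaten by the symbol, so squares give a factor 1/4 where 1 would be borderline. Since the
  multiplier is specified through the L2 Fourier transform, defined as a limit over truncations,
  Plancherel, Parseval, inversion and the existence of a real image for test functions have to be
  proved for that transform. The exponentials in time are not compactly supported and enter through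
  cut-offs.\<close>

lemma norm_mult_le_squares:
  fixes a b :: "'a::real_normed_algebra"
  shows "norm (a * b) \<le> (norm a)\<^sup>2 + (norm b)\<^sup>2"
proof -
  have "norm (a * b) \<le> norm a * norm b" by (rule norm_mult_ineq)
  also have "\<dots> \<le> (norm a)\<^sup>2 + (norm b)\<^sup>2"
    using sum_squares_bound[of "norm a" "norm b"] mult_nonneg_nonneg[of "norm a" "norm b"] by (simp del: mult_nonneg_nonneg)
  finally show ?thesis .
qed

text \<open>Triangle inequality for squares. L2 distances are kept as integrals of squares
  throughout, so this factor 2 takes the place of Minkowski's inequality and fixes the constants in
  the epsilon arguments below.\<close>

lemma norm_add_square_le:
  fixes a b :: "'a::real_normed_vector"
  shows "(norm (a + b))\<^sup>2 \<le> 2 * (norm a)\<^sup>2 + 2 * (norm b)\<^sup>2"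
proof -
  have "(norm (a + b))\<^sup>2 \<le> (norm a + norm b)\<^sup>2"
    by (intro power_mono norm_triangle_ineq) auto
  also have "\<dots> \<le> 2 * (norm a)\<^sup>2 + 2 * (norm b)\<^sup>2"
    using sum_squares_bound[of "norm a" "norm b"] by (simp add: power2_sum)
  finally show ?thesis .
qed

lemma integrable_mult_square_integrable:
  fixes f g :: "'b \<Rightarrow> 'a::{real_normed_algebra, banach, second_countable_topology}"
  assumes [measurable]: "f \<in> borel_measurable M" "g \<in> borel_measurable M"
    and "integrable M (\<lambda>x. (norm (f x))\<^sup>2)" "integrable M (\<lambda>x. (norm (g x))\<^sup>2)"
  shows "integrable M (\<lambda>x. f x * g x)"
  by (rule Bochner_Integration.integrable_bound[OF Bochner_Integration.integrable_add[OF assms(3,4)]])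
    (auto intro: order_trans[OF norm_mult_le_squares])

abbreviation L2_sq :: "(real \<Rightarrow> 'a::real_normed_vector) \<Rightarrow> real" where
  "L2_sq f \<equiv> LBINT x. (norm (f x))\<^sup>2"

abbreviation L2_nn :: "(real \<Rightarrow> 'a::real_normed_vector) \<Rightarrow> ennreal" where
  "L2_nn f \<equiv> \<integral>\<^sup>+x. ennreal ((norm (f x))\<^sup>2) \<partial>lborel"

lemma L2_measurable: "f \<in> L2 \<Longrightarrow> f \<in> borel_measurable borel"
  by (simp add: L2_def)

lemma L2_integrable: "f \<in> L2 \<Longrightarrow> integrable lborel (\<lambda>x. (norm (f x))\<^sup>2)"
  by (simp add: L2_def)

lemma L2_iff_nn_integral:
  "f \<in> L2 \<longleftrightarrow> f \<in> borel_measurable borel \<and> (L2_nn f) < \<infinity>"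
  by (auto simp: L2_def integrable_iff_bounded)

lemma L2_nn_integral:
  "f \<in> L2 \<Longrightarrow> (L2_nn f) = ennreal (L2_sq f)"
  by (intro nn_integral_eq_integral L2_integrable) auto

lemma L2_bound:
  assumes "f \<in> L2" "g \<in> borel_measurable borel" "\<And>x. norm (g x) \<le> C * norm (f x)"
  shows "g \<in> L2"
  unfolding L2_def
proof safe
  show "integrable lborel (\<lambda>x. (norm (g x))\<^sup>2)"
  proof (rule Bochner_Integration.integrable_bound[of _ "\<lambda>x. C\<^sup>2 * (norm (f x))\<^sup>2"])
    have "(norm (g x))\<^sup>2 \<le> C\<^sup>2 * (norm (f x))\<^sup>2" for x
      using power_mono[OF assms(3), of x 2] by (simp add: power_mult_distrib)
    then show "AE x in lborel. norm ((norm (g x))\<^sup>2) \<le> norm (C\<^sup>2 * (norm (f x))\<^sup>2)"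
      by auto
  qed (use assms in \<open>auto intro: L2_integrable\<close>)
qed (use assms in auto)

lemma L2_add:
  assumes "f \<in> L2" "g \<in> L2"
  shows "(\<lambda>x. f x + g x) \<in> L2"
  unfolding L2_def
proof safe
  have m [measurable]: "f \<in> borel_measurable borel" "g \<in> borel_measurable borel"
    using assms by (auto intro: L2_measurable)
  show "integrable lborel (\<lambda>x. (norm (f x + g x))\<^sup>2)"
    by (rule Bochner_Integration.integrable_bound[of _ "\<lambda>x. 2 * (norm (f x))\<^sup>2 + 2 * (norm (g x))\<^sup>2"])
      (use assms norm_add_square_le in \<open>auto intro!: L2_integrable\<close>)
  show "(\<lambda>x. f x + g x) \<in> borel_measurable lborel" by simp
qed

lemma L2_scale: "f \<in> L2 \<Longrightarrow> (\<lambda>x. c * f x) \<in> L2" for f :: "real \<Rightarrow> 'a::{real_normed_field, banach, second_countable_topology}"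
  by (rule L2_bound[of f _ "norm c"]) (auto simp: norm_mult dest: L2_measurable)

lemma L2_diff: "f \<in> L2 \<Longrightarrow> g \<in> L2 \<Longrightarrow> (\<lambda>x. f x - g x) \<in> L2" for f g :: "real \<Rightarrow> 'a::{real_normed_field, banach, second_countable_topology}"
  using L2_add[of f "\<lambda>x. (-1) * g x"] L2_scale[of g "-1"] by simp

lemma L2_mult_integrable:
  fixes f g :: "real \<Rightarrow> 'a::{real_normed_algebra, banach, second_countable_topology}"
  shows "f \<in> L2 \<Longrightarrow> g \<in> L2 \<Longrightarrow> integrable lborel (\<lambda>x. f x * g x)"
  by (intro integrable_mult_square_integrable) (auto dest: L2_measurable L2_integrable)

lemma borel_measurable_cnj [measurable (raw)]:
  "f \<in> borel_measurable M \<Longrightarrow> (\<lambda>x. cnj (f x)) \<in> borel_measurable M"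
  by (rule borel_measurable_continuous_on[OF continuous_on_cnj[OF continuous_on_id], unfolded id_def])

lemma L2_cnj: "f \<in> L2 \<Longrightarrow> (\<lambda>x. cnj (f x)) \<in> L2"
  by (rule L2_bound[of f _ 1]) (auto dest: L2_measurable)

lemma L2_of_real: "f \<in> L2 \<Longrightarrow> (\<lambda>x. complex_of_real (f x)) \<in> L2" for f :: "real \<Rightarrow> real"
  by (rule L2_bound[of f _ 1]) (auto dest: L2_measurable)

lemma L2_Re: "f \<in> L2 \<Longrightarrow> (\<lambda>x. Re (f x)) \<in> L2"
  by (rule L2_bound[of f _ 1]) (auto dest: L2_measurable simp: abs_Re_le_cmod)

lemma L2_reflect: "f \<in> L2 \<Longrightarrow> (\<lambda>x. f (- x)) \<in> L2"
  using lborel_integrable_real_affine_iff[of "-1" "\<lambda>x. (norm (f x))\<^sup>2" 0]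
  by (auto simp: L2_def)

lemma L2_indicator: "f \<in> L2 \<Longrightarrow> A \<in> sets borel \<Longrightarrow> (\<lambda>x. indicator A x *\<^sub>R f x) \<in> L2"
  by (rule L2_bound[of f _ 1]) (auto dest!: L2_measurable simp: indicator_def)

lemma integral_dist_zero_imp_AE_eq:
  fixes f g :: "real \<Rightarrow> 'a::{banach, second_countable_topology}"
  assumes "f \<in> borel_measurable borel" "g \<in> borel_measurable borel"
    and "L2_nn (\<lambda>x. f x - g x) = 0"
  shows "AE x in lborel. f x = g x"
proof -
  have "AE x in lborel. ennreal ((norm (f x - g x))\<^sup>2) = 0"
    using assms by (subst (asm) nn_integral_0_iff_AE) auto
  then show ?thesis by eventually_elim (simp add: ennreal_eq_0_iff)
qed

section \<open>Truncation and approximation by continuous functions\<close>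

lemma L2_indicator_tendsto:
  fixes f :: "real \<Rightarrow> 'a::{banach, second_countable_topology}"
  assumes f: "f \<in> L2" and A: "\<And>n. A n \<in> sets borel"
    and lim: "\<And>x. \<forall>\<^sub>F n in sequentially. x \<in> A n"
  shows "(\<lambda>n. L2_sq (\<lambda>x. f x - indicator (A n) x *\<^sub>R f x)) \<longlonglongrightarrow> 0"
proof -
  note [measurable] = L2_measurable[OF f] A
  have "(\<lambda>n. L2_sq (\<lambda>x. f x - indicator (A n) x *\<^sub>R f x)) \<longlonglongrightarrow> (LINT x|(lborel::real measure). (0::real))"
  proof (rule integral_dominated_convergence[where w="\<lambda>x. (norm (f x))\<^sup>2"])
    show "AE x in lborel. (\<lambda>n. (norm (f x - indicator (A n) x *\<^sub>R f x))\<^sup>2) \<longlonglongrightarrow> 0"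
    proof (rule AE_I2)
      fix x
      show "(\<lambda>n. (norm (f x - indicator (A n) x *\<^sub>R f x))\<^sup>2) \<longlonglongrightarrow> 0"
        by (rule tendsto_eventually) (use lim[of x] in eventually_elim, simp)
    qed
  qed (use L2_integrable[OF f] in \<open>auto simp: indicator_def\<close>)
  then show ?thesis by simp
qed

text \<open>\<open>measurable_on\<close> gives continuous functions converging off a negligible set,
  but without any bound. Clipping them in size and support allows dominated convergence, which turns
  almost everywhere convergence into convergence in L2.\<close>

lemma L2_continuous_approx:
  fixes f :: "real \<Rightarrow> complex"
  assumes f: "f \<in> L2" and e: "e > 0"
  obtains g R where "continuous_on UNIV g" "\<And>x. norm (g x) \<le> R" "\<And>x. \<bar>x\<bar> > R \<Longrightarrow> g x = 0"
    "L2_nn (\<lambda>x. f x - g x) < ennreal e"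
proof -
  note [measurable] = L2_measurable[OF f]
  \<comment> \<open>Cutting domain and range at once makes the truncated function bounded with
    compact support. The two errors e / 4 are doubled by \<open>norm_add_square_le\<close> and add
    up to e.\<close>
  define A where "A n = {x. \<bar>x\<bar> \<le> real n \<and> norm (f x) \<le> real n}" for n
  have A [measurable]: "A n \<in> sets borel" for n unfolding A_def by measurable
  have "\<forall>\<^sub>F n in sequentially. x \<in> A n" for x
  proof -
    obtain N where "max \<bar>x\<bar> (norm (f x)) \<le> real N" using real_arch_simple by blast
    then show ?thesis unfolding A_def eventually_sequentially by (intro exI[of _ N]) auto
  qed
  then have "(\<lambda>n. L2_sq (\<lambda>x. f x - indicator (A n) x *\<^sub>R f x)) \<longlonglongrightarrow> 0"
    by (intro L2_indicator_tendsto f A) auto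
  then have "\<forall>\<^sub>F n in sequentially. (L2_sq (\<lambda>x. f x - indicator (A n) x *\<^sub>R f x)) < e / 4"
    using e by (intro order_tendstoD) auto
  then obtain n where n: "L2_sq (\<lambda>x. f x - indicator (A n) x *\<^sub>R f x) < e / 4"
    by (auto simp: eventually_sequentially)
  define F where "F x = indicator (A n) x *\<^sub>R f x" for x
  have F2: "F \<in> L2" unfolding F_def[abs_def] by (intro L2_indicator f) auto
  note [measurable] = L2_measurable[OF F2]
  have Fn: "norm (F x) \<le> real n" "\<bar>x\<bar> > real n \<Longrightarrow> F x = 0" for x
    by (auto simp: F_def A_def indicator_def)
  have "F measurable_on UNIV"
    by (rule lebesgue_measurable_imp_measurable_on)
      (use \<open>F \<in> borel_measurable borel\<close> in \<open>auto intro!: measurable_completion\<close>)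
  then obtain N g where N: "negligible N" and g: "\<And>k::nat. continuous_on UNIV (g k)"
    and gF: "\<And>x. x \<notin> N \<Longrightarrow> (\<lambda>k. g k x) \<longlonglongrightarrow> F x"
    by (auto simp: measurable_on_def)
  define K where "K = max 1 (real n)"
  \<comment> \<open>Division by \<open>max 1 (norm (g k x) / K)\<close> projects radially onto the
    ball of radius K, and the trapezoid equals 1 on [-n, n] and vanishes outside [-n-1, n+1].
    Neither affects \<open>F\<close>, whose size and support are bounded by n \<le> K.\<close>
  define G where "G k x = (max 0 (min 1 (real n + 1 - \<bar>x\<bar>)) / max 1 (norm (g k x) / K)) *\<^sub>R g k x" for k x
  have K: "K \<ge> 1" "K \<ge> n" by (auto simp: K_def)
  have Gc: "continuous_on UNIV (G k)" for k
    unfolding G_def[abs_def] by (intro continuous_intros g) (use K in auto)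
  have [measurable]: "G k \<in> borel_measurable borel" for k
    using Gc by (rule borel_measurable_continuous_onI)
  have Gb: "norm (G k x) \<le> K" for k x
  proof -
    have *: "norm (g k x) / max 1 (norm (g k x) / K) \<le> K"
      using K by (auto simp: max_def field_simps)
    have "norm (G k x) = max 0 (min 1 (real n + 1 - \<bar>x\<bar>)) * (norm (g k x) / max 1 (norm (g k x) / K))"
      by (simp add: G_def)
    also have "\<dots> \<le> 1 * (norm (g k x) / max 1 (norm (g k x) / K))"
      by (intro mult_right_mono) auto
    finally show ?thesis using * by simp
  qed
  have G0: "G k x = 0" if "\<bar>x\<bar> > K + 1" for k x using that K by (auto simp: G_def)
  have lim: "(\<lambda>k. G k x) \<longlonglongrightarrow> F x" if "x \<notin> N" for x
  proof -
    have "(\<lambda>k. G k x) \<longlonglongrightarrow> (max 0 (min 1 (real n + 1 - \<bar>x\<bar>)) / max 1 (norm (F x) / K)) *\<^sub>R F x"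
      unfolding G_def by (intro tendsto_intros gF that) (use K in auto)
    also have "(max 0 (min 1 (real n + 1 - \<bar>x\<bar>)) / max 1 (norm (F x) / K)) *\<^sub>R F x = F x"
    proof (cases "\<bar>x\<bar> > real n")
      case False
      have "norm (F x) / K \<le> 1" using Fn(1)[of x] K by (simp add: divide_le_eq)
      then show ?thesis using False by simp
    qed (simp add: Fn)
    finally show ?thesis .
  qed
  \<comment> \<open>The negligible set is null for Lebesgue measure, the completion of
    \<open>lborel\<close>; \<open>AE_completion_iff\<close> brings the statement back.\<close>
  have AEN: "AE x in lborel. x \<notin> N"
  proof -
    have "AE x in lebesgue. x \<notin> N" using N by (simp add: negligible_iff_null_sets AE_not_in)
    then show ?thesis by (simp add: AE_completion_iff)
  qed
  have "(\<lambda>k. L2_sq (\<lambda>x. F x - G k x)) \<longlonglongrightarrow> (LINT x|(lborel::real measure). (0::real))"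
  proof (rule integral_dominated_convergence[where w="\<lambda>x. indicator {- (K+1)..K+1} x *\<^sub>R (2 * K)\<^sup>2"])
    show "AE x in lborel. (\<lambda>k. (norm (F x - G k x))\<^sup>2) \<longlonglongrightarrow> 0"
      using AEN
    proof eventually_elim
      case (elim x)
      have "(\<lambda>k. (norm (F x - G k x))\<^sup>2) \<longlonglongrightarrow> (norm (F x - F x))\<^sup>2"
        by (intro tendsto_intros lim elim)
      then show ?case by simp
    qed
    show "AE x in lborel. norm ((norm (F x - G k x))\<^sup>2) \<le> indicator {- (K+1)..K+1} x *\<^sub>R (2 * K)\<^sup>2" for k
    proof (rule AE_I2)
      fix x
      have 1: "norm (F x - G k x) \<le> 2 * K"
        using norm_triangle_ineq4[of "F x" "G k x"] Fn(1)[of x] Gb[of k x] K by linarith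
      have 2: "F x - G k x = 0" if "\<bar>x\<bar> > K + 1" using that Fn(2) G0 K by auto
      show "norm ((norm (F x - G k x))\<^sup>2) \<le> indicator {- (K+1)..K+1} x *\<^sub>R (2 * K)\<^sup>2"
        using 2 power_mono[OF 1, of 2] by (cases "\<bar>x\<bar> > K + 1") (auto simp: indicator_def)
    qed
  qed (auto intro!: integrable_real_indicator integrable_mult_left simp: emeasure_lborel_Icc_eq)
  then have "(\<lambda>k. L2_sq (\<lambda>x. F x - G k x)) \<longlonglongrightarrow> 0" by simp
  then have "\<forall>\<^sub>F k in sequentially. (L2_sq (\<lambda>x. F x - G k x)) < e / 4"
    using e by (intro order_tendstoD) auto
  then obtain k where k: "L2_sq (\<lambda>x. F x - G k x) < e / 4"
    by (auto simp: eventually_sequentially)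
  have G2: "G k \<in> L2"
    unfolding L2_def
  proof safe
    show "integrable lborel (\<lambda>x. (norm (G k x))\<^sup>2)"
    proof (rule Bochner_Integration.integrable_bound[where f="\<lambda>x. indicator {- (K+1)..K+1} x *\<^sub>R K\<^sup>2"])
      have "norm ((norm (G k x))\<^sup>2) \<le> norm (indicator {- (K+1)..K+1} x *\<^sub>R K\<^sup>2)" for x
        using G0[of x k] power_mono[OF Gb, of k x 2] by (cases "\<bar>x\<bar> > K + 1") (auto simp: indicator_def)
      then show "AE x in lborel. norm ((norm (G k x))\<^sup>2) \<le> norm (indicator {- (K+1)..K+1} x *\<^sub>R K\<^sup>2)"
        by simp
    qed (auto intro!: integrable_real_indicator integrable_mult_left simp: emeasure_lborel_Icc_eq)
  qed simp
  have FG2: "(\<lambda>x. F x - G k x) \<in> L2" and fF2: "(\<lambda>x. f x - F x) \<in> L2" and fG2: "(\<lambda>x. f x - G k x) \<in> L2"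
    by (intro L2_diff F2 G2 f)+
  have "L2_sq (\<lambda>x. f x - G k x) \<le> (LBINT x. 2 * (norm (f x - F x))\<^sup>2 + 2 * (norm (F x - G k x))\<^sup>2)"
    using norm_add_square_le[of "f x - F x" "F x - G k x" for x]
    by (intro integral_mono) (auto intro!: L2_integrable FG2 fF2 fG2)
  also have "\<dots> = 2 * L2_sq (\<lambda>x. f x - F x) + 2 * L2_sq (\<lambda>x. F x - G k x)"
    using L2_integrable[OF fF2] L2_integrable[OF FG2] by simp
  also have "\<dots> < e" using n k by (simp add: F_def)
  finally have "L2_sq (\<lambda>x. f x - G k x) < e" .
  then have "L2_nn (\<lambda>x. f x - G k x) < ennreal e"
    unfolding L2_nn_integral[OF fG2] by (intro ennreal_lessI e)
  then show ?thesis
    using Gc G0 by (intro that[of "G k" "K + 1"]) (auto intro: order_trans[OF Gb])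
qed

section \<open>Fourier transform of integrable functions\<close>

lemma integrable_pair_lborelI:
  fixes F :: "real \<Rightarrow> real \<Rightarrow> 'a::{banach, second_countable_topology}"
  assumes [measurable]: "case_prod F \<in> borel_measurable (lborel \<Otimes>\<^sub>M lborel)"
    and "(\<integral>\<^sup>+x. \<integral>\<^sup>+y. ennreal (norm (F x y)) \<partial>lborel \<partial>lborel) < \<infinity>"
  shows "integrable (lborel \<Otimes>\<^sub>M lborel) (case_prod F)"
proof (rule integrableI_bounded)
  have "(\<integral>\<^sup>+z. ennreal (norm (case_prod F z)) \<partial>(lborel \<Otimes>\<^sub>M lborel)) =
      (\<integral>\<^sup>+x. \<integral>\<^sup>+y. ennreal (norm (case_prod F (x, y))) \<partial>lborel \<partial>lborel)"
    by (rule lborel.nn_integral_fst[symmetric]) measurable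
  then show "(\<integral>\<^sup>+z. ennreal (norm (case_prod F z)) \<partial>(lborel \<Otimes>\<^sub>M lborel)) < \<infinity>"
    using assms(2) by simp
qed measurable

lemma integrable_pair_mult:
  fixes f g :: "real \<Rightarrow> complex"
  assumes f: "integrable lborel f" and g: "integrable lborel g"
    and K [measurable]: "case_prod K \<in> borel_measurable (lborel \<Otimes>\<^sub>M lborel)"
    and K1: "\<And>x y. norm (K x y) \<le> 1"
  shows "integrable (lborel \<Otimes>\<^sub>M lborel) (\<lambda>(x, y). K x y * f x * g y)"
proof (rule integrable_pair_lborelI)
  have [measurable]: "f \<in> borel_measurable borel" "g \<in> borel_measurable borel"
    using f g by auto
  show "(\<lambda>(x, y). K x y * f x * g y) \<in> borel_measurable (lborel \<Otimes>\<^sub>M lborel)"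
    by measurable
  have "(\<integral>\<^sup>+x. \<integral>\<^sup>+y. ennreal (norm (K x y * f x * g y)) \<partial>lborel \<partial>lborel)
      \<le> (\<integral>\<^sup>+x. \<integral>\<^sup>+y. ennreal (norm (f x)) * ennreal (norm (g y)) \<partial>lborel \<partial>lborel)"
    by (intro nn_integral_mono)
      (auto simp: norm_mult ennreal_mult[symmetric] intro!: ennreal_leI mult_right_mono mult_left_le_one_le K1)
  also have "\<dots> = (\<integral>\<^sup>+x. ennreal (norm (f x)) \<partial>lborel) * (\<integral>\<^sup>+y. ennreal (norm (g y)) \<partial>lborel)"
    by (simp add: nn_integral_cmult nn_integral_multc)
  also have "\<dots> < \<infinity>"
    using f g by (simp add: integrable_iff_bounded ennreal_mult_less_top)
  finally show "(\<integral>\<^sup>+x. \<integral>\<^sup>+y. ennreal (norm (K x y * f x * g y)) \<partial>lborel \<partial>lborel) < \<infinity>" .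
qed

text \<open>The Bochner integral of a nonintegrable function is 0, which is why the scaling,
  translation and conjugation rules carry no integrability hypothesis.\<close>

definition fourier :: "(real \<Rightarrow> complex) \<Rightarrow> real \<Rightarrow> complex" where
  "fourier f \<xi> = (LBINT x. cis (- (\<xi> * x)) * f x)"

lemma borel_measurable_cis [measurable (raw)]:
  "f \<in> borel_measurable M \<Longrightarrow> (\<lambda>x. cis (f x)) \<in> borel_measurable M"
  by (rule borel_measurable_continuous_on[of cis]) (auto intro!: continuous_intros)

lemma integrable_cis_mult:
  fixes f :: "real \<Rightarrow> complex"
  assumes "integrable lborel f" "c \<in> borel_measurable borel"
  shows "integrable lborel (\<lambda>x. cis (c x) * f x)"
  by (rule Bochner_Integration.integrable_bound[OF assms(1)])
    (use assms in \<open>auto simp: norm_mult\<close>)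

lemma integrable_fourier_kernel:
  fixes f :: "real \<Rightarrow> complex"
  shows "integrable lborel f \<Longrightarrow> integrable lborel (\<lambda>x. cis (- (\<xi> * x)) * f x)"
  by (rule integrable_cis_mult) auto

lemma borel_measurable_fourier [measurable]:
  assumes [measurable]: "f \<in> borel_measurable borel"
  shows "fourier f \<in> borel_measurable borel"
  unfolding fourier_def[abs_def]
  by (rule lborel.borel_measurable_lebesgue_integral) measurable

lemma norm_fourier_le: "norm (fourier f \<xi>) \<le> (LBINT x. norm (f x))"
  unfolding fourier_def
  by (rule order_trans[OF integral_norm_bound]) (simp add: norm_mult)

lemma fourier_diff:
  "integrable lborel f \<Longrightarrow> integrable lborel g \<Longrightarrow> fourier (\<lambda>x. f x - g x) \<xi> = fourier f \<xi> - fourier g \<xi>"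
  unfolding fourier_def by (simp add: right_diff_distrib integrable_fourier_kernel)

text \<open>Fubini for the kernel \<open>cis (- (\<xi> * x))\<close>, symmetric in its two
  variables. It shifts the transform onto a Gaussian for Plancherel, and onto a test function for
  inversion.\<close>

lemma fourier_mult_formula:
  assumes f: "integrable lborel f" and g: "integrable lborel g"
  shows "(LBINT \<xi>. fourier f \<xi> * g \<xi>) = (LBINT x. f x * fourier g x)"
proof -
  have "integrable (lborel \<Otimes>\<^sub>M lborel) (\<lambda>(x, \<xi>). cis (- (\<xi> * x)) * f x * g \<xi>)"
    by (rule integrable_pair_mult[OF f g]) auto
  from lborel_pair.Fubini_integral[OF this]
  have "(LBINT \<xi>. LINT x|lborel. cis (- (\<xi> * x)) * f x * g \<xi>) =
      (LBINT x. LINT \<xi>|lborel. cis (- (\<xi> * x)) * f x * g \<xi>)" .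
  moreover have "(LBINT x. cis (- (\<xi> * x)) * f x * g \<xi>) = fourier f \<xi> * g \<xi>" for \<xi>
    unfolding fourier_def by (rule integral_mult_left_zero)
  moreover have "(LBINT \<xi>. cis (- (\<xi> * x)) * f x * g \<xi>) = f x * fourier g x" for x
  proof -
    have "(LBINT \<xi>. cis (- (\<xi> * x)) * f x * g \<xi>) = (LBINT \<xi>. f x * (cis (- (x * \<xi>)) * g \<xi>))"
      by (simp add: mult_ac)
    then show ?thesis unfolding fourier_def by (simp only: integral_mult_right_zero)
  qed
  ultimately show ?thesis by (simp only:)
qed

lemma fourier_affine:
  assumes "c \<noteq> 0"
  shows "fourier (\<lambda>x. f (c * x)) \<xi> = fourier f (\<xi> / c) / \<bar>c\<bar>"
proof -
  have "fourier f (\<xi> / c) = \<bar>c\<bar> *\<^sub>R (LBINT x. cis (- (\<xi> / c * (0 + c * x))) * f (0 + c * x))"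
    unfolding fourier_def by (rule lborel_integral_real_affine) fact
  also have "\<dots> = \<bar>c\<bar> *\<^sub>R fourier (\<lambda>x. f (c * x)) \<xi>"
    using assms by (simp add: fourier_def)
  finally show ?thesis using assms by (simp add: scaleR_conv_of_real)
qed

lemma fourier_translate: "fourier (\<lambda>x. f (a + x)) \<xi> = cis (\<xi> * a) * fourier f \<xi>"
proof -
  have "fourier f \<xi> = (LBINT x. cis (- (\<xi> * (a + 1 * x))) * f (a + 1 * x))"
    unfolding fourier_def by (subst lborel_integral_real_affine[of 1 _ a]) auto
  also have "\<dots> = (LBINT x. cis (- (\<xi> * a)) * (cis (- (\<xi> * x)) * f (a + x)))"
    by (simp only: mult.assoc[symmetric] cis_mult) (simp add: distrib_left)
  also have "\<dots> = cis (- (\<xi> * a)) * fourier (\<lambda>x. f (a + x)) \<xi>"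
    unfolding fourier_def by (rule integral_mult_right_zero)
  finally show ?thesis by (simp only: mult.assoc[symmetric] cis_mult) simp
qed

section \<open>Gaussians\<close>

lemma fourier_std_normal:
  "fourier (\<lambda>x. complex_of_real (std_normal_density x)) \<xi> = complex_of_real (exp (- \<xi>\<^sup>2 / 2))"
proof -
  \<comment> \<open>The kernel of \<open>char\<close> is exp (i t x), hence the argument -
    \<xi>.\<close>
  have "char std_normal_distribution (- \<xi>) = complex_of_real (exp (- \<xi>\<^sup>2 / 2))"
    by (simp add: char_std_normal_distribution)
  moreover have "char std_normal_distribution (- \<xi>) = (LBINT x. std_normal_density x *\<^sub>R cis (- (\<xi> * x)))"
    unfolding char_def
    by (subst integral_density) (simp_all add: cis_conv_exp normal_density_nonneg del: of_real_minus of_real_mult)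
  ultimately show ?thesis
    by (simp add: fourier_def scaleR_conv_of_real mult.commute)
qed

text \<open>Written as 2 pi times the normal density of standard deviation s, the transform is an
  approximate identity of mass 2 pi as s tends to 0. This mass is the constant in Plancherel's
  formula.\<close>

lemma fourier_gaussian:
  assumes "s > 0"
  shows "fourier (\<lambda>x. complex_of_real (exp (- (s * x)\<^sup>2 / 2))) \<xi>
    = complex_of_real (2 * pi / s * std_normal_density (\<xi> / s))"
proof -
  have eq: "(\<lambda>x. complex_of_real (exp (- (s * x)\<^sup>2 / 2)))
      = (\<lambda>x. complex_of_real (sqrt (2 * pi)) * complex_of_real (std_normal_density (s * x)))"
    by (auto simp: std_normal_density_def fun_eq_iff)
  have "fourier (\<lambda>x. complex_of_real (exp (- (s * x)\<^sup>2 / 2))) \<xi>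
    = sqrt (2 * pi) * fourier (\<lambda>x. complex_of_real (std_normal_density (s * x))) \<xi>"
    unfolding eq unfolding fourier_def
    by (subst mult.left_commute) simp
  also have "\<dots> = sqrt (2 * pi) * (exp (- (\<xi> / s)\<^sup>2 / 2) / s)"
    using assms by (subst fourier_affine[of s "\<lambda>x. complex_of_real (std_normal_density x)"]) (auto simp: fourier_std_normal)
  also have "sqrt (2 * pi) * (exp (- (\<xi> / s)\<^sup>2 / 2) / s) = 2 * pi / s * std_normal_density (\<xi> / s)"
  proof -
    have "2 * pi = sqrt (2 * pi) * sqrt (2 * pi)" by simp
    then have *: "2 * pi / sqrt (2 * pi) = sqrt (2 * pi)" by (simp add: field_simps)
    have "2 * pi / s * std_normal_density (\<xi> / s)
        = (2 * pi / sqrt (2 * pi)) * (exp (- (\<xi> / s)\<^sup>2 / 2) / s)"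
      unfolding std_normal_density_def by (simp add: mult.commute)
    then show ?thesis by (simp only: *)
  qed
  finally show ?thesis by (simp only: of_real_mult of_real_divide)
qed

lemma integrable_gaussian:
  assumes "s > 0"
  shows "integrable lborel (\<lambda>x. complex_of_real (exp (- (s * x)\<^sup>2 / 2)))"
proof -
  have "integrable lborel (\<lambda>x. std_normal_density (0 + s * x))"
    using assms by (intro lborel_integrable_real_affine) auto
  then have "integrable lborel (\<lambda>x. sqrt (2 * pi) * std_normal_density (0 + s * x))"
    by (rule integrable_mult_right)
  then show ?thesis by (simp add: std_normal_density_def)
qed

section \<open>Translations, autocorrelation and Plancherel's formula\<close>

lemma nn_integral_lborel_translate:
  fixes a :: real
  assumes "f \<in> borel_measurable borel"
  shows "(\<integral>\<^sup>+x. f (x + a) \<partial>lborel) = (\<integral>\<^sup>+x. f x \<partial>lborel)"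
  using nn_integral_real_affine[OF assms, of 1 a] by (simp add: add.commute)

lemma L2_translate:
  assumes "f \<in> L2" shows "(\<lambda>x. f (x + a)) \<in> L2"
  using assms nn_integral_lborel_translate[of "\<lambda>x. ennreal ((norm (f x))\<^sup>2)" a]
  by (auto simp: L2_iff_nn_integral)

text \<open>For continuous functions of compact support this is dominated convergence; the general
  case follows by density, since translation preserves the norm.\<close>

lemma L2_translation_continuous:
  fixes f :: "real \<Rightarrow> complex" and s :: "nat \<Rightarrow> real"
  assumes f: "f \<in> L2" and s: "s \<longlonglongrightarrow> 0"
  shows "(\<lambda>n. L2_sq (\<lambda>x. f (x + s n) - f x)) \<longlonglongrightarrow> 0"
proof (rule LIMSEQ_I)
  fix r :: real assume r: "r > 0"
  note [measurable] = L2_measurable[OF f]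
  \<comment> \<open>The three terms of the final estimate cost at most 4 r / 16, 4 r / 8 and 2 r /
    16, together 7 r / 8.\<close>
  obtain g R where g: "continuous_on UNIV g" and gR: "\<And>x. norm (g x) \<le> R" "\<And>x. \<bar>x\<bar> > R \<Longrightarrow> g x = 0"
    and fg: "L2_nn (\<lambda>x. f x - g x) < ennreal (r / 16)"
    using L2_continuous_approx[OF f, of "r / 16"] r by auto
  have R: "R \<ge> 0" using gR(1)[of 0] norm_ge_zero order_trans by blast
  have [measurable]: "g \<in> borel_measurable borel" using g by (rule borel_measurable_continuous_onI)
  have fg2: "(\<lambda>x. f x - g x) \<in> L2"
    unfolding L2_iff_nn_integral using fg by (auto intro: order_less_trans)
  have fgt2: "(\<lambda>x. f (x + a) - g (x + a)) \<in> L2" for a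
    using L2_translate[OF fg2] .
  have g2: "g \<in> L2" using L2_diff[OF f fg2] by simp
  have gt2: "(\<lambda>x. g (x + a) - g x) \<in> L2" for a
    using L2_diff[OF L2_translate[OF g2] g2] .
  have ft2: "(\<lambda>x. f (x + a) - f x) \<in> L2" for a
    using L2_diff[OF L2_translate[OF f] f] .
  have fgi: "L2_sq (\<lambda>x. f x - g x) < r / 16"
    using fg r unfolding L2_nn_integral[OF fg2] by (simp add: ennreal_less_iff)
  have fgti: "L2_sq (\<lambda>x. f (x + a) - g (x + a)) < r / 16" for a
    using lborel_integral_real_affine[of 1 "\<lambda>x. (norm (f x - g x))\<^sup>2" a] fgi by (simp add: add.commute)
  \<comment> \<open>Once the shifts are below 1, all the differences of g live on [-R - 1, R + 1],
    which supplies the dominating function.\<close>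
  obtain N0 where N0: "\<And>n. n \<ge> N0 \<Longrightarrow> norm (s n) < 1"
    using LIMSEQ_D[OF s, of 1] by auto
  have "(\<lambda>n. L2_sq (\<lambda>x. g (x + s (n + N0)) - g x)) \<longlonglongrightarrow> (LINT x|(lborel::real measure). (0::real))"
  proof (rule integral_dominated_convergence[where w="\<lambda>x. indicator {- (R+1)..R+1} x *\<^sub>R (2 * R)\<^sup>2"])
    show "AE x in lborel. (\<lambda>n. (norm (g (x + s (n + N0)) - g x))\<^sup>2) \<longlonglongrightarrow> 0"
    proof (rule AE_I2)
      fix x
      have "(\<lambda>n. x + s (n + N0)) \<longlonglongrightarrow> x + 0"
        by (intro tendsto_intros LIMSEQ_ignore_initial_segment s)
      then have "(\<lambda>n. g (x + s (n + N0))) \<longlonglongrightarrow> g x"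
        using g by (intro continuous_on_tendsto_compose[OF g]) auto
      then have "(\<lambda>n. (norm (g (x + s (n + N0)) - g x))\<^sup>2) \<longlonglongrightarrow> (norm (g x - g x))\<^sup>2"
        by (intro tendsto_intros)
      then show "(\<lambda>n. (norm (g (x + s (n + N0)) - g x))\<^sup>2) \<longlonglongrightarrow> 0" by simp
    qed
    show "AE x in lborel. norm ((norm (g (x + s (n + N0)) - g x))\<^sup>2) \<le> indicator {- (R+1)..R+1} x *\<^sub>R (2 * R)\<^sup>2" for n
    proof (rule AE_I2)
      fix x
      have 1: "norm (g (x + s (n + N0)) - g x) \<le> 2 * R"
        using norm_triangle_ineq4[of "g (x + s (n + N0))" "g x"] gR(1)[of x] gR(1)[of "x + s (n + N0)"] by linarith
      have 2: "g (x + s (n + N0)) - g x = 0" if "\<bar>x\<bar> > R + 1"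
        using that gR(2) N0[of "n + N0"] by auto
      show "norm ((norm (g (x + s (n + N0)) - g x))\<^sup>2) \<le> indicator {- (R+1)..R+1} x *\<^sub>R (2 * R)\<^sup>2"
        using 2 power_mono[OF 1, of 2] by (cases "\<bar>x\<bar> > R + 1") (auto simp: indicator_def)
    qed
  qed (auto intro!: integrable_real_indicator integrable_mult_left simp: emeasure_lborel_Icc_eq)
  then have "(\<lambda>n. L2_sq (\<lambda>x. g (x + s n) - g x)) \<longlonglongrightarrow> 0"
    using LIMSEQ_offset[of "\<lambda>n. LINT x|lborel. (norm (g (x + s n) - g x))\<^sup>2" N0] by simp
  from LIMSEQ_D[OF this, of "r / 8"] r obtain N where
    N: "\<And>n. n \<ge> N \<Longrightarrow> (L2_sq (\<lambda>x. g (x + s n) - g x)) < r / 8"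
    by auto
  show "\<exists>no. \<forall>n\<ge>no. norm ((L2_sq (\<lambda>x. f (x + s n) - f x)) - 0) < r"
  proof (intro exI allI impI)
    fix n assume n: "n \<ge> N"
    have "(norm (f (x + s n) - f x))\<^sup>2 \<le> 4 * (norm (f (x + s n) - g (x + s n)))\<^sup>2
        + 4 * (norm (g (x + s n) - g x))\<^sup>2 + 2 * (norm (f x - g x))\<^sup>2" for x
    proof -
      have "(norm (f (x + s n) - f x))\<^sup>2
          = (norm (((f (x + s n) - g (x + s n)) + (g (x + s n) - g x)) + (g x - f x)))\<^sup>2" by simp
      also have "\<dots> \<le> 2 * (norm ((f (x + s n) - g (x + s n)) + (g (x + s n) - g x)))\<^sup>2 + 2 * (norm (g x - f x))\<^sup>2"
        by (rule norm_add_square_le)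
      also have "(norm ((f (x + s n) - g (x + s n)) + (g (x + s n) - g x)))\<^sup>2
          \<le> 2 * (norm (f (x + s n) - g (x + s n)))\<^sup>2 + 2 * (norm (g (x + s n) - g x))\<^sup>2"
        by (rule norm_add_square_le)
      finally show ?thesis by (simp add: norm_minus_commute)
    qed
    then have "L2_sq (\<lambda>x. f (x + s n) - f x) \<le>
      (LBINT x. 4 * (norm (f (x + s n) - g (x + s n)))\<^sup>2
        + 4 * (norm (g (x + s n) - g x))\<^sup>2 + 2 * (norm (f x - g x))\<^sup>2)"
      by (intro integral_mono Bochner_Integration.integrable_add integrable_mult_right L2_integrable ft2 fgt2 gt2 fg2)
    also have "\<dots> = 4 * L2_sq (\<lambda>x. f (x + s n) - g (x + s n))
        + 4 * L2_sq (\<lambda>x. g (x + s n) - g x) + 2 * L2_sq (\<lambda>x. f x - g x)"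
      using L2_integrable[OF fgt2[of "s n"]] L2_integrable[OF gt2[of "s n"]] L2_integrable[OF fg2] by simp
    also have "\<dots> < r" using N[OF n] fgti[of "s n"] fgi r by linarith
    finally show "norm ((L2_sq (\<lambda>x. f (x + s n) - f x)) - 0) < r"
      by simp
  qed
qed

text \<open>Its transform is the squared modulus of \<open>fourier f\<close> and its value at 0 is
  the squared norm of f, so Plancherel's formula is Fourier inversion for this one function at this
  one point.\<close>

definition autocorrelation :: "(real \<Rightarrow> complex) \<Rightarrow> real \<Rightarrow> complex" where
  "autocorrelation f z = (LBINT x. f (x + z) * cnj (f x))"

lemma integrable_autocorrelation_kernel:
  fixes f :: "real \<Rightarrow> complex"
  assumes f: "integrable lborel f"
  shows "integrable (lborel \<Otimes>\<^sub>M lborel) (\<lambda>(x, z). f (x + z) * cnj (f x))"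
proof (rule integrable_pair_lborelI)
  have [measurable]: "f \<in> borel_measurable borel" using f by auto
  show "(\<lambda>(x, z). f (x + z) * cnj (f x)) \<in> borel_measurable (lborel \<Otimes>\<^sub>M lborel)"
    by measurable
  have "(\<integral>\<^sup>+x. \<integral>\<^sup>+z. ennreal (norm (f (x + z) * cnj (f x))) \<partial>lborel \<partial>lborel)
      = (\<integral>\<^sup>+x. (\<integral>\<^sup>+z. ennreal (norm (f (z + x))) \<partial>lborel) * ennreal (norm (f x)) \<partial>lborel)"
    by (simp add: norm_mult ennreal_mult nn_integral_multc add.commute)
  also have "\<dots> = (\<integral>\<^sup>+z. ennreal (norm (f z)) \<partial>lborel) * (\<integral>\<^sup>+x. ennreal (norm (f x)) \<partial>lborel)"
    by (subst nn_integral_lborel_translate[of "\<lambda>x. ennreal (norm (f x))"]) (auto simp: nn_integral_cmult)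
  also have "\<dots> < \<infinity>"
    using f by (simp add: integrable_iff_bounded ennreal_mult_less_top)
  finally show "(\<integral>\<^sup>+x. \<integral>\<^sup>+z. ennreal (norm (f (x + z) * cnj (f x))) \<partial>lborel \<partial>lborel) < \<infinity>" .
qed

lemma integrable_autocorrelation:
  assumes f: "integrable lborel f"
  shows "integrable lborel (autocorrelation f)"
  using lborel_pair.integrable_snd[OF integrable_autocorrelation_kernel[OF f]]
  by (simp add: autocorrelation_def[abs_def])

lemma fourier_cnj: "cnj (fourier f \<xi>) = (LBINT x. cis (\<xi> * x) * cnj (f x))"
  unfolding fourier_def by (subst Bochner_Integration.integral_cnj[symmetric]) (simp add: cis_cnj)

lemma fourier_autocorrelation:
  assumes f: "integrable lborel f"
  shows "fourier (autocorrelation f) \<xi> = complex_of_real ((norm (fourier f \<xi>))\<^sup>2)"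
proof -
  have [measurable]: "f \<in> borel_measurable borel" using f by auto
  have "integrable (lborel \<Otimes>\<^sub>M lborel) (\<lambda>(x, z). cis (- (\<xi> * z)) * (f (x + z) * cnj (f x)))"
    by (rule Bochner_Integration.integrable_bound[OF integrable_autocorrelation_kernel[OF f]])
      (auto simp: norm_mult)
  from lborel_pair.Fubini_integral[OF this]
  have "(LBINT z. LINT x|lborel. cis (- (\<xi> * z)) * (f (x + z) * cnj (f x)))
      = (LBINT x. LINT z|lborel. cis (- (\<xi> * z)) * (f (x + z) * cnj (f x)))" .
  moreover have "(LBINT x. cis (- (\<xi> * z)) * (f (x + z) * cnj (f x)))
      = cis (- (\<xi> * z)) * autocorrelation f z" for z
    unfolding autocorrelation_def by (rule integral_mult_right_zero)
  moreover have "(LBINT z. cis (- (\<xi> * z)) * (f (x + z) * cnj (f x)))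
      = fourier f \<xi> * (cis (\<xi> * x) * cnj (f x))" for x
  proof -
    have "(LBINT z. cis (- (\<xi> * z)) * (f (x + z) * cnj (f x)))
        = (LBINT z. cis (- (\<xi> * z)) * f (x + z)) * cnj (f x)"
      by (simp only: mult.assoc[symmetric] integral_mult_left_zero)
    also have "\<dots> = fourier (\<lambda>z. f (x + z)) \<xi> * cnj (f x)" by (simp add: fourier_def)
    finally show ?thesis by (simp add: fourier_translate)
  qed
  ultimately have "fourier (autocorrelation f) \<xi> = (LBINT x. fourier f \<xi> * (cis (\<xi> * x) * cnj (f x)))"
    by (simp only: fourier_def)
  also have "\<dots> = fourier f \<xi> * cnj (fourier f \<xi>)"
    by (simp only: fourier_cnj integral_mult_right_zero)
  finally show ?thesis by (simp only: complex_norm_square)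
qed

text \<open>Polarisation: continuity of the real part at 0 becomes the continuity of translations in
  L2.\<close>

lemma Re_autocorrelation:
  assumes f: "f \<in> L2"
  shows "Re (autocorrelation f z)
    = L2_sq f - L2_sq (\<lambda>x. f (x + z) - f x) / 2"
proof -
  have ft: "(\<lambda>x. f (x + z)) \<in> L2" by (rule L2_translate[OF f])
  have int: "integrable lborel (\<lambda>x. f (x + z) * cnj (f x))"
    by (intro L2_mult_integrable ft L2_cnj f)
  have "(norm (a - b))\<^sup>2 = (norm a)\<^sup>2 + (norm b)\<^sup>2 - 2 * Re (a * cnj b)" for a b :: complex
    unfolding cmod_power2 by (simp add: power2_eq_square algebra_simps)
  then have "L2_sq (\<lambda>x. f (x + z) - f x)
      = (LBINT x. (norm (f (x + z)))\<^sup>2 + (norm (f x))\<^sup>2 - 2 * Re (f (x + z) * cnj (f x)))"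
    by (simp only:)
  also have "\<dots> = L2_sq (\<lambda>x. f (x + z)) + L2_sq f
      - 2 * Re (autocorrelation f z)"
    unfolding autocorrelation_def
    using L2_integrable[OF f] L2_integrable[OF ft] integral_Re[OF int] integrable_Re[OF int]
    by (simp del: times_complex.sel)
  also have "L2_sq (\<lambda>x. f (x + z)) = L2_sq f"
    using lborel_integral_real_affine[of 1 "\<lambda>x. (norm (f x))\<^sup>2" z] by (simp add: add.commute)
  finally show ?thesis by linarith
qed

text \<open>Nothing is known beforehand about the finiteness of the left side, so it is damped by a
  Gaussian. \<open>fourier_mult_formula\<close> turns the damped integral into 2 pi times an average
  of the autocorrelation against a normal density of width s. As s decreases to 0, monotone
  convergence removes the damping and the average tends to the value at 0.\<close>

theorem plancherel_L1_L2:
  assumes f: "integrable lborel f" and f2: "f \<in> L2"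
  shows "L2_nn (fourier f)
    = ennreal (2 * pi * L2_sq f)"
proof -
  note [measurable] = L2_measurable[OF f2]
  define s where "s n = 1 / real (Suc n)" for n
  have s0: "s n > 0" for n by (simp add: s_def)
  have slim: "s \<longlonglongrightarrow> 0" unfolding s_def[abs_def] by (rule LIMSEQ_Suc[OF lim_1_over_n])
  define c where "c z = Re (autocorrelation f z)" for z
  define E where "E = L2_sq f"
  have [measurable]: "c \<in> borel_measurable borel"
    using integrable_autocorrelation[OF f] unfolding c_def[abs_def] by auto
  \<comment> \<open>The squared distance of f to a translate lies between 0 and 4 E, so
    \<open>c\<close> stays in [-E, E]; this dominates the averages below.\<close>
  have cE: "c z \<le> E" "\<bar>c z\<bar> \<le> E" for z
  proof -
    have "L2_sq (\<lambda>x. f (x + z) - f x) \<le> (LBINT x. 2 * (norm (f (x + z)))\<^sup>2 + 2 * (norm (f x))\<^sup>2)"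
      by (intro integral_mono Bochner_Integration.integrable_add integrable_mult_right L2_integrable
          L2_diff[OF L2_translate[OF f2] f2] L2_translate f2)
        (use norm_add_square_le[of "f (x + z)" "- f x" for x] in simp)
    also have "\<dots> = 4 * E"
      using L2_integrable[OF f2] L2_integrable[OF L2_translate[OF f2, of z]]
        lborel_integral_real_affine[of 1 "\<lambda>x. (norm (f x))\<^sup>2" z] by (simp add: add.commute E_def)
    finally have "L2_sq (\<lambda>x. f (x + z) - f x) \<le> 4 * E" .
    moreover have "0 \<le> L2_sq (\<lambda>x. f (x + z) - f x)" by (rule integral_nonneg_AE) simp
    ultimately show "c z \<le> E" "\<bar>c z\<bar> \<le> E"
      unfolding c_def Re_autocorrelation[OF f2] E_def by linarith+
  qed
  have clim: "(\<lambda>n. c (s n * z)) \<longlonglongrightarrow> E" for z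
  proof -
    have "(\<lambda>n. s n * z) \<longlonglongrightarrow> 0" using tendsto_mult_left_zero[OF slim, of z] .
    from L2_translation_continuous[OF f2 this]
    have "(\<lambda>n. E - L2_sq (\<lambda>x. f (x + s n * z) - f x) / 2) \<longlonglongrightarrow> E - 0 / 2"
      by (intro tendsto_intros) auto
    then show ?thesis unfolding c_def Re_autocorrelation[OF f2] E_def by simp
  qed
  have gauss: "has_bochner_integral lborel (\<lambda>\<xi>. (norm (fourier f \<xi>))\<^sup>2 * exp (- (s n * \<xi>)\<^sup>2 / 2))
      (2 * pi * (LBINT z. c (s n * z) * std_normal_density z))" for n
  proof -
    let ?g = "\<lambda>x. complex_of_real (exp (- (s n * x)\<^sup>2 / 2))"
    have "(LBINT \<xi>. fourier (autocorrelation f) \<xi> * ?g \<xi>)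
        = (LBINT z. autocorrelation f z * fourier ?g z)"
      by (rule fourier_mult_formula[OF integrable_autocorrelation[OF f] integrable_gaussian[OF s0]])
    also have "\<dots> = (LBINT z. autocorrelation f z * complex_of_real (2 * pi / s n * std_normal_density (z / s n)))"
      by (simp only: fourier_gaussian[OF s0])
    \<comment> \<open>Rescaling by \<open>s n\<close> moves the width from the density to the
      autocorrelation, so that the density stays fixed as n grows.\<close>
    also have "\<dots> = s n *\<^sub>R (LBINT z. autocorrelation f (0 + s n * z) * complex_of_real (2 * pi / s n * std_normal_density ((0 + s n * z) / s n)))"
      using s0[of n] by (subst lborel_integral_real_affine[of "s n" _ 0]) auto
    also have "\<dots> = complex_of_real (s n) * (LBINT z. complex_of_real (2 * pi / s n) * (autocorrelation f (s n * z) * complex_of_real (std_normal_density z)))"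
      using s0[of n] by (simp add: scaleR_conv_of_real mult_ac)
    also have "\<dots> = complex_of_real (2 * pi) * (LBINT z. autocorrelation f (s n * z) * complex_of_real (std_normal_density z))"
      using s0[of n] by (simp only: integral_mult_right_zero) simp
    finally have eq: "(LBINT \<xi>. fourier (autocorrelation f) \<xi> * ?g \<xi>)
      = complex_of_real (2 * pi) * (LBINT z. autocorrelation f (s n * z) * complex_of_real (std_normal_density z))" .
    have i1: "integrable lborel (\<lambda>\<xi>. (norm (fourier f \<xi>))\<^sup>2 * exp (- (s n * \<xi>)\<^sup>2 / 2))"
    proof (rule Bochner_Integration.integrable_bound)
      show "integrable lborel (\<lambda>\<xi>. complex_of_real ((LBINT x. norm (f x))\<^sup>2) * ?g \<xi>)"
        by (intro integrable_mult_right integrable_gaussian s0)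
      have "(norm (fourier f \<xi>))\<^sup>2 \<le> (LBINT x. norm (f x))\<^sup>2" for \<xi>
        by (intro power_mono norm_fourier_le) auto
      then show "AE \<xi> in lborel. norm ((norm (fourier f \<xi>))\<^sup>2 * exp (- (s n * \<xi>)\<^sup>2 / 2)) \<le>
          norm (complex_of_real ((LBINT x. norm (f x))\<^sup>2) * ?g \<xi>)"
        by (auto simp: norm_mult intro!: mult_right_mono simp del: of_real_power)
    qed measurable
    have i2: "integrable lborel (\<lambda>z. autocorrelation f (s n * z) * complex_of_real (std_normal_density z))"
    proof (rule Bochner_Integration.integrable_bound[where f="\<lambda>z. autocorrelation f (0 + s n * z)"])
      show "integrable lborel (\<lambda>z. autocorrelation f (0 + s n * z))"
        using s0[of n] integrable_autocorrelation[OF f] by (intro lborel_integrable_real_affine) auto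
      have "std_normal_density z \<le> 1" for z
      proof -
        have "1 \<le> sqrt (2 * pi)" using pi_gt3 by simp
        moreover have "exp (- z\<^sup>2 / 2) \<le> 1" by simp
        ultimately show ?thesis unfolding std_normal_density_def
          using mult_mono[of "1 / sqrt (2 * pi)" 1 "exp (- z\<^sup>2 / 2)" 1] by simp
      qed
      then show "AE z in lborel. norm (autocorrelation f (s n * z) * complex_of_real (std_normal_density z))
          \<le> norm (autocorrelation f (0 + s n * z))"
        by (auto simp: norm_mult normal_density_nonneg intro!: mult_right_le_one_le)
      show "(\<lambda>z. autocorrelation f (s n * z) * complex_of_real (std_normal_density z)) \<in> borel_measurable lborel"
        using integrable_autocorrelation[OF f, THEN borel_measurable_integrable] by simp
    qed
    have "complex_of_real (LBINT \<xi>. (norm (fourier f \<xi>))\<^sup>2 * exp (- (s n * \<xi>)\<^sup>2 / 2))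
        = (LBINT \<xi>. fourier (autocorrelation f) \<xi> * ?g \<xi>)"
      by (simp only: fourier_autocorrelation[OF f] integral_complex_of_real[symmetric] of_real_mult)
    also note eq
    finally have "(LBINT \<xi>. (norm (fourier f \<xi>))\<^sup>2 * exp (- (s n * \<xi>)\<^sup>2 / 2))
      = Re (complex_of_real (2 * pi) * (LBINT z. autocorrelation f (s n * z) * complex_of_real (std_normal_density z)))"
      using Re_complex_of_real[of "LINT \<xi>|lborel. (norm (fourier f \<xi>))\<^sup>2 * exp (- (s n * \<xi>)\<^sup>2 / 2)"] by (simp only:)
    also have "\<dots> = 2 * pi * (LBINT z. c (s n * z) * std_normal_density z)"
    proof -
      have "Re (LBINT z. autocorrelation f (s n * z) * complex_of_real (std_normal_density z))
          = (LBINT z. c (s n * z) * std_normal_density z)"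
        unfolding c_def by (subst integral_Re[OF i2, symmetric]) simp
      then show ?thesis by simp
    qed
    finally show ?thesis using i1 by (simp add: has_bochner_integral_iff)
  qed
  have "(\<lambda>n. \<integral>\<^sup>+\<xi>. ennreal ((norm (fourier f \<xi>))\<^sup>2 * exp (- (s n * \<xi>)\<^sup>2 / 2)) \<partial>lborel)
      \<longlonglongrightarrow> (L2_nn (fourier f))"
  proof (rule nn_integral_LIMSEQ)
    show "incseq (\<lambda>n \<xi>. ennreal ((norm (fourier f \<xi>))\<^sup>2 * exp (- (s n * \<xi>)\<^sup>2 / 2)))"
    proof (intro incseq_SucI le_funI ennreal_leI mult_left_mono)
      fix n \<xi>
      have "s (Suc n) \<le> s n" by (simp add: s_def frac_le)
      then have "(s (Suc n))\<^sup>2 * \<xi>\<^sup>2 \<le> (s n)\<^sup>2 * \<xi>\<^sup>2"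
        using s0[of "Suc n"] by (intro mult_right_mono power_mono) auto
      then show "exp (- (s n * \<xi>)\<^sup>2 / 2) \<le> exp (- (s (Suc n) * \<xi>)\<^sup>2 / 2)"
        by (simp add: power_mult_distrib)
    qed auto
    fix \<xi>
    have "(\<lambda>n. (norm (fourier f \<xi>))\<^sup>2 * exp (- (s n * \<xi>)\<^sup>2 / 2)) \<longlonglongrightarrow> (norm (fourier f \<xi>))\<^sup>2 * exp (- (0 * \<xi>)\<^sup>2 / 2)"
      by (intro tendsto_intros slim) auto
    then show "(\<lambda>n. ennreal ((norm (fourier f \<xi>))\<^sup>2 * exp (- (s n * \<xi>)\<^sup>2 / 2))) \<longlonglongrightarrow> ennreal ((norm (fourier f \<xi>))\<^sup>2)"
      by (intro tendsto_ennrealI) simp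
  qed measurable
  moreover have "(\<integral>\<^sup>+\<xi>. ennreal ((norm (fourier f \<xi>))\<^sup>2 * exp (- (s n * \<xi>)\<^sup>2 / 2)) \<partial>lborel)
      = ennreal (2 * pi * (LBINT z. c (s n * z) * std_normal_density z))" for n
    using gauss[of n] by (subst nn_integral_eq_integral) (auto simp: has_bochner_integral_iff)
  moreover have "(\<lambda>n. ennreal (2 * pi * (LBINT z. c (s n * z) * std_normal_density z))) \<longlonglongrightarrow> ennreal (2 * pi * E)"
  proof -
    have "(\<lambda>n. LINT z|lborel. c (s n * z) * std_normal_density z) \<longlonglongrightarrow> (LBINT z. E * std_normal_density z)"
    proof (rule integral_dominated_convergence[where w="\<lambda>z. E * std_normal_density z"])
      show "AE z in lborel. (\<lambda>n. c (s n * z) * std_normal_density z) \<longlonglongrightarrow> E * std_normal_density z"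
        by (intro AE_I2 tendsto_intros clim)
      show "AE z in lborel. norm (c (s n * z) * std_normal_density z) \<le> E * std_normal_density z" for n
        using cE by (auto simp: abs_mult normal_density_nonneg intro!: mult_right_mono)
    qed (auto intro!: integrable_mult_right)
    then have "(\<lambda>n. 2 * pi * (LBINT z. c (s n * z) * std_normal_density z)) \<longlonglongrightarrow> 2 * pi * (E * 1)"
      by (intro tendsto_intros) (simp_all add: integral_normal_density)
    then show ?thesis by (intro tendsto_ennrealI) simp
  qed
  ultimately show ?thesis
    unfolding E_def by (auto intro: LIMSEQ_unique)
qed

lemma fourier_in_L2:
  assumes "integrable lborel f" "f \<in> L2"
  shows "fourier f \<in> L2"
  using plancherel_L1_L2[OF assms] assms by (auto simp: L2_iff_nn_integral)

section \<open>Fourier transform on \<open>L2\<close>\<close>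

text \<open>Membership in L2 is part of the notion: the integral in \<open>L2_sq\<close> is 0 for
  nonintegrable functions, so the distances alone would not express convergence.\<close>

definition L2_tendsto :: "(nat \<Rightarrow> real \<Rightarrow> complex) \<Rightarrow> (real \<Rightarrow> complex) \<Rightarrow> bool" where
  "L2_tendsto g h \<longleftrightarrow> (\<forall>n. g n \<in> L2) \<and> h \<in> L2 \<and> (\<lambda>n. L2_sq (\<lambda>x. h x - g n x)) \<longlonglongrightarrow> 0"

lemma L2_tendsto_lincomb:
  assumes g: "L2_tendsto g h" and g': "L2_tendsto g' h'"
  shows "L2_tendsto (\<lambda>n x. a * g n x + b * g' n x) (\<lambda>x. a * h x + b * h' x)"
  unfolding L2_tendsto_def
proof safe
  have h: "h \<in> L2" "h' \<in> L2" "\<And>n. g n \<in> L2" "\<And>n. g' n \<in> L2" using g g' by (auto simp: L2_tendsto_def)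
  show "(\<lambda>x. a * h x + b * h' x) \<in> L2" "\<And>n. (\<lambda>x. a * g n x + b * g' n x) \<in> L2"
    by (intro L2_add L2_scale h)+
  have "L2_sq (\<lambda>x. a * h x + b * h' x - (a * g n x + b * g' n x))
      \<le> 2 * (norm a)\<^sup>2 * L2_sq (\<lambda>x. h x - g n x) + 2 * (norm b)\<^sup>2 * L2_sq (\<lambda>x. h' x - g' n x)" for n
  proof -
    have "L2_sq (\<lambda>x. a * h x + b * h' x - (a * g n x + b * g' n x))
      \<le> (LBINT x. 2 * (norm a)\<^sup>2 * (norm (h x - g n x))\<^sup>2 + 2 * (norm b)\<^sup>2 * (norm (h' x - g' n x))\<^sup>2)"
    proof (intro integral_mono Bochner_Integration.integrable_add integrable_mult_right L2_integrable L2_diff L2_add L2_scale h)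
      fix x
      show "(norm (a * h x + b * h' x - (a * g n x + b * g' n x)))\<^sup>2
        \<le> 2 * (norm a)\<^sup>2 * (norm (h x - g n x))\<^sup>2 + 2 * (norm b)\<^sup>2 * (norm (h' x - g' n x))\<^sup>2"
        using norm_add_square_le[of "a * (h x - g n x)" "b * (h' x - g' n x)"]
        unfolding norm_mult power_mult_distrib by (simp add: algebra_simps)
    qed
    also have "\<dots> = 2 * (norm a)\<^sup>2 * L2_sq (\<lambda>x. h x - g n x) + 2 * (norm b)\<^sup>2 * L2_sq (\<lambda>x. h' x - g' n x)"
      using L2_integrable[OF L2_diff[OF h(1) h(3)[of n]]] L2_integrable[OF L2_diff[OF h(2) h(4)[of n]]]
      by (subst Bochner_Integration.integral_add) auto
    finally show ?thesis .
  qed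
  moreover have "(\<lambda>n. 2 * (norm a)\<^sup>2 * L2_sq (\<lambda>x. h x - g n x) + 2 * (norm b)\<^sup>2 * L2_sq (\<lambda>x. h' x - g' n x)) \<longlonglongrightarrow> 0"
    using g g' by (auto simp: L2_tendsto_def intro!: tendsto_eq_intros)
  ultimately show "(\<lambda>n. L2_sq (\<lambda>x. a * h x + b * h' x - (a * g n x + b * g' n x))) \<longlonglongrightarrow> 0"
    by - (rule Lim_null_comparison, rule always_eventually, rule allI,
      simp only: real_norm_def abs_of_nonneg[OF Bochner_Integration.integral_nonneg[OF zero_le_power2]])
qed

text \<open>Continuity of the norm, obtained for squares by Young's inequality with a small weight d
  on the fixed limit function.\<close>

lemma L2_tendsto_norm:
  assumes "L2_tendsto g h"
  shows "(\<lambda>n. L2_sq (g n)) \<longlonglongrightarrow> (L2_sq h)"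
proof (rule LIMSEQ_I)
  fix r :: real assume r: "r > 0"
  have h: "h \<in> L2" "g n \<in> L2" and lim: "(\<lambda>n. L2_sq (\<lambda>x. h x - g n x)) \<longlonglongrightarrow> 0" for n
    using assms by (auto simp: L2_tendsto_def)
  define H where "H = L2_sq h"
  have H: "H \<ge> 0" by (simp add: H_def)
  \<comment> \<open>The added 1 keeps the denominator positive when H = 0; d * H stays below r /
    2.\<close>
  define d where "d = r / (2 * (H + 1))"
  have d: "d > 0" using r H by (simp add: d_def)
  have dH: "d * H < r" using r H by (simp add: d_def divide_simps)
  have pt: "\<bar>(norm a)\<^sup>2 - (norm b)\<^sup>2\<bar> \<le> (1 + 1 / d) * (norm (b - a))\<^sup>2 + d * (norm b)\<^sup>2" for a b :: complex
  proof -
    define D where "D = norm (b - a)"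
    have D: "\<bar>norm a - norm b\<bar> \<le> D" unfolding D_def by (metis norm_triangle_ineq3 norm_minus_commute)
    have "\<bar>(norm a)\<^sup>2 - (norm b)\<^sup>2\<bar> = \<bar>norm a - norm b\<bar> * (norm a + norm b)"
      by (simp add: power2_eq_square square_diff_square_factored abs_mult mult.commute)
    also have "\<dots> \<le> D * (D + 2 * norm b)"
      using D by (intro mult_mono) auto
    also have "\<dots> = D\<^sup>2 + 2 * (D * norm b)"
      by (simp add: power2_eq_square algebra_simps)
    also have "2 * (D * norm b) \<le> D\<^sup>2 / d + d * (norm b)\<^sup>2"
    proof -
      have "0 \<le> (D - d * norm b)\<^sup>2 / d" using d by simp
      also have "\<dots> = D\<^sup>2 / d + d * (norm b)\<^sup>2 - 2 * (D * norm b)"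
        using d by (simp add: power2_diff field_simps power2_eq_square)
      finally show ?thesis by simp
    qed
    finally show ?thesis unfolding D_def by (simp add: algebra_simps power2_eq_square)
  qed
  have bound: "\<bar>(L2_sq (g n)) - H\<bar> \<le> (1 + 1 / d) * L2_sq (\<lambda>x. h x - g n x) + d * H" for n
  proof -
    have "\<bar>(L2_sq (g n)) - H\<bar> = \<bar>LINT x|lborel. (norm (g n x))\<^sup>2 - (norm (h x))\<^sup>2\<bar>"
      unfolding H_def using L2_integrable[OF h(1)] L2_integrable[OF h(2)] by simp
    also have "\<dots> \<le> (LBINT x. \<bar>(norm (g n x))\<^sup>2 - (norm (h x))\<^sup>2\<bar>)"
      by (rule integral_abs_bound)
    also have "\<dots> \<le> (LBINT x. (1 + 1 / d) * (norm (h x - g n x))\<^sup>2 + d * (norm (h x))\<^sup>2)"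
      by (intro integral_mono integrable_abs Bochner_Integration.integrable_add Bochner_Integration.integrable_diff
          integrable_mult_right L2_integrable L2_diff h pt)
    also have "\<dots> = (1 + 1 / d) * L2_sq (\<lambda>x. h x - g n x) + d * H"
      using L2_integrable[OF h(1)] L2_integrable[OF L2_diff[OF h(1) h(2)[of n]]]
      unfolding H_def by (subst Bochner_Integration.integral_add) auto
    finally show ?thesis .
  qed
  have "(\<lambda>n. (1 + 1 / d) * L2_sq (\<lambda>x. h x - g n x) + d * H) \<longlonglongrightarrow> (1 + 1 / d) * 0 + d * H"
    by (intro tendsto_intros lim)
  then have "\<forall>\<^sub>F n in sequentially. (1 + 1 / d) * L2_sq (\<lambda>x. h x - g n x) + d * H < r"
    using dH by (intro order_tendstoD) auto
  then obtain N where "\<And>n. n \<ge> N \<Longrightarrow> (1 + 1 / d) * L2_sq (\<lambda>x. h x - g n x) + d * H < r"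
    by (auto simp: eventually_sequentially)
  then show "\<exists>no. \<forall>n\<ge>no. norm ((L2_sq (g n)) - L2_sq h) < r"
    using bound unfolding H_def real_norm_def by (meson order_le_less_trans)
qed

text \<open>Along a subsequence the consecutive distances are at most \<open>4\<^sup>-\<^sup>k\<close>; the weights \<open>2\<^sup>k\<close>
  then make the telescoping series converge almost everywhere.\<close>

lemma L2_complete:
  fixes g :: "nat \<Rightarrow> real \<Rightarrow> complex"
  assumes g: "\<And>n. g n \<in> L2"
    and cauchy: "\<And>e. e > 0 \<Longrightarrow> \<exists>N. \<forall>m\<ge>N. \<forall>n\<ge>N. (L2_sq (\<lambda>x. g m x - g n x)) < e"
  shows "\<exists>h. L2_tendsto g h"
proof -
  note [measurable] = L2_measurable[OF g]
  have "\<forall>k. \<exists>N. \<forall>m\<ge>N. \<forall>n\<ge>N. (L2_sq (\<lambda>x. g m x - g n x)) < (1/4) ^ k"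
    by (intro allI cauchy) simp
  from choice[OF this] obtain N where
    N: "\<And>k m n. m \<ge> N k \<Longrightarrow> n \<ge> N k \<Longrightarrow> (L2_sq (\<lambda>x. g m x - g n x)) < (1/4) ^ k"
    by blast
  \<comment> \<open>The partial sums put both \<open>M k\<close> and \<open>M (Suc k)\<close> beyond
    \<open>N k\<close>, and the summand k sends \<open>M\<close> to infinity.\<close>
  define M where "M k = k + (\<Sum>i\<le>k. N i)" for k
  have MN: "M k \<ge> N k" "M (Suc k) \<ge> N k" "M k \<ge> k" for k
  proof -
    have "N k \<le> (\<Sum>i\<le>k. N i)" by (rule member_le_sum) auto
    then show "M k \<ge> N k" "M (Suc k) \<ge> N k" by (auto simp: M_def)
  qed (simp add: M_def)
  define d where "d k x = norm (g (M (Suc k)) x - g (M k) x)" for k x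
  have [measurable]: "d k \<in> borel_measurable borel" for k unfolding d_def[abs_def] by measurable
  have "(\<integral>\<^sup>+x. (\<Sum>k. ennreal (2 ^ k * (d k x)\<^sup>2)) \<partial>lborel) = (\<Sum>k. \<integral>\<^sup>+x. ennreal (2 ^ k * (d k x)\<^sup>2) \<partial>lborel)"
    by (rule nn_integral_suminf) measurable
  also have "\<dots> \<le> (\<Sum>k. ennreal ((1/2) ^ k))"
  proof (rule suminf_le)
    fix k
    have "(\<integral>\<^sup>+x. ennreal (2 ^ k * (d k x)\<^sup>2) \<partial>lborel) = ennreal (2 ^ k) * (\<integral>\<^sup>+x. ennreal ((d k x)\<^sup>2) \<partial>lborel)"
      by (simp add: ennreal_mult nn_integral_cmult)
    also have "\<dots> = ennreal (2 ^ k * (LBINT x. (d k x)\<^sup>2))"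
      unfolding d_def by (subst L2_nn_integral[OF L2_diff[OF g g]]) (simp add: ennreal_mult)
    also have "\<dots> \<le> ennreal ((1/2) ^ k)"
    proof (rule ennreal_leI)
      have "2 ^ k * (LBINT x. (d k x)\<^sup>2) \<le> 2 ^ k * (1/4) ^ k"
        using N[of k "M (Suc k)" "M k"] MN[of k] unfolding d_def by (intro mult_left_mono) auto
      also have "\<dots> = ((1/2) ^ k :: real)" by (simp add: power_mult_distrib[symmetric])
      finally show "2 ^ k * (LBINT x. (d k x)\<^sup>2) \<le> (1/2) ^ k" .
    qed
    finally show "(\<integral>\<^sup>+x. ennreal (2 ^ k * (d k x)\<^sup>2) \<partial>lborel) \<le> ennreal ((1/2) ^ k)" .
  qed auto
  also have "\<dots> < \<infinity>"
    by (subst suminf_ennreal2) auto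
  finally have "AE x in lborel. (\<Sum>k. ennreal (2 ^ k * (d k x)\<^sup>2)) \<noteq> \<infinity>"
    by (intro nn_integral_PInf_AE) auto
  then have conv: "AE x in lborel. convergent (\<lambda>k. g (M k) x)"
  proof eventually_elim
    case (elim x)
    then have "(\<Sum>k. ennreal (2 ^ k * (d k x)\<^sup>2)) \<noteq> top"
      by (simp only: infinity_ennreal_def simp_thms)
    then have s: "summable (\<lambda>k. 2 ^ k * (d k x)\<^sup>2)"
      by (rule summable_suminf_not_top[rotated]) simp
    have "summable (\<lambda>k. (1/2) ^ k + 2 ^ k * (d k x)\<^sup>2)"
      by (intro summable_add s summable_geometric) simp
    then have "summable (\<lambda>k. g (M (Suc k)) x - g (M k) x)"
    proof (rule summable_comparison_test'[where N=0])
      fix k :: nat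
      \<comment> \<open>The arithmetic-geometric mean inequality splits the increment: 2
        \<open>d k x\<close> \<le> 2^(-k) + 2^k (\<open>d k x\<close>)^2, and both series
        converge.\<close>
      have "2 * (sqrt ((1/2) ^ k) * (sqrt (2 ^ k) * d k x)) \<le> (sqrt ((1/2) ^ k))\<^sup>2 + (sqrt (2 ^ k) * d k x)\<^sup>2"
        using sum_squares_bound[of "sqrt ((1/2) ^ k)" "sqrt (2 ^ k) * d k x"] by (simp add: mult.assoc)
      also have "\<dots> = (1/2) ^ k + 2 ^ k * (d k x)\<^sup>2" by (simp add: power_mult_distrib)
      also have "sqrt ((1/2) ^ k) * (sqrt (2 ^ k) * d k x) = d k x"
        by (simp add: real_sqrt_mult[symmetric] power_mult_distrib[symmetric] flip: mult.assoc)
      finally have "2 * d k x \<le> (1/2) ^ k + 2 ^ k * (d k x)\<^sup>2" .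
      moreover have "d k x \<ge> 0" by (simp add: d_def)
      ultimately show "norm (g (M (Suc k)) x - g (M k) x) \<le> (1/2) ^ k + 2 ^ k * (d k x)\<^sup>2"
        unfolding d_def by linarith
    qed
    then have "convergent (\<lambda>n. \<Sum>k<n. g (M (Suc k)) x - g (M k) x)"
      by (simp add: summable_iff_convergent)
    then have "convergent (\<lambda>n. (\<Sum>k<n. g (M (Suc k)) x - g (M k) x) + g (M 0) x)"
      by (rule convergent_add[OF _ convergent_const])
    then show ?case
      using sum_lessThan_telescope[of "\<lambda>k. g (M k) x"] by simp
  qed
  define h where "h x = lim (\<lambda>k. g (M k) x)" for x
  have [measurable]: "h \<in> borel_measurable borel"
    unfolding h_def[abs_def] by measurable
  have hlim: "AE x in lborel. (\<lambda>k. g (M k) x) \<longlonglongrightarrow> h x"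
    using conv by eventually_elim (simp add: h_def convergent_LIMSEQ_iff)
  \<comment> \<open>The pointwise limit is known only along \<open>M\<close>; Fatou's lemma carries
    the Cauchy estimate over to it for every large index n of the full sequence.\<close>
  have fatou: "L2_nn (\<lambda>x. h x - g n x) \<le> ennreal e"
    if n: "n \<ge> N0" and e: "\<And>m n. m \<ge> N0 \<Longrightarrow> n \<ge> N0 \<Longrightarrow> (L2_sq (\<lambda>x. g m x - g n x)) < e" for n e N0
  proof -
    have "L2_nn (\<lambda>x. h x - g n x)
        = (\<integral>\<^sup>+x. liminf (\<lambda>k. ennreal ((norm (g (M k) x - g n x))\<^sup>2)) \<partial>lborel)"
    proof (rule nn_integral_cong_AE)
      show "AE x in lborel. ennreal ((norm (h x - g n x))\<^sup>2) = liminf (\<lambda>k. ennreal ((norm (g (M k) x - g n x))\<^sup>2))"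
        using hlim
      proof eventually_elim
        case (elim x)
        have "(\<lambda>k. ennreal ((norm (g (M k) x - g n x))\<^sup>2)) \<longlonglongrightarrow> ennreal ((norm (h x - g n x))\<^sup>2)"
          by (intro tendsto_intros elim)
        then show ?case by (rule lim_imp_Liminf[symmetric, rotated]) simp
      qed
    qed
    also have "\<dots> \<le> liminf (\<lambda>k. L2_nn (\<lambda>x. g (M k) x - g n x))"
      by (rule nn_integral_liminf) measurable
    also have "\<dots> \<le> ennreal e"
    proof -
      have "\<forall>\<^sub>F k in sequentially. (L2_nn (\<lambda>x. g (M k) x - g n x)) \<le> ennreal e"
        using eventually_ge_at_top[of N0]
      proof eventually_elim
        case (elim k)
        then show ?case
          unfolding L2_nn_integral[OF L2_diff[OF g g]]
          using e[of "M k" n] n MN(3)[of k] by (intro ennreal_leI) auto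
      qed
      then have "liminf (\<lambda>k. L2_nn (\<lambda>x. g (M k) x - g n x)) \<le> liminf (\<lambda>k::nat. ennreal e)"
        by (rule Liminf_mono)
      then show ?thesis by (simp add: Liminf_const)
    qed
    finally show ?thesis .
  qed
  obtain N1 where N1: "\<And>m n. m \<ge> N1 \<Longrightarrow> n \<ge> N1 \<Longrightarrow> (L2_sq (\<lambda>x. g m x - g n x)) < 1"
    using cauchy[of 1] by auto
  have "L2_nn (\<lambda>x. h x - g N1 x) < \<infinity>"
    using fatou[of N1 N1 1] N1 by (auto intro: order_le_less_trans)
  then have "(\<lambda>x. h x - g N1 x) \<in> L2" by (simp add: L2_iff_nn_integral)
  from L2_add[OF this g[of N1]] have h2: "h \<in> L2" by simp
  have "(\<lambda>n. L2_sq (\<lambda>x. h x - g n x)) \<longlonglongrightarrow> 0"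
  proof (rule LIMSEQ_I)
    fix r :: real assume r: "r > 0"
    obtain N2 where N2: "\<And>m n. m \<ge> N2 \<Longrightarrow> n \<ge> N2 \<Longrightarrow> (L2_sq (\<lambda>x. g m x - g n x)) < r / 2"
      using cauchy[of "r / 2"] r by auto
    show "\<exists>no. \<forall>n\<ge>no. norm ((L2_sq (\<lambda>x. h x - g n x)) - 0) < r"
    proof (intro exI allI impI)
      fix n assume n: "n \<ge> N2"
      have "L2_sq (\<lambda>x. h x - g n x) \<le> r / 2"
        using fatou[OF n N2] r unfolding L2_nn_integral[OF L2_diff[OF h2 g]] by simp
      then show "norm ((L2_sq (\<lambda>x. h x - g n x)) - 0) < r" using r by simp
    qed
  qed
  then show ?thesis unfolding L2_tendsto_def using g h2 by blast
qed

section \<open>Extension of the transform by truncation\<close>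

definition trunc :: "(real \<Rightarrow> complex) \<Rightarrow> nat \<Rightarrow> real \<Rightarrow> complex" where
  "trunc f n x = indicator {- real n..real n} x *\<^sub>R f x"

lemma trunc_L2: "f \<in> L2 \<Longrightarrow> trunc f n \<in> L2"
  unfolding trunc_def[abs_def] by (rule L2_indicator) auto

lemma indicator_L2: "(indicator {a..b} :: real \<Rightarrow> complex) \<in> L2"
proof -
  have eq: "(norm (indicator {a..b} x :: complex))\<^sup>2 = indicator {a..b} x" for x
    by (simp add: indicator_def)
  show ?thesis unfolding L2_def mem_Collect_eq eq
    by (auto simp: emeasure_lborel_Icc_eq)
qed

lemma trunc_integrable: "f \<in> L2 \<Longrightarrow> integrable lborel (trunc f n)"
  using L2_mult_integrable[OF indicator_L2, of f "- real n" "real n"]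
  unfolding trunc_def[abs_def] by (simp add: indicator_scaleR_eq_if indicator_times_eq_if cong: if_cong)

lemma trunc_tendsto:
  assumes "f \<in> L2" shows "L2_tendsto (trunc f) f"
  unfolding L2_tendsto_def
proof (intro conjI allI trunc_L2 assms)
  have "\<forall>\<^sub>F n in sequentially. x \<in> {- real n..real n}" for x
  proof -
    obtain N where "\<bar>x\<bar> \<le> real N" using real_arch_simple by blast
    then show ?thesis unfolding eventually_sequentially by (intro exI[of _ N]) auto
  qed
  then show "(\<lambda>n. L2_sq (\<lambda>x. f x - trunc f n x)) \<longlonglongrightarrow> 0"
    unfolding trunc_def by (intro L2_indicator_tendsto assms) auto
qed

text \<open>Truncations of L2 functions are integrable and square integrable, so their transforms
  lie in L2 and the extended integrals in \<open>is_fourier\<close> are finite; the defining limit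
  becomes one of real numbers.\<close>

lemma is_fourier_iff:
  "is_fourier f F \<longleftrightarrow> f \<in> L2 \<and> L2_tendsto (\<lambda>n. fourier (trunc f n)) F"
proof -
  have eq: "(LINT x:{- real n..real n}|lborel. cis (- (\<xi> * x)) * f x) = fourier (trunc f n) \<xi>" for n \<xi>
    unfolding fourier_def trunc_def set_lebesgue_integral_def
    by (simp add: mult_scaleR_right)
  have "(\<lambda>n. L2_nn (\<lambda>\<xi>. F \<xi> - fourier (trunc f n) \<xi>)) \<longlonglongrightarrow> 0
    \<longleftrightarrow> (\<lambda>n. L2_sq (\<lambda>\<xi>. F \<xi> - fourier (trunc f n) \<xi>)) \<longlonglongrightarrow> 0" if "f \<in> L2" "F \<in> L2"
  proof -
    have "(\<lambda>\<xi>. F \<xi> - fourier (trunc f n) \<xi>) \<in> L2" for n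
      by (intro L2_diff that fourier_in_L2 trunc_L2 trunc_integrable)
    then show ?thesis
      by (simp add: L2_nn_integral ennreal_0[symmetric] tendsto_ennreal_iff del: ennreal_0)
  qed
  then show ?thesis
    unfolding is_fourier_def L2_tendsto_def eq
    by (auto intro: fourier_in_L2 trunc_L2 trunc_integrable)
qed

lemma is_fourier_L2: assumes "is_fourier f F" shows "f \<in> L2" "F \<in> L2"
  using assms by (auto simp: is_fourier_def)

lemma L2_dist_fourier:
  assumes "integrable lborel f" "f \<in> L2" "integrable lborel g" "g \<in> L2"
  shows "L2_sq (\<lambda>\<xi>. fourier f \<xi> - fourier g \<xi>) = 2 * pi * L2_sq (\<lambda>x. f x - g x)"
proof -
  have d: "integrable lborel (\<lambda>x. f x - g x)" "(\<lambda>x. f x - g x) \<in> L2"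
    using assms by (auto intro: L2_diff)
  have "ennreal (L2_sq (fourier (\<lambda>x. f x - g x))) = ennreal (2 * pi * L2_sq (\<lambda>x. f x - g x))"
    using plancherel_L1_L2[OF d] by (simp add: L2_nn_integral[OF fourier_in_L2[OF d]])
  then show ?thesis by (simp add: fourier_diff assms)
qed

text \<open>Consistency of the two transforms, by Plancherel's formula for the truncation
  error.\<close>

lemma is_fourier_fourier:
  assumes "integrable lborel f" "f \<in> L2"
  shows "is_fourier f (fourier f)"
  unfolding is_fourier_iff L2_tendsto_def
proof (intro conjI allI assms fourier_in_L2 trunc_L2 trunc_integrable)
  have "(\<lambda>n. 2 * pi * L2_sq (\<lambda>x. f x - trunc f n x)) \<longlonglongrightarrow> 2 * pi * 0"
    using trunc_tendsto[OF assms(2)] by (intro tendsto_intros) (auto simp: L2_tendsto_def)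
  then show "(\<lambda>n. L2_sq (\<lambda>x. fourier f x - fourier (trunc f n) x)) \<longlonglongrightarrow> 0"
    by (simp add: L2_dist_fourier assms trunc_L2 trunc_integrable)
qed

text \<open>Plancherel makes the transforms of the truncations a Cauchy sequence along with the
  truncations themselves, and L2 is complete.\<close>

lemma is_fourier_exists:
  assumes f: "f \<in> L2"
  obtains F where "is_fourier f F"
proof -
  have "\<exists>F. L2_tendsto (\<lambda>n. fourier (trunc f n)) F"
  proof (rule L2_complete)
    show "fourier (trunc f n) \<in> L2" for n by (intro fourier_in_L2 trunc_L2 trunc_integrable f)
    fix e :: real assume e: "e > 0"
    have "(\<lambda>n. L2_sq (\<lambda>x. f x - trunc f n x)) \<longlonglongrightarrow> 0"
      using trunc_tendsto[OF f] by (simp add: L2_tendsto_def)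
    \<comment> \<open>Both truncation errors are doubled and Plancherel multiplies by 2 pi: in total
      2 pi times 4 e / (8 pi), which is e.\<close>
    from LIMSEQ_D[OF this, of "e / (8 * pi)"] e obtain N where
      N: "\<And>n. n \<ge> N \<Longrightarrow> (L2_sq (\<lambda>x. f x - trunc f n x)) < e / (8 * pi)"
      by auto
    show "\<exists>N. \<forall>m\<ge>N. \<forall>n\<ge>N. (L2_sq (\<lambda>x. fourier (trunc f m) x - fourier (trunc f n) x)) < e"
    proof (intro exI allI impI)
      fix m n assume mn: "m \<ge> N" "n \<ge> N"
      have "L2_sq (\<lambda>x. trunc f m x - trunc f n x)
          \<le> (LBINT x. 2 * (norm (f x - trunc f n x))\<^sup>2 + 2 * (norm (f x - trunc f m x))\<^sup>2)"
      proof (intro integral_mono Bochner_Integration.integrable_add integrable_mult_right L2_integrable L2_diff trunc_L2 f)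
        fix x
        show "(norm (trunc f m x - trunc f n x))\<^sup>2 \<le> 2 * (norm (f x - trunc f n x))\<^sup>2 + 2 * (norm (f x - trunc f m x))\<^sup>2"
          using norm_add_square_le[of "f x - trunc f n x" "trunc f m x - f x"] by (simp add: norm_minus_commute)
      qed
      also have "\<dots> = 2 * L2_sq (\<lambda>x. f x - trunc f n x) + 2 * L2_sq (\<lambda>x. f x - trunc f m x)"
        using L2_integrable[OF L2_diff[OF f trunc_L2[OF f, of m]]] L2_integrable[OF L2_diff[OF f trunc_L2[OF f, of n]]]
        by simp
      also have "\<dots> < e / (2 * pi)" using N[OF mn(1)] N[OF mn(2)] by simp
      finally have "2 * pi * L2_sq (\<lambda>x. trunc f m x - trunc f n x) < e"
        by (simp add: field_simps)
      then show "L2_sq (\<lambda>x. fourier (trunc f m) x - fourier (trunc f n) x) < e"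
        by (simp add: L2_dist_fourier f trunc_L2 trunc_integrable)
    qed
  qed
  then show ?thesis using f that by (auto simp: is_fourier_iff)
qed

theorem plancherel:
  assumes "is_fourier f F"
  shows "L2_sq F = 2 * pi * L2_sq f"
proof (rule LIMSEQ_unique)
  have f: "f \<in> L2" using assms by (rule is_fourier_L2)
  show "(\<lambda>n. L2_sq (fourier (trunc f n))) \<longlonglongrightarrow> (L2_sq F)"
    using assms by (intro L2_tendsto_norm) (simp add: is_fourier_iff)
  have "L2_sq (fourier (trunc f n)) = 2 * pi * L2_sq (trunc f n)" for n
    using L2_dist_fourier[OF trunc_integrable[OF f] trunc_L2[OF f], of "\<lambda>_. 0" n]
    by (simp add: fourier_def L2_def)
  moreover have "(\<lambda>n. 2 * pi * L2_sq (trunc f n)) \<longlonglongrightarrow> 2 * pi * L2_sq f"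
    by (intro tendsto_intros L2_tendsto_norm trunc_tendsto f)
  ultimately show "(\<lambda>n. L2_sq (fourier (trunc f n))) \<longlonglongrightarrow> 2 * pi * L2_sq f"
    by simp
qed

lemma is_fourier_lincomb:
  assumes f: "is_fourier f F" and g: "is_fourier g G"
  shows "is_fourier (\<lambda>x. a * f x + b * g x) (\<lambda>\<xi>. a * F \<xi> + b * G \<xi>)"
proof -
  have f2: "f \<in> L2" "g \<in> L2" using f g by (auto simp: is_fourier_def)
  have "fourier (trunc (\<lambda>x. a * f x + b * g x) n) = (\<lambda>\<xi>. a * fourier (trunc f n) \<xi> + b * fourier (trunc g n) \<xi>)" for n
  proof
    fix \<xi>
    note i = integrable_fourier_kernel[OF trunc_integrable[OF f2(1)], of \<xi> n]
      integrable_fourier_kernel[OF trunc_integrable[OF f2(2)], of \<xi> n]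
    have "fourier (trunc (\<lambda>x. a * f x + b * g x) n) \<xi> = (LBINT x. a * (cis (- (\<xi> * x)) * trunc f n x)
      + b * (cis (- (\<xi> * x)) * trunc g n x))"
      unfolding fourier_def trunc_def
      by (intro Bochner_Integration.integral_cong refl) (simp add: scaleR_conv_of_real algebra_simps)
    also have "\<dots> = a * fourier (trunc f n) \<xi> + b * fourier (trunc g n) \<xi>"
      unfolding fourier_def
      by (subst Bochner_Integration.integral_add) (simp_all only: integrable_mult_right i integral_mult_right_zero)
    finally show "fourier (trunc (\<lambda>x. a * f x + b * g x) n) \<xi> = a * fourier (trunc f n) \<xi> + b * fourier (trunc g n) \<xi>" .
  qed
  then show ?thesis
    using f g unfolding is_fourier_iff by (auto intro!: L2_tendsto_lincomb L2_add L2_scale)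
qed

lemma is_fourier_scale: "is_fourier f F \<Longrightarrow> is_fourier (\<lambda>x. a * f x) (\<lambda>\<xi>. a * F \<xi>)"
  using is_fourier_lincomb[of f F f F a 0] by simp

lemma is_fourier_diff: "is_fourier f F \<Longrightarrow> is_fourier g G \<Longrightarrow> is_fourier (\<lambda>x. f x - g x) (\<lambda>\<xi>. F \<xi> - G \<xi>)"
  using is_fourier_lincomb[of f F g G 1 "-1"] by simp

text \<open>Polarisation: expanding the norm of p + g gives the real parts, and replacing f by i f
  gives the imaginary parts.\<close>

theorem parseval:
  assumes f: "is_fourier f F" and g: "is_fourier g G"
  shows "(LBINT \<xi>. F \<xi> * cnj (G \<xi>)) = 2 * pi * (LBINT x. f x * cnj (g x))"
proof -
  have expand: "L2_sq (\<lambda>x. p x + q x)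
      = L2_sq p + L2_sq q + 2 * Re (LBINT x. p x * cnj (q x))"
    if "p \<in> L2" "q \<in> L2" for p q :: "real \<Rightarrow> complex"
  proof -
    have int: "integrable lborel (\<lambda>x. p x * cnj (q x))" by (intro L2_mult_integrable that L2_cnj)
    have "(norm (a + b))\<^sup>2 = (norm a)\<^sup>2 + (norm b)\<^sup>2 + 2 * Re (a * cnj b)" for a b :: complex
      unfolding cmod_power2 by (simp add: power2_eq_square algebra_simps)
    then have "L2_sq (\<lambda>x. p x + q x) = (LBINT x. (norm (p x))\<^sup>2 + (norm (q x))\<^sup>2 + 2 * Re (p x * cnj (q x)))"
      by (simp only:)
    also have "\<dots> = L2_sq p + L2_sq q + 2 * Re (LBINT x. p x * cnj (q x))"
      using L2_integrable[OF that(1)] L2_integrable[OF that(2)] integral_Re[OF int] integrable_Re[OF int]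
      by (simp del: times_complex.sel)
    finally show ?thesis .
  qed
  have real_part: "Re (LBINT \<xi>. P \<xi> * cnj (G \<xi>)) = 2 * pi * Re (LBINT x. p x * cnj (g x))"
    if p: "is_fourier p P" for p P
  proof -
    have "is_fourier (\<lambda>x. p x + g x) (\<lambda>\<xi>. P \<xi> + G \<xi>)"
      using is_fourier_lincomb[OF p g, of 1 1] by simp
    from plancherel[OF this] plancherel[OF p] plancherel[OF g] is_fourier_L2[OF p] is_fourier_L2[OF g]
    show ?thesis by (simp only: expand) (simp add: distrib_left)
  qed
  have "Re (\<i> * (LBINT \<xi>. F \<xi> * cnj (G \<xi>))) = 2 * pi * Re (\<i> * (LBINT x. f x * cnj (g x)))"
    using real_part[OF is_fourier_scale[OF f, of \<i>]]
    by (simp only: mult.assoc integral_mult_right_zero)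
  then show ?thesis
    using real_part[OF f] by (simp add: complex_eq_iff)
qed

text \<open>\<open>is_multiplier_image\<close> speaks of some transform F; together with
  \<open>is_fourier_inject\<close>, this makes multipliers well defined up to null sets.\<close>

lemma is_fourier_unique:
  assumes "is_fourier f F" "is_fourier f G"
  shows "AE \<xi> in lborel. F \<xi> = G \<xi>"
proof (rule integral_dist_zero_imp_AE_eq)
  have "(\<lambda>\<xi>. F \<xi> - G \<xi>) \<in> L2" using assms by (intro L2_diff) (auto dest: is_fourier_L2)
  then show "L2_nn (\<lambda>\<xi>. F \<xi> - G \<xi>) = 0"
    using plancherel[OF is_fourier_diff[OF assms]] by (simp add: L2_nn_integral)
qed (use assms in \<open>auto dest: is_fourier_L2 intro: L2_measurable\<close>)

lemma is_fourier_inject: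
  assumes f: "is_fourier f F" and g: "is_fourier g G" and eq: "AE \<xi> in lborel. F \<xi> = G \<xi>"
  shows "AE x in lborel. f x = g x"
proof (rule integral_dist_zero_imp_AE_eq)
  have d: "(\<lambda>x. f x - g x) \<in> L2" using f g by (intro L2_diff) (auto dest: is_fourier_L2)
  have [measurable]: "F \<in> borel_measurable borel" "G \<in> borel_measurable borel"
    using f g by (auto dest: is_fourier_L2 intro: L2_measurable)
  have "L2_sq (\<lambda>\<xi>. F \<xi> - G \<xi>) = (LINT \<xi>|(lborel::real measure). (0::real))"
    by (rule integral_cong_AE) (use eq in auto)
  then show "L2_nn (\<lambda>x. f x - g x) = 0"
    using plancherel[OF is_fourier_diff[OF f g]] by (simp add: L2_nn_integral[OF d])
qed (use assms in \<open>auto dest: is_fourier_L2 intro: L2_measurable\<close>)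

section \<open>Smooth test functions\<close>

text \<open>The one-variable analogue of \<open>C_k\<close>, with the derivative as a witness rather
  than \<open>deriv\<close>, so that inductions on k run with the function generalised.\<close>

primrec k_smooth :: "nat \<Rightarrow> (real \<Rightarrow> real) \<Rightarrow> bool" where
  "k_smooth 0 f \<longleftrightarrow> continuous_on UNIV f"
| "k_smooth (Suc k) f \<longleftrightarrow> (\<exists>f'. (\<forall>x. (f has_real_derivative f' x) (at x)) \<and> k_smooth k f')"

lemma k_smooth_SucI:
  "(\<And>x. (f has_real_derivative f' x) (at x)) \<Longrightarrow> k_smooth k f' \<Longrightarrow> k_smooth (Suc k) f"
  by auto

lemma has_real_derivative_imp_continuous:
  fixes f :: "real \<Rightarrow> real"
  assumes "\<And>x. (f has_real_derivative f' x) (at x)"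
  shows "continuous_on UNIV f"
proof (rule continuous_at_imp_continuous_on, rule ballI)
  show "isCont f x" for x using assms[of x] by (rule DERIV_isCont)
qed

lemma k_smooth_Suc_imp: "k_smooth (Suc k) f \<Longrightarrow> k_smooth k f"
proof (induction k arbitrary: f)
  case 0
  then obtain f' where "\<And>x. (f has_real_derivative f' x) (at x)" by auto
  then show ?case unfolding k_smooth.simps by (rule has_real_derivative_imp_continuous)
next
  case (Suc k)
  then show ?case by (metis k_smooth.simps(2))
qed

lemma k_smooth_continuous: "k_smooth k f \<Longrightarrow> continuous_on UNIV f"
  by (induction k) (auto dest: k_smooth_Suc_imp simp del: k_smooth.simps(2))

lemma k_smooth_const: "k_smooth k (\<lambda>_. c)"
proof (induction k arbitrary: c)
  case (Suc k)
  then show ?case by (auto intro!: exI[of _ "\<lambda>_. 0"])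
qed auto

lemma k_smooth_add: "k_smooth k f \<Longrightarrow> k_smooth k g \<Longrightarrow> k_smooth k (\<lambda>x. f x + g x)"
proof (induction k arbitrary: f g)
  case (Suc k)
  then obtain f' g' where "\<forall>x. (f has_real_derivative f' x) (at x)" "k_smooth k f'"
    "\<forall>x. (g has_real_derivative g' x) (at x)" "k_smooth k g'" by auto
  note d = this
  show ?case
    by (rule k_smooth_SucI[OF _ Suc.IH[OF d(2,4)]]) (intro DERIV_add d(1)[rule_format] d(3)[rule_format])
qed (simp add: continuous_on_add)

lemma k_smooth_mult: "k_smooth k f \<Longrightarrow> k_smooth k g \<Longrightarrow> k_smooth k (\<lambda>x. f x * g x)"
proof (induction k arbitrary: f g)
  case (Suc k)
  then obtain f' g' where f': "\<forall>x. (f has_real_derivative f' x) (at x)" "k_smooth k f'"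
    and g': "\<forall>x. (g has_real_derivative g' x) (at x)" "k_smooth k g'"
    unfolding k_smooth.simps by blast
  have "k_smooth k (\<lambda>x. f' x * g x + g' x * f x)"
    by (intro k_smooth_add Suc.IH f'(2) g'(2) Suc.prems[THEN k_smooth_Suc_imp])
  then show ?case
    by (rule k_smooth_SucI[rotated]) (intro DERIV_mult f'(1)[rule_format] g'(1)[rule_format])
qed (simp add: continuous_on_mult)

lemma k_smooth_affine: "k_smooth k f \<Longrightarrow> k_smooth k (\<lambda>x. f (a + c * x))"
proof (induction k arbitrary: f)
  case 0
  have "continuous_on UNIV (\<lambda>x. a + c * x)" by (intro continuous_intros)
  from continuous_on_compose2[OF 0[unfolded k_smooth.simps] this subset_UNIV] show ?case by simp
next
  case (Suc k)
  then obtain f' where f': "\<forall>x. (f has_real_derivative f' x) (at x)" "k_smooth k f'"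
    unfolding k_smooth.simps by blast
  have "k_smooth k (\<lambda>x. f' (a + c * x) * c)"
    by (rule k_smooth_mult[OF Suc.IH[OF f'(2)] k_smooth_const])
  then show ?case
  proof (rule k_smooth_SucI[rotated])
    show "((\<lambda>x. f (a + c * x)) has_real_derivative f' (a + c * x) * c) (at x)" for x
    proof (rule DERIV_chain2[of f])
      show "(f has_real_derivative f' (a + c * x)) (at (a + c * x))" using f' by blast
      show "((\<lambda>x. a + c * x) has_real_derivative c) (at x)" by (auto intro!: derivative_eq_intros)
    qed
  qed
qed

text \<open>The span of the two oscillating exponentials is closed under differentiation, hence the
  induction over arbitrary coefficients c and d.\<close>

lemma k_smooth_exp_trig: "k_smooth k (\<lambda>t. exp (a * t) * (c * cos (b * t) + d * sin (b * t)))"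
proof (induction k arbitrary: c d)
  case 0
  then show ?case by (auto intro!: continuous_intros)
next
  case (Suc k)
  have "((\<lambda>t. exp (a * t) * (c * cos (b * t) + d * sin (b * t))) has_real_derivative
     exp (a * t) * ((a * c + b * d) * cos (b * t) + (a * d - b * c) * sin (b * t))) (at t)" for t
    by (auto intro!: derivative_eq_intros simp: algebra_simps)
  then show ?case by (rule k_smooth_SucI) (rule Suc.IH)
qed

section \<open>The flat exponential and the bump function\<close>

text \<open>The polynomial prefactor in 1/x makes the class closed under differentiation, which
  sends p to X^2 (p - p').\<close>

definition flat_exp :: "real poly \<Rightarrow> real \<Rightarrow> real" where
  "flat_exp p x = (if x > 0 then poly p (1 / x) * exp (- (1 / x)) else 0)"

lemma poly_exp_tendsto_0: "((\<lambda>y. y ^ k * poly p y / exp y) \<longlongrightarrow> 0) at_top" for p :: "real poly"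
proof (induction p arbitrary: k)
  case (pCons a p)
  have "((\<lambda>y. a * (y ^ k / exp y) + y ^ Suc k * poly p y / exp y) \<longlongrightarrow> a * 0 + 0) at_top"
    by (intro tendsto_intros tendsto_power_div_exp_0 pCons.IH)
  moreover have "(\<lambda>y. a * (y ^ k / exp y) + y ^ Suc k * poly p y / exp y) = (\<lambda>y. y ^ k * poly (pCons a p) y / exp y)"
    by (auto simp: fun_eq_iff field_simps)
  ultimately show ?case by simp
qed simp

lemma flat_tendsto_0: "(flat_exp p \<longlongrightarrow> 0) (at 0)"
proof (rule filterlim_split_at)
  show "(flat_exp p \<longlongrightarrow> 0) (at_left 0)"
    by (rule tendsto_eventually) (auto simp: flat_exp_def eventually_at_filter)
  have "((\<lambda>x. poly p (inverse x) / exp (inverse x)) \<longlongrightarrow> 0) (at_right 0)"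
    using filterlim_compose[OF poly_exp_tendsto_0[of 0 p] filterlim_inverse_at_top_right] by simp
  moreover have "\<forall>\<^sub>F x in at_right 0. poly p (inverse x) / exp (inverse x) = flat_exp p x"
    by (auto simp: flat_exp_def eventually_at_filter exp_minus field_simps)
  ultimately show "(flat_exp p \<longlongrightarrow> 0) (at_right 0)"
    by (rule Lim_transform_eventually)
qed

lemma flat_has_derivative: "(flat_exp p has_real_derivative flat_exp ([:0, 0, 1:] * (p - pderiv p)) x) (at x)"
proof -
  consider "x < 0" | "x = 0" | "x > 0" by linarith
  then show ?thesis
  proof cases
    case 1
    have "\<forall>\<^sub>F y in nhds x. flat_exp p y = 0"
      using eventually_nhds_in_open[of "{..<0}" x] 1 by (auto simp: flat_exp_def elim: eventually_mono)
    then have "(flat_exp p has_real_derivative 0) (at x)"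
      by (subst DERIV_cong_ev[OF refl _ refl]) auto
    then show ?thesis using 1 by (simp add: flat_exp_def)
  next
    case 2
    have "((\<lambda>y. (flat_exp p y - flat_exp p 0) / (y - 0)) \<longlongrightarrow> 0) (at 0)"
    \<comment> \<open>At 0 the difference quotient is again in the class: division by y multiplies
      the polynomial by X, which is \<open>pCons 0 p\<close>.\<close>
    proof (rule Lim_transform_eventually[OF flat_tendsto_0[of "pCons 0 p"]])
      show "\<forall>\<^sub>F y in at 0. flat_exp (pCons 0 p) y = (flat_exp p y - flat_exp p 0) / (y - 0)"
        by (auto simp: flat_exp_def eventually_at_filter)
    qed
    then have "(flat_exp p has_real_derivative 0) (at 0)"
      by (simp add: has_field_derivative_iff)
    then show ?thesis using 2 by (simp add: flat_exp_def)
  next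
    case 3
    have "((\<lambda>x. poly p (1 / x) * exp (- (1 / x))) has_real_derivative
        poly ([:0, 0, 1:] * (p - pderiv p)) (1 / x) * exp (- (1 / x))) (at x)"
      using 3 by (auto intro!: derivative_eq_intros DERIV_chain2[OF poly_DERIV] simp: field_simps power2_eq_square)
    moreover have "\<forall>\<^sub>F y in nhds x. flat_exp p y = poly p (1 / y) * exp (- (1 / y))"
      using eventually_nhds_in_open[of "{0<..}" x] 3 by (auto simp: flat_exp_def elim: eventually_mono)
    ultimately have "(flat_exp p has_real_derivative poly ([:0, 0, 1:] * (p - pderiv p)) (1 / x) * exp (- (1 / x))) (at x)"
      by (subst DERIV_cong_ev[OF refl _ refl]) auto
    then show ?thesis using 3 by (simp add: flat_exp_def)
  qed
qed

lemma k_smooth_flat: "k_smooth k (flat_exp p)"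
proof (induction k arbitrary: p)
  case 0
  then show ?case by (simp add: has_real_derivative_imp_continuous[OF flat_has_derivative])
next
  case (Suc k)
  then show ?case by (rule k_smooth_SucI[OF flat_has_derivative])
qed

definition test_fun :: "(real \<Rightarrow> real) \<Rightarrow> bool" where
  "test_fun f \<longleftrightarrow> (\<forall>k. k_smooth k f) \<and> (\<exists>R. \<forall>x. \<bar>x\<bar> > R \<longrightarrow> f x = 0)"

definition bump :: "real \<Rightarrow> real" where
  "bump x = flat_exp 1 (1 + x) * flat_exp 1 (1 - x)"

lemma bump_nonneg: "bump x \<ge> 0"
  by (simp add: bump_def flat_exp_def)

lemma bump_eq_0: "\<bar>x\<bar> \<ge> 1 \<Longrightarrow> bump x = 0"
  by (auto simp: bump_def flat_exp_def)

text \<open>On this half-interval 1 + x and 1 - x are at least 1/2, so each factor is at least exp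
  (-2). The bound serves the positivity of \<open>bump 0\<close> and of the transforms of rescaled
  bumps.\<close>

lemma bump_ge: "\<bar>x\<bar> \<le> 1/2 \<Longrightarrow> bump x \<ge> exp (- 4)"
proof -
  assume x: "\<bar>x\<bar> \<le> 1/2"
  have "exp (- 2) \<le> flat_exp 1 (1 + x)" "exp (- 2) \<le> flat_exp 1 (1 - x)"
    using x by (auto simp: flat_exp_def field_simps)
  then have "exp (- 2) * exp (- 2) \<le> bump x"
    unfolding bump_def by (intro mult_mono) (auto simp: flat_exp_def)
  then show ?thesis by (simp add: exp_add[symmetric])
qed

lemma test_fun_bump: "test_fun bump"
proof -
  have "k_smooth k bump" for k
    using k_smooth_mult[OF k_smooth_affine[OF k_smooth_flat, of k 1 1 1] k_smooth_affine[OF k_smooth_flat, of k 1 1 "-1"]]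
    by (simp add: bump_def[abs_def])
  then show ?thesis unfolding test_fun_def using bump_eq_0 by (auto intro!: exI[of _ 1])
qed

lemma test_fun_affine:
  assumes "test_fun f" "c \<noteq> 0"
  shows "test_fun (\<lambda>x. f (a + c * x))"
proof -
  obtain R where R: "\<And>x. \<bar>x\<bar> > R \<Longrightarrow> f x = 0" using assms by (auto simp: test_fun_def)
  have "f (a + c * x) = 0" if "\<bar>x\<bar> > (\<bar>R\<bar> + \<bar>a\<bar>) / \<bar>c\<bar>" for x
  proof (rule R)
    have "\<bar>R\<bar> + \<bar>a\<bar> < \<bar>c\<bar> * \<bar>x\<bar>" using that assms(2) by (simp add: field_simps)
    then show "R < \<bar>a + c * x\<bar>" by (simp add: abs_mult[symmetric])
  qed
  then show ?thesis using assms by (auto simp: test_fun_def intro: k_smooth_affine)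
qed

lemma test_fun_mult:
  assumes "\<And>k. k_smooth k f" "test_fun g"
  shows "test_fun (\<lambda>x. f x * g x)"
  using assms unfolding test_fun_def by (auto intro!: k_smooth_mult)

lemma test_fun_continuous: "test_fun f \<Longrightarrow> continuous_on UNIV f"
  unfolding test_fun_def using k_smooth_continuous by blast

lemma test_fun_DERIV:
  assumes "test_fun f"
  shows "(f has_real_derivative deriv f x) (at x)"
proof -
  have "k_smooth (Suc 0) f" using assms by (auto simp: test_fun_def simp del: k_smooth.simps)
  then obtain f' where "\<forall>x. (f has_real_derivative f' x) (at x)" by auto
  then show ?thesis by (metis DERIV_imp_deriv)
qed

lemma test_fun_deriv:
  assumes "test_fun f"
  shows "test_fun (deriv f)"
proof -
  have "k_smooth k (deriv f)" for k
  proof -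
    have "k_smooth (Suc k) f" using assms by (auto simp: test_fun_def simp del: k_smooth.simps)
    then obtain f' where f': "\<forall>x. (f has_real_derivative f' x) (at x)" "k_smooth k f'" by auto
    then have "deriv f = f'" by (auto intro!: ext DERIV_imp_deriv)
    then show ?thesis using f' by simp
  qed
  moreover obtain R where R: "\<And>x. \<bar>x\<bar> > R \<Longrightarrow> f x = 0" using assms by (auto simp: test_fun_def)
  have "deriv f x = 0" if "\<bar>x\<bar> > R" for x
  proof -
    have "open {x::real. \<bar>x\<bar> > R}" by (intro open_Collect_less continuous_intros)
    then have "\<forall>\<^sub>F y in nhds x. f y = 0"
      using eventually_nhds_in_open[of "{x. \<bar>x\<bar> > R}" x] that by (auto intro: R elim: eventually_mono)
    then have "(f has_real_derivative 0) (at x)"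
      by (subst DERIV_cong_ev[OF refl _ refl]) auto
    then show ?thesis by (rule DERIV_imp_deriv)
  qed
  ultimately show ?thesis unfolding test_fun_def by blast
qed

lemma test_fun_bounded:
  assumes "test_fun f"
  obtains B where "B > 0" "\<And>x. \<bar>f x\<bar> \<le> B" "\<And>x. \<bar>x\<bar> > B \<Longrightarrow> f x = 0"
proof -
  obtain R where R: "\<And>x. \<bar>x\<bar> > R \<Longrightarrow> f x = 0" using assms by (auto simp: test_fun_def)
  have "bounded (f ` {- \<bar>R\<bar>..\<bar>R\<bar>})"
    using test_fun_continuous[OF assms]
    by (intro compact_imp_bounded compact_continuous_image) (auto intro: continuous_on_subset)
  then obtain C where C: "\<forall>x\<in>{- \<bar>R\<bar>..\<bar>R\<bar>}. \<bar>f x\<bar> \<le> C"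
    by (auto simp: bounded_iff)
  show ?thesis
  proof (rule that[of "\<bar>R\<bar> + \<bar>C\<bar> + 1"])
    fix x
    show "\<bar>f x\<bar> \<le> \<bar>R\<bar> + \<bar>C\<bar> + 1"
    proof (cases "\<bar>x\<bar> > \<bar>R\<bar>")
      case True
      then show ?thesis using R[of x] by simp
    next
      case False
      then have "x \<in> {- \<bar>R\<bar>..\<bar>R\<bar>}" by (simp add: abs_le_iff not_less)
      then have "\<bar>f x\<bar> \<le> C" using C by blast
      then show ?thesis by linarith
    qed
  qed (use R in auto)
qed

lemma test_fun_borel: "test_fun f \<Longrightarrow> f \<in> borel_measurable borel"
  by (intro borel_measurable_continuous_onI test_fun_continuous)

lemma test_fun_integrable:
  assumes "test_fun f" shows "integrable lborel f"
proof -
  obtain B where B: "B > 0" "\<And>x. \<bar>f x\<bar> \<le> B" "\<And>x. \<bar>x\<bar> > B \<Longrightarrow> f x = 0"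
    using test_fun_bounded[OF assms] by blast
  show ?thesis
  proof (rule Bochner_Integration.integrable_bound[where f="\<lambda>x. indicator {-B..B} x *\<^sub>R B"])
    have "norm (f x) \<le> norm (indicator {-B..B} x *\<^sub>R B)" for x
      using B(1) B(2)[of x] B(3)[of x] by (cases "\<bar>x\<bar> > B") (auto simp: indicator_def)
    then show "AE x in lborel. norm (f x) \<le> norm (indicator {-B..B} x *\<^sub>R B)" by simp
  qed (use test_fun_borel[OF assms] in \<open>auto intro!: integrable_mult_left simp: emeasure_lborel_Icc_eq\<close>)
qed

lemma test_fun_L2:
  assumes "test_fun f" shows "f \<in> L2"
proof -
  have "test_fun (\<lambda>x. f x * f x)"
    using assms by (intro test_fun_mult) (auto simp: test_fun_def)
  then show ?thesis
    using test_fun_integrable[of "\<lambda>x. f x * f x"] test_fun_borel[OF assms]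
    by (simp add: L2_def power2_eq_square)
qed

text \<open>Products decouple time from space and are the only test functions fed into the weak
  formulation. The induction generalises both factors, as each partial derivative is again a
  product.\<close>

lemma test_function_product:
  assumes f: "test_fun f" and g: "test_fun g"
  shows "test_function (\<lambda>t x. f t * g x)"
  unfolding test_function_def
proof
  have "C_k k (\<lambda>t x. f t * g x)" for k
    using f g
  proof (induction k arbitrary: f g)
    case 0
    have "continuous_on UNIV f" "continuous_on UNIV g" by (intro test_fun_continuous 0)+
    then show ?case
      by (simp add: case_prod_unfold)
        (intro continuous_on_mult continuous_on_compose2[of UNIV f "UNIV :: (real \<times> real) set" fst]
          continuous_on_compose2[of UNIV g "UNIV :: (real \<times> real) set" snd] continuous_on_fst continuous_on_snd continuous_on_id subset_UNIV)
  next
    case (Suc k)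
    show ?case
      unfolding C_k.simps
    proof (rule exI[of _ "\<lambda>t x. deriv f t * g x"], rule exI[of _ "\<lambda>t x. f t * deriv g x"], intro conjI allI)
      show "C_k k (\<lambda>t x. deriv f t * g x)" "C_k k (\<lambda>t x. f t * deriv g x)"
        by (intro Suc.IH test_fun_deriv Suc.prems)+
    qed (intro DERIV_cmult_right DERIV_cmult test_fun_DERIV Suc.prems)+
  qed
  then show "\<forall>k. C_k k (\<lambda>t x. f t * g x)" by blast
  obtain R S where R: "\<And>x. \<bar>x\<bar> > R \<Longrightarrow> f x = 0" and S: "\<And>x. \<bar>x\<bar> > S \<Longrightarrow> g x = 0"
    using f g by (auto simp: test_fun_def)
  have "x \<in> {-R..R}" if "f x \<noteq> 0" for x using R[of x] that by (cases "\<bar>x\<bar> > R") auto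
  moreover have "x \<in> {-S..S}" if "g x \<noteq> 0" for x using S[of x] that by (cases "\<bar>x\<bar> > S") auto
  ultimately have "{(t, x). f t * g x \<noteq> 0} \<subseteq> {-R..R} \<times> {-S..S}" by auto
  then have "bounded {(t, x). f t * g x \<noteq> 0}"
    by (rule bounded_subset[rotated]) (intro bounded_Times bounded_closed_interval)
  then show "compact (closure {(t, x). f t * g x \<noteq> 0})"
    by (simp add: compact_closure)
qed

section \<open>Uniqueness and inversion\<close>

text \<open>Reduction to uniqueness of characteristic functions: the positive and negative parts of
  b have equal mass c, as \<xi> = 0 shows, and divided by c they become probability densities with
  the same characteristic function. If c = 0, both parts vanish.\<close>

lemma fourier_zero_imp_AE_zero_real:
  fixes b :: "real \<Rightarrow> real"
  assumes b: "integrable lborel b" and zero: "\<And>\<xi>. fourier (\<lambda>x. complex_of_real (b x)) \<xi> = 0"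
  shows "AE x in lborel. b x = 0"
proof -
  have [measurable]: "b \<in> borel_measurable borel" using b by auto
  define p q where "p x = max (b x) 0" and "q x = max (- b x) 0" for x
  have [measurable]: "p \<in> borel_measurable borel" "q \<in> borel_measurable borel"
    unfolding p_def[abs_def] q_def[abs_def] by measurable
  have pq: "b x = p x - q x" "p x \<ge> 0" "q x \<ge> 0" for x by (auto simp: p_def q_def)
  have ip: "integrable lborel p" "integrable lborel q"
    by (rule Bochner_Integration.integrable_bound[OF b]; auto simp: p_def q_def)+
  have eq: "fourier (\<lambda>x. complex_of_real (p x)) \<xi> = fourier (\<lambda>x. complex_of_real (q x)) \<xi>" for \<xi>
    using zero[of \<xi>] fourier_diff[of "\<lambda>x. complex_of_real (p x)" "\<lambda>x. complex_of_real (q x)" \<xi>] ip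
    by (simp add: pq(1))
  define c where "c = (LBINT x. p x)"
  have c: "(LBINT x. q x) = c"
    using eq[of 0] by (simp add: fourier_def c_def)
  have "c \<ge> 0" unfolding c_def using pq by simp
  show ?thesis
  proof (cases "c = 0")
    case True
    then have "AE x in lborel. p x = 0" "AE x in lborel. q x = 0"
      using c integral_nonneg_eq_0_iff_AE[OF ip(1)] integral_nonneg_eq_0_iff_AE[OF ip(2)] pq
      by (auto simp: c_def)
    then show ?thesis by eventually_elim (simp add: pq(1))
  next
    case False
    with \<open>c \<ge> 0\<close> have c0: "c > 0" by simp
    define D where "D r = density lborel (\<lambda>x. ennreal (r x / c))" for r :: "real \<Rightarrow> real"
    have dist: "real_distribution (D r)" if "integrable lborel r" "\<And>x. r x \<ge> 0" "(LBINT x. r x) = c" for r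
    proof -
      have "emeasure (D r) (space (D r)) = (\<integral>\<^sup>+x. ennreal (r x / c) \<partial>lborel)"
        using that by (simp add: D_def emeasure_density)
      also have "\<dots> = ennreal ((LBINT x. r x) / c)"
        using that c0 by (subst nn_integral_eq_integral) auto
      finally have "prob_space (D r)" using that c0 by (intro prob_spaceI) simp
      then show ?thesis by (simp add: real_distribution_def real_distribution_axioms_def D_def)
    qed
    have char: "char (D r) t = fourier (\<lambda>x. complex_of_real (r x)) (- t) / c"
      if r: "integrable lborel r" "\<And>x. r x \<ge> 0" for r t
    proof -
      have [measurable]: "r \<in> borel_measurable borel" using r by auto
      have "char (D r) t = (LBINT x. (r x / c) *\<^sub>R cis (t * x))"
        unfolding char_def D_def using r c0
        by (subst integral_density) (simp_all add: cis_conv_exp)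
      also have "\<dots> = (LBINT x. cis (- (- t * x)) * complex_of_real (r x) / c)"
        by (simp add: scaleR_conv_of_real mult.commute)
      also have "\<dots> = fourier (\<lambda>x. complex_of_real (r x)) (- t) / c"
        unfolding fourier_def by (rule integral_divide_zero)
      finally show ?thesis .
    qed
    have "D p = D q"
      by (rule Levy_uniqueness) (use ip pq c c_def in \<open>auto intro!: dist simp: char eq\<close>)
    then have "AE x in lborel. ennreal (p x / c) = ennreal (q x / c)"
      unfolding D_def by (intro sigma_finite_measure.density_unique[OF sigma_finite_lborel]) auto
    then show ?thesis
      by eventually_elim (use c0 pq in \<open>simp add: divide_right_mono\<close>)
  qed
qed

text \<open>Conjugation conjugates and reflects the transform, so the conjugate of B also has
  transform 0, and with it the real and imaginary parts of B.\<close>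

lemma fourier_zero_imp_AE_zero:
  assumes B: "integrable lborel B" and zero: "\<And>\<xi>. fourier B \<xi> = 0"
  shows "AE x in lborel. B x = 0"
proof -
  have cn: "fourier (\<lambda>x. cnj (B x)) \<xi> = 0" for \<xi>
    using zero[of "- \<xi>"] fourier_cnj[of B "- \<xi>"] by (simp add: fourier_def)
  have Bc: "integrable lborel (\<lambda>x. cnj (B x))" using B by simp
  have lin: "fourier (\<lambda>x. (B x - c * cnj (B x)) / d) \<xi> = 0" for c d \<xi>
  proof -
    have "fourier (\<lambda>x. (B x - c * cnj (B x)) / d) \<xi> = fourier (\<lambda>x. B x - c * cnj (B x)) \<xi> / d"
      unfolding fourier_def by (simp only: times_divide_eq_right integral_divide_zero)
    also have "fourier (\<lambda>x. B x - c * cnj (B x)) \<xi> = fourier B \<xi> - fourier (\<lambda>x. c * cnj (B x)) \<xi>"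
      by (intro fourier_diff B integrable_mult_right Bc)
    also have "fourier (\<lambda>x. c * cnj (B x)) \<xi> = c * fourier (\<lambda>x. cnj (B x)) \<xi>"
      unfolding fourier_def by (simp only: mult.left_commute[of _ c] integral_mult_right_zero)
    finally show ?thesis by (simp add: cn zero)
  qed
  have "(\<lambda>x. complex_of_real (Re (B x))) = (\<lambda>x. (B x - (- 1) * cnj (B x)) / 2)"
    "(\<lambda>x. complex_of_real (Im (B x))) = (\<lambda>x. (B x - 1 * cnj (B x)) / (2 * \<i>))"
    by (simp_all add: fun_eq_iff complex_eq_iff)
  then have "fourier (\<lambda>x. complex_of_real (Re (B x))) \<xi> = 0" "fourier (\<lambda>x. complex_of_real (Im (B x))) \<xi> = 0" for \<xi>
    by (simp_all only: lin)
  then have "AE x in lborel. Re (B x) = 0" "AE x in lborel. Im (B x) = 0"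
    using B by (auto intro!: fourier_zero_imp_AE_zero_real)
  then show ?thesis by eventually_elim (simp add: complex_eq_iff)
qed

section \<open>Transforms of test functions and Fourier inversion\<close>

abbreviation fourier_real :: "(real \<Rightarrow> real) \<Rightarrow> real \<Rightarrow> complex" where
  "fourier_real f \<equiv> fourier (\<lambda>x. complex_of_real (f x))"

lemma fourier_real_minus: "fourier_real f (- \<xi>) = cnj (fourier_real f \<xi>)"
  by (simp add: fourier_cnj) (simp add: fourier_def)

lemma test_fun_fourier:
  assumes "test_fun f"
  shows "integrable lborel (\<lambda>x. complex_of_real (f x))" "(\<lambda>x. complex_of_real (f x)) \<in> L2"
    "fourier_real f \<in> L2" "is_fourier (\<lambda>x. complex_of_real (f x)) (fourier_real f)"
proof -
  show *: "integrable lborel (\<lambda>x. complex_of_real (f x))" "(\<lambda>x. complex_of_real (f x)) \<in> L2"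
    using test_fun_integrable[OF assms] test_fun_L2[OF assms] by (auto intro: L2_of_real)
  show "fourier_real f \<in> L2" "is_fourier (\<lambda>x. complex_of_real (f x)) (fourier_real f)"
    by (intro fourier_in_L2 is_fourier_fourier *)+
qed

text \<open>Integration by parts, as the fundamental theorem for
  \<open>cis (- (\<xi> * x)) * f x\<close> on an interval [-R, R] reaching beyond the supports of f
  and its derivative, where the boundary terms vanish.\<close>

lemma fourier_deriv:
  assumes f: "test_fun f"
  shows "fourier_real (deriv f) \<xi> = \<i> * \<xi> * fourier_real f \<xi>"
proof -
  obtain B where B: "B > 0" "\<And>x. \<bar>f x\<bar> \<le> B" "\<And>x. \<bar>x\<bar> > B \<Longrightarrow> f x = 0"
    using test_fun_bounded[OF f] by blast
  obtain B' where B': "B' > 0" "\<And>x. \<bar>deriv f x\<bar> \<le> B'" "\<And>x. \<bar>x\<bar> > B' \<Longrightarrow> deriv f x = 0"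
    using test_fun_bounded[OF test_fun_deriv[OF f]] by blast
  define R where "R = B + B' + 1"
  define h where "h x = cis (- (\<xi> * x)) * complex_of_real (deriv f x) - \<i> * \<xi> * (cis (- (\<xi> * x)) * complex_of_real (f x))" for x
  have h0: "h x = 0" if "x \<notin> {- R..R}" for x
    using that B(1) B(3)[of x] B'(1) B'(3)[of x] by (force simp: h_def R_def abs_if)
  have "(LBINT x. indicator {- R..R} x *\<^sub>R h x)
      = cis (- (\<xi> * R)) * complex_of_real (f R) - cis (- (\<xi> * (- R))) * complex_of_real (f (- R))"
  proof (rule integral_FTC_atLeastAtMost)
    show "- R \<le> R" using B(1) B'(1) by (simp add: R_def)
    fix x
    have "(f has_vector_derivative deriv f x) (at x within {- R..R})"
      using test_fun_DERIV[OF f, of x] has_vector_derivative_at_within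
      by (auto simp: has_real_derivative_iff_has_vector_derivative)
    then have "((\<lambda>x. complex_of_real (f x)) has_vector_derivative complex_of_real (deriv f x)) (at x within {- R..R})"
      by (rule bounded_linear.has_vector_derivative[OF bounded_linear_of_real])
    moreover have "((\<lambda>x. cis (- (\<xi> * x))) has_vector_derivative (- \<xi>) *\<^sub>R (\<i> * cis (- (\<xi> * x)))) (at x within {- R..R})"
    proof -
      have "((cis \<circ> (\<lambda>x. - (\<xi> * x))) has_vector_derivative (- \<xi>) *\<^sub>R (\<i> * cis (- (\<xi> * x)))) (at x within {- R..R})"
        by (rule vector_diff_chain_within)
          (auto intro!: derivative_eq_intros simp: has_vector_derivative_def cis_conv_exp scaleR_conv_of_real mult_ac)
      then show ?thesis by (simp add: o_def)
    qed
    ultimately have "((\<lambda>x. cis (- (\<xi> * x)) * complex_of_real (f x)) has_vector_derivative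
        cis (- (\<xi> * x)) * complex_of_real (deriv f x) + (- \<xi>) *\<^sub>R (\<i> * cis (- (\<xi> * x))) * complex_of_real (f x)) (at x within {- R..R})"
      by (intro has_vector_derivative_mult)
    then show "((\<lambda>x. cis (- (\<xi> * x)) * complex_of_real (f x)) has_vector_derivative h x) (at x within {- R..R})"
      by (rule has_vector_derivative_eq_rhs) (simp add: h_def scaleR_conv_of_real mult_ac)
  next
    show "continuous_on {- R..R} h"
      unfolding h_def[abs_def]
      using test_fun_continuous[OF f] test_fun_continuous[OF test_fun_deriv[OF f]]
      by (intro continuous_intros) (auto intro: continuous_on_subset)
  qed
  moreover have "f R = 0" "f (- R) = 0" using B(1) B'(1) by (auto intro!: B(3) simp: R_def)
  moreover have "indicator {- R..R} x *\<^sub>R h x = h x" for x using h0[of x] by (auto simp: indicator_def)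
  ultimately have "(LBINT x. h x) = 0" by simp
  moreover have "(LBINT x. h x) = fourier_real (deriv f) \<xi> - \<i> * \<xi> * fourier_real f \<xi>"
    unfolding h_def fourier_def
    using integrable_fourier_kernel[OF test_fun_fourier(1)[OF f], of \<xi>]
      integrable_fourier_kernel[OF test_fun_fourier(1)[OF test_fun_deriv[OF f]], of \<xi>]
    by (subst Bochner_Integration.integral_diff) (simp_all only: integrable_mult_right integral_mult_right_zero)
  ultimately show ?thesis by simp
qed

text \<open>On the support of the rescaled bump |\<xi> x| \<le> 1 < pi / 2, so cos (\<xi> x) \<ge>
  cos 1 > 0 and the real part of the transform is positive. Hence the countably many rescaled bumps
  have no common zero in frequency. The \<open>0 +\<close> keeps the shape of
  \<open>test_fun_affine\<close>.\<close>

lemma fourier_bump_pos: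
  assumes "\<bar>\<xi>\<bar> \<le> real (Suc n)"
  shows "fourier_real (\<lambda>x. bump (0 + real (Suc n) * x)) \<xi> \<noteq> 0"
proof -
  define N where "N = real (Suc n)"
  have N: "N > 0" "\<bar>\<xi>\<bar> \<le> N" using assms by (auto simp: N_def)
  have t: "test_fun (\<lambda>x. bump (0 + N * x))" using N by (intro test_fun_affine test_fun_bump) auto
  note i = integrable_fourier_kernel[OF test_fun_fourier(1)[OF t], of \<xi>]
  have cos1: "cos (1::real) > 0" by (rule cos_gt_zero) (use pi_gt3 in auto)
  have "0 < (LBINT x. indicator {- (1 / (2 * N))..1 / (2 * N)} x * (cos 1 * exp (- 4 :: real)))"
  proof -
    have "measure lborel {- (1 / (2 * N))..1 / (2 * N)} = 1 / N" using N by (simp add: field_simps)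
    then show ?thesis using N cos1 by (simp only: integral_mult_left_zero integral_indicator) (simp add: emeasure_lborel_Icc_eq)
  qed
  also have "\<dots> \<le> (LBINT x. Re (cis (- (\<xi> * x)) * complex_of_real (bump (0 + N * x))))"
  proof (rule integral_mono)
    show "integrable lborel (\<lambda>x. Re (cis (- (\<xi> * x)) * complex_of_real (bump (0 + N * x))))"
      using i by (rule integrable_Re)
    fix x
    have re: "Re (cis (- (\<xi> * x)) * complex_of_real (bump (0 + N * x))) = cos (\<xi> * x) * bump (N * x)" by simp
    have c: "cos 1 \<le> cos (\<xi> * x)" if "\<bar>N * x\<bar> \<le> 1"
    proof -
      have "\<bar>\<xi> * x\<bar> \<le> \<bar>N * x\<bar>" unfolding abs_mult using N by (intro mult_right_mono) auto
      then have "\<bar>\<xi> * x\<bar> \<le> 1" using that by linarith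
      then have "cos 1 \<le> cos \<bar>\<xi> * x\<bar>" using pi_gt3 by (intro cos_monotone_0_pi_le) auto
      then show ?thesis by simp
    qed
    show "indicator {- (1 / (2 * N))..1 / (2 * N)} x * (cos 1 * exp (- 4))
      \<le> Re (cis (- (\<xi> * x)) * complex_of_real (bump (0 + N * x)))"
    proof (cases "x \<in> {- (1 / (2 * N))..1 / (2 * N)}")
      case True
      then have "\<bar>N * x\<bar> \<le> 1 / 2" using N by (auto simp: abs_le_iff field_simps)
      then show ?thesis unfolding re using True cos1 c bump_ge[of "N * x"]
        by (auto intro!: mult_mono)
    next
      case False
      have "0 \<le> cos (\<xi> * x) * bump (N * x)"
      proof (cases "\<bar>N * x\<bar> \<le> 1")
        case True
        then show ?thesis using c cos1 bump_nonneg by (intro mult_nonneg_nonneg) auto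
      qed (simp add: bump_eq_0)
      then show ?thesis unfolding re using False by simp
    qed
  qed (auto simp: emeasure_lborel_Icc_eq)
  also have "\<dots> = Re (fourier_real (\<lambda>x. bump (0 + N * x)) \<xi>)"
    unfolding fourier_def using i by (rule integral_Re)
  finally show ?thesis unfolding N_def by (intro notI) simp
qed

text \<open>Translating the test function multiplies its transform by a character, so the hypothesis says
  that the integrable function \<open>A \<cdot> cnj (fourier \<theta>)\<close> has vanishing Fourier transform.\<close>

lemma AE_zero_if_orthogonal_to_test_funs:
  assumes int: "\<And>f. test_fun f \<Longrightarrow> integrable lborel (\<lambda>\<xi>. A \<xi> * cnj (fourier_real f \<xi>))"
    and zero: "\<And>f. test_fun f \<Longrightarrow> (LBINT \<xi>. A \<xi> * cnj (fourier_real f \<xi>)) = 0"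
  shows "AE \<xi> in lborel. A \<xi> = 0"
proof -
  have *: "AE \<xi> in lborel. A \<xi> * cnj (fourier_real f \<xi>) = 0" if f: "test_fun f" for f
  proof (rule fourier_zero_imp_AE_zero[OF int[OF f]])
    fix a
    have "test_fun (\<lambda>x. f (a + x))" using test_fun_affine[OF f, of 1 a] by simp
    from zero[OF this] have "(LBINT \<xi>. A \<xi> * cnj (cis (\<xi> * a) * fourier_real f \<xi>)) = 0"
      using fourier_translate[of "\<lambda>x. complex_of_real (f x)" a] by simp
    then show "fourier (\<lambda>\<xi>. A \<xi> * cnj (fourier_real f \<xi>)) a = 0"
      unfolding fourier_def[of "\<lambda>\<xi>. A \<xi> * cnj (fourier_real f \<xi>)"]
      by (simp add: cis_cnj mult_ac)
  qed
  \<comment> \<open>One null set must serve all the test functions involved, so a countable family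
    is used; at every \<xi> one of its members has a nonzero transform.\<close>
  have "AE \<xi> in lborel. \<forall>n. A \<xi> * cnj (fourier_real (\<lambda>x. bump (0 + real (Suc n) * x)) \<xi>) = 0"
    unfolding AE_all_countable by (intro allI * test_fun_affine test_fun_bump) auto
  then show ?thesis
  proof eventually_elim
    case (elim \<xi>)
    obtain n where "\<bar>\<xi>\<bar> \<le> real n" using real_arch_simple by blast
    then have "\<bar>\<xi>\<bar> \<le> real (Suc n)" by simp
    from fourier_bump_pos[OF this] elim[rule_format, of n] show ?case by simp
  qed
qed

lemma is_fourier_cong_AE:
  assumes F: "is_fourier f F" and eq: "AE \<xi> in lborel. F \<xi> = G \<xi>" and G: "G \<in> borel_measurable borel"
  shows "is_fourier f G"
proof -
  have [measurable]: "F \<in> borel_measurable borel" using F by (auto dest: is_fourier_L2 intro: L2_measurable)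
  note [measurable] = G
  have "L2_nn G = L2_nn F"
    by (rule nn_integral_cong_AE) (use eq in \<open>eventually_elim, simp\<close>)
  then have G2: "G \<in> L2" using is_fourier_L2(2)[OF F] by (simp add: L2_iff_nn_integral)
  have f2: "f \<in> L2" by (rule is_fourier_L2[OF F])
  have "L2_sq (\<lambda>\<xi>. G \<xi> - fourier (trunc f n) \<xi>) = L2_sq (\<lambda>\<xi>. F \<xi> - fourier (trunc f n) \<xi>)" for n
  proof (rule integral_cong_AE)
    note [measurable] = L2_measurable[OF trunc_L2[OF f2]]
    show "(\<lambda>\<xi>. (norm (G \<xi> - fourier (trunc f n) \<xi>))\<^sup>2) \<in> borel_measurable lborel"
      "(\<lambda>\<xi>. (norm (F \<xi> - fourier (trunc f n) \<xi>))\<^sup>2) \<in> borel_measurable lborel" by measurable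
  qed (use eq in \<open>eventually_elim, simp\<close>)
  then show ?thesis using F G2 by (simp add: is_fourier_iff L2_tendsto_def)
qed

text \<open>The candidate h has some L2 transform H. Parseval for h and
  \<open>fourier_mult_formula\<close> for F give H and F the same pairing with the transform of each
  test function, so they agree almost everywhere.\<close>

theorem fourier_inversion:
  assumes F: "integrable lborel F" "F \<in> L2"
  shows "is_fourier (\<lambda>x. fourier F (- x) / (2 * pi)) F"
proof -
  define h where "h x = fourier F (- x) / (2 * pi)" for x
  have h_eq: "h = (\<lambda>x. complex_of_real (1 / (2 * pi)) * fourier F (- x))" by (auto simp: h_def)
  have h2: "h \<in> L2" unfolding h_eq by (rule L2_scale[OF L2_reflect[OF fourier_in_L2[OF F]]])
  obtain H where H: "is_fourier h H" using is_fourier_exists[OF h2] by blast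
  have H2: "H \<in> L2" by (rule is_fourier_L2[OF H])
  have "AE \<xi> in lborel. H \<xi> - F \<xi> = 0"
  proof (rule AE_zero_if_orthogonal_to_test_funs)
    fix f assume f: "test_fun f"
    note tf = test_fun_fourier[OF f]
    have iH: "integrable lborel (\<lambda>\<xi>. H \<xi> * cnj (fourier_real f \<xi>))"
      and iF: "integrable lborel (\<lambda>\<xi>. F \<xi> * cnj (fourier_real f \<xi>))"
      by (intro L2_mult_integrable H2 F L2_cnj tf)+
    then show "integrable lborel (\<lambda>\<xi>. (H \<xi> - F \<xi>) * cnj (fourier_real f \<xi>))"
      by (simp add: left_diff_distrib)
    have "test_fun (\<lambda>x. f (- x))" using test_fun_affine[OF f, of "-1" 0] by simp
    note tf' = test_fun_fourier[OF this]
    have "(LBINT \<xi>. H \<xi> * cnj (fourier_real f \<xi>)) = 2 * pi * (LBINT x. h x * cnj (complex_of_real (f x)))"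
      by (rule parseval[OF H tf(4)])
    also have "\<dots> = (LBINT x. complex_of_real (2 * pi) * (h x * cnj (complex_of_real (f x))))"
      by (simp only: integral_mult_right_zero)
    also have "\<dots> = (LBINT x. fourier F (- x) * complex_of_real (f x))"
      by (simp add: h_def)
    \<comment> \<open>The reflection in h moves onto f; as f is real, the transform of its
      reflection is \<open>cnj (fourier_real f \<xi>)\<close>.\<close>
    also have "\<dots> = (LBINT x. fourier F x * complex_of_real (f (- x)))"
      by (subst lborel_integral_real_affine[of "-1" _ 0]) auto
    also have "\<dots> = (LBINT \<xi>. F \<xi> * fourier_real (\<lambda>x. f (- x)) \<xi>)"
      by (rule fourier_mult_formula[OF F(1) tf'(1)])
    also have "\<dots> = (LBINT \<xi>. F \<xi> * cnj (fourier_real f \<xi>))"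
      using fourier_affine[of "-1" "\<lambda>x. complex_of_real (f x)"] by (simp add: fourier_real_minus)
    finally show "(LBINT \<xi>. (H \<xi> - F \<xi>) * cnj (fourier_real f \<xi>)) = 0"
      using iH iF by (simp add: left_diff_distrib)
  qed
  then have "AE \<xi> in lborel. H \<xi> = F \<xi>" by simp
  from is_fourier_cong_AE[OF H this L2_measurable[OF F(2)]] show ?thesis by (simp add: h_def[abs_def])
qed

section \<open>The dispersive symbol\<close>

abbreviation symbol :: "real \<Rightarrow> real" where
  "symbol \<equiv> \<lambda>\<xi>. lap_symbol (1/2) \<xi> * m_symbol \<xi>"

lemma symbol_eq: "symbol \<xi> = \<bar>\<xi>\<bar> * m_symbol \<xi>"
  by (cases "\<xi> = 0") (simp_all add: lap_symbol_def)

lemma m_symbol_nonneg: "m_symbol \<xi> \<ge> 0"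
proof -
  have "tanh \<xi> / \<xi> \<ge> 0" by (cases "\<xi> \<ge> 0") (auto simp: zero_le_divide_iff)
  then have "0 \<le> (1 + \<xi>\<^sup>2) * (tanh \<xi> / \<xi>)" by (intro mult_nonneg_nonneg) auto
  then show ?thesis unfolding m_symbol_def by simp
qed

lemma m_symbol_minus: "m_symbol (- \<xi>) = m_symbol \<xi>"
  by (simp add: m_symbol_def)

lemma symbol_minus: "symbol (- \<xi>) = symbol \<xi>"
  unfolding symbol_eq by (simp add: m_symbol_minus)

lemma symbol_nonneg: "symbol \<xi> \<ge> 0"
  unfolding symbol_eq using m_symbol_nonneg by simp

lemma m_symbol_square: "\<xi> \<noteq> 0 \<Longrightarrow> (m_symbol \<xi>)\<^sup>2 = (1 + \<xi>\<^sup>2) * (tanh \<bar>\<xi>\<bar> / \<bar>\<xi>\<bar>)"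
proof -
  assume "\<xi> \<noteq> 0"
  have "tanh \<xi> / \<xi> \<ge> 0" by (cases "\<xi> \<ge> 0") (auto simp: zero_le_divide_iff)
  moreover have "tanh \<bar>\<xi>\<bar> / \<bar>\<xi>\<bar> = tanh \<xi> / \<xi>" by (cases "\<xi> \<ge> 0") (auto simp: abs_if)
  moreover from calculation(1) have "0 \<le> (1 + \<xi>\<^sup>2) * (tanh \<xi> / \<xi>)" by (intro mult_nonneg_nonneg) auto
  ultimately show ?thesis using \<open>\<xi> \<noteq> 0\<close> unfolding m_symbol_def by (simp del: tanh_real_abs)
qed

text \<open>From \<sigma>^2 = (1 + \<xi>^2) |\<xi>| tanh |\<xi>| and tanh < 1. The bound is not
  sharp, but quadratic growth is what two derivatives of a test function can pay for.\<close>

lemma symbol_le: "symbol \<xi> \<le> 1 + \<xi>\<^sup>2"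
proof (cases "\<xi> = 0")
  case False
  have "(\<bar>\<xi>\<bar> * m_symbol \<xi>)\<^sup>2 = (1 + \<xi>\<^sup>2) * (\<bar>\<xi>\<bar> * tanh \<bar>\<xi>\<bar>)"
    unfolding power_mult_distrib m_symbol_square[OF False] using False by (simp add: field_simps power2_eq_square)
  also have "\<dots> \<le> (1 + \<xi>\<^sup>2) * (1 + \<xi>\<^sup>2)"
  proof (intro mult_left_mono)
    have "\<bar>\<xi>\<bar> * tanh \<bar>\<xi>\<bar> \<le> \<bar>\<xi>\<bar> * 1" using tanh_real_lt_1[of "\<bar>\<xi>\<bar>"] by (intro mult_left_mono) auto
    also have "\<dots> \<le> 1 + \<xi>\<^sup>2" using sum_squares_bound[of 1 "\<bar>\<xi>\<bar>"] by simp
    finally show "\<bar>\<xi>\<bar> * tanh \<bar>\<xi>\<bar> \<le> 1 + \<xi>\<^sup>2" .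
  qed simp
  finally have "(\<bar>\<xi>\<bar> * m_symbol \<xi>)\<^sup>2 \<le> (1 + \<xi>\<^sup>2)\<^sup>2" by (simp add: power2_eq_square)
  then have "\<bar>\<xi>\<bar> * m_symbol \<xi> \<le> 1 + \<xi>\<^sup>2" by (rule power2_le_imp_le) simp
  then show ?thesis unfolding symbol_eq .
qed (simp add: lap_symbol_def)

text \<open>Superlinear growth of the symbol is what dominates the derivative in the nonlinearity.\<close>

lemma symbol_dominates:
  assumes "M > 0"
  obtains l where "l > 0" "\<And>\<xi>. M * \<bar>\<xi>\<bar> \<le> l + symbol \<xi>"
proof -
  \<comment> \<open>tanh 1 bounds tanh |\<xi>| from below for |\<xi>| \<ge> 1. Beyond
    \<open>K\<close> the square of \<open>m_symbol\<close> is at least |\<xi>| T \<ge> M^2, and up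
    to \<open>K\<close> the constant l = M K covers M |\<xi>|.\<close>
  define T where "T = tanh (1::real)"
  have T: "T > 0" by (simp add: T_def)
  define K where "K = max 1 (M\<^sup>2 / T)"
  show ?thesis
  proof (rule that[of "M * K"])
    show "M * K > 0" using assms by (simp add: K_def)
    fix \<xi>
    show "M * \<bar>\<xi>\<bar> \<le> M * K + symbol \<xi>"
    proof (cases "\<bar>\<xi>\<bar> \<le> K")
      case True
      then have "M * \<bar>\<xi>\<bar> \<le> M * K" using assms by (intro mult_left_mono) auto
      then show ?thesis using symbol_nonneg[of \<xi>] by linarith
    next
      case False
      then have x: "\<bar>\<xi>\<bar> \<ge> 1" "\<bar>\<xi>\<bar> \<ge> M\<^sup>2 / T" "\<xi> \<noteq> 0" by (auto simp: K_def)
      have "M\<^sup>2 \<le> \<bar>\<xi>\<bar> * T" using x(2) T by (simp add: field_simps)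
      also have "\<dots> \<le> \<bar>\<xi>\<bar> * tanh \<bar>\<xi>\<bar>"
        unfolding T_def using x(1) by (intro mult_left_mono) (simp_all del: tanh_real_abs)
      also have "\<dots> = \<xi>\<^sup>2 * (tanh \<bar>\<xi>\<bar> / \<bar>\<xi>\<bar>)"
      proof -
        have "\<xi>\<^sup>2 = \<bar>\<xi>\<bar> * \<bar>\<xi>\<bar>" by (simp add: power2_eq_square)
        then show ?thesis using x(3) by (simp del: tanh_real_abs abs_mult_self_eq)
      qed
      also have "\<dots> \<le> (1 + \<xi>\<^sup>2) * (tanh \<bar>\<xi>\<bar> / \<bar>\<xi>\<bar>)" by (intro mult_right_mono) auto
      also have "\<dots> = (m_symbol \<xi>)\<^sup>2" using m_symbol_square[OF x(3)] by simp
      finally have "M \<le> m_symbol \<xi>" by (rule power2_le_imp_le) (rule m_symbol_nonneg)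
      then have "\<bar>\<xi>\<bar> * M \<le> symbol \<xi>" unfolding symbol_eq by (intro mult_left_mono) auto
      moreover have "M * K \<ge> 0" using \<open>M * K > 0\<close> by simp
      ultimately show ?thesis by (simp only: mult.commute[of M "\<bar>\<xi>\<bar>"])
    qed
  qed
qed

lemma symbol_measurable [measurable]: "symbol \<in> borel_measurable borel"
proof -
  have [measurable]: "(\<lambda>\<xi>::real. tanh \<xi> / \<xi>) \<in> borel_measurable borel"
    unfolding tanh_def by (intro borel_measurable_divide borel_measurable_continuous_onI)
      (auto intro!: continuous_intros)
  have "m_symbol \<in> borel_measurable borel"
    unfolding m_symbol_def[abs_def] by measurable
  then show ?thesis unfolding symbol_eq by measurable
qed

lemma integrable_inverse_one_plus_square: "integrable lborel (\<lambda>x::real. inverse (1 + x\<^sup>2))"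
  using integrable_inverse_1_plus_square by (simp add: set_integrable_def)

lemma L2_of_real_norm: "f \<in> L2 \<Longrightarrow> (\<lambda>x. complex_of_real (norm (f x))) \<in> L2"
  by (rule L2_bound[of f _ 1]) (auto dest: L2_measurable)

text \<open>Two derivatives of f control the product in L2. Four derivatives bound (1 + \<xi>^4)
  times the transform, which leaves the pointwise decay 2 C / (1 + \<xi>^2) and hence
  integrability.\<close>

lemma symbol_fourier_bounds:
  assumes f: "test_fun f"
  shows "integrable lborel (\<lambda>\<xi>. complex_of_real (symbol \<xi>) * fourier_real f \<xi>)"
    and "(\<lambda>\<xi>. complex_of_real (symbol \<xi>) * fourier_real f \<xi>) \<in> L2"
proof -
  let ?F = "\<lambda>\<xi>. complex_of_real (symbol \<xi>) * fourier_real f \<xi>"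
  note f1 = test_fun_deriv[OF f]
  note f2 = test_fun_deriv[OF f1]
  note f3 = test_fun_deriv[OF f2]
  note f4 = test_fun_deriv[OF f3]
  have [measurable]: "fourier_real f \<in> borel_measurable borel"
    using test_fun_fourier(3)[OF f] by (rule L2_measurable)
  have i2: "\<i> * z * (\<i> * z * w) = - z\<^sup>2 * w" for z w :: complex
    by (simp add: power2_eq_square algebra_simps)
  have d2: "fourier_real (deriv (deriv f)) \<xi> = - (complex_of_real \<xi>)\<^sup>2 * fourier_real f \<xi>" for \<xi>
    unfolding fourier_deriv[OF f1] fourier_deriv[OF f] by (rule i2)
  have d4: "fourier_real (deriv (deriv (deriv (deriv f)))) \<xi> = (complex_of_real \<xi>) ^ 4 * fourier_real f \<xi>" for \<xi>
  proof -
    have "fourier_real (deriv (deriv (deriv (deriv f)))) \<xi> = - (complex_of_real \<xi>)\<^sup>2 * (- (complex_of_real \<xi>)\<^sup>2 * fourier_real f \<xi>)"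
      unfolding d2[symmetric] fourier_deriv[OF f3] fourier_deriv[OF f2] by (rule i2)
    then show ?thesis by (simp add: power2_eq_square power4_eq_xxxx mult.assoc)
  qed
  have bound: "norm (?F \<xi>) \<le> norm (fourier_real f \<xi>) + norm (fourier_real (deriv (deriv f)) \<xi>)" for \<xi>
  proof -
    have "norm (?F \<xi>) = symbol \<xi> * norm (fourier_real f \<xi>)"
      using symbol_nonneg[of \<xi>] by (simp add: norm_mult del: of_real_mult)
    also have "\<dots> \<le> (1 + \<xi>\<^sup>2) * norm (fourier_real f \<xi>)"
      using symbol_le by (intro mult_right_mono) auto
    also have "\<dots> = norm (fourier_real f \<xi>) + norm (fourier_real (deriv (deriv f)) \<xi>)"
      by (simp add: d2 norm_mult norm_power distrib_right)
    finally show ?thesis .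
  qed
  show "?F \<in> L2"
  proof (rule L2_bound[where C=1])
    show "(\<lambda>\<xi>. complex_of_real (norm (fourier_real f \<xi>)) + complex_of_real (norm (fourier_real (deriv (deriv f)) \<xi>))) \<in> L2"
      by (intro L2_add L2_of_real_norm test_fun_fourier(3) f f2)
    fix \<xi>
    show "norm (?F \<xi>) \<le> 1 * norm (complex_of_real (norm (fourier_real f \<xi>)) + complex_of_real (norm (fourier_real (deriv (deriv f)) \<xi>)))"
      using bound[of \<xi>] by (simp add: of_real_add[symmetric] del: of_real_add)
  qed measurable
  define C where "C = (LBINT x. norm (complex_of_real (f x)))
    + (LBINT x. norm (complex_of_real (deriv (deriv (deriv (deriv f))) x)))"
  show "integrable lborel ?F"
  proof (rule Bochner_Integration.integrable_bound)
    show "integrable lborel (\<lambda>x. (2 * C) * inverse (1 + x\<^sup>2))"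
      by (intro integrable_mult_right integrable_inverse_one_plus_square)
    have "norm (?F \<xi>) \<le> (2 * C) * inverse (1 + \<xi>\<^sup>2)" for \<xi>
    proof -
      define n where "n = norm (fourier_real f \<xi>)"
      have "(1 + \<xi> ^ 4) * n = norm (fourier_real f \<xi>) + norm (fourier_real (deriv (deriv (deriv (deriv f)))) \<xi>)"
        by (simp add: d4 n_def norm_mult norm_power distrib_right)
      also have "\<dots> \<le> C" unfolding C_def by (intro add_mono norm_fourier_le)
      finally have n: "(1 + \<xi> ^ 4) * n \<le> C" .
      have "(1 + \<xi>\<^sup>2) * (1 + \<xi>\<^sup>2) \<le> 2 * (1 + \<xi> ^ 4)"
        using sum_squares_bound[of 1 "\<xi>\<^sup>2"] by (simp add: power2_eq_square power4_eq_xxxx algebra_simps)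
      then have "(1 + \<xi>\<^sup>2) * (1 + \<xi>\<^sup>2) * n \<le> 2 * (1 + \<xi> ^ 4) * n"
        by (intro mult_right_mono) (auto simp: n_def)
      then have le: "(1 + \<xi>\<^sup>2) * ((1 + \<xi>\<^sup>2) * n) \<le> 2 * C" using n by (simp add: mult.assoc distrib_right)
      have "norm (?F \<xi>) = symbol \<xi> * n"
        using symbol_nonneg[of \<xi>] by (simp add: norm_mult n_def del: of_real_mult)
      also have "\<dots> \<le> (1 + \<xi>\<^sup>2) * n"
        using symbol_le by (intro mult_right_mono) (auto simp: n_def)
      also have "\<dots> \<le> (2 * C) * inverse (1 + \<xi>\<^sup>2)"
      proof -
        have "0 < 1 + \<xi>\<^sup>2" by (rule add_pos_nonneg) auto
        then show ?thesis using le by (simp add: field_simps)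
      qed
      finally show ?thesis .
    qed
    then show "AE \<xi> in lborel. norm (?F \<xi>) \<le> norm ((2 * C) * inverse (1 + \<xi>\<^sup>2))"
      by (intro AE_I2) (metis abs_ge_self order_trans real_norm_def)
  qed measurable
qed

section \<open>The multiplier on test functions\<close>

text \<open>\<open>multiplier\<close> is a choice, so a real image has to be exhibited: the inverse
  transform of \<open>F\<close>, which is real because F (- \<xi>) = cnj (F \<xi>) for an even real
  symbol and a real f.\<close>

lemma multiplier_test_fun:
  assumes f: "test_fun f"
  shows "is_multiplier_image symbol f (multiplier symbol f)"
  unfolding multiplier_def
proof (rule someI_ex[of "is_multiplier_image symbol f"])
  define F where "F \<xi> = complex_of_real (symbol \<xi>) * fourier_real f \<xi>" for \<xi>
  have F: "integrable lborel F" "F \<in> L2"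
    using symbol_fourier_bounds[OF f] by (simp_all add: F_def[abs_def])
  have inv: "is_fourier (\<lambda>x. fourier F (- x) / (2 * pi)) F" by (rule fourier_inversion[OF F])
  have sym: "cnj (F \<xi>) = F (- \<xi>)" for \<xi>
    unfolding F_def symbol_minus fourier_real_minus by simp
  have "cnj (fourier F x) = fourier F x" for x
  proof -
    have "cnj (fourier F x) = (LBINT \<xi>. cis (x * \<xi>) * F (- \<xi>))"
      unfolding fourier_cnj sym ..
    also have "\<dots> = fourier F x"
      unfolding fourier_def by (subst lborel_integral_real_affine[of "-1" _ 0]) auto
    finally show ?thesis .
  qed
  then have "complex_of_real (Re (fourier F x)) = fourier F x" for x
    by (metis Reals_cnj_iff of_real_Re)
  then have "(\<lambda>x. complex_of_real (Re (fourier F (- x)) / (2 * pi))) = (\<lambda>x. fourier F (- x) / (2 * pi))"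
    by simp
  with inv have "is_fourier (\<lambda>x. complex_of_real (Re (fourier F (- x)) / (2 * pi))) F"
    by (simp only:)
  then have "is_multiplier_image symbol f (\<lambda>x. Re (fourier F (- x)) / (2 * pi))"
    unfolding is_multiplier_image_def F_def[abs_def, symmetric]
    using test_fun_fourier(4)[OF f] by (intro exI[of _ "fourier_real f"]) (simp only: F_def[abs_def] simp_thms)
  then show "\<exists>h. is_multiplier_image symbol f h" by blast
qed

lemma is_multiplier_imageD:
  assumes f: "test_fun f" and h: "is_multiplier_image symbol f h"
  shows "is_fourier (\<lambda>x. complex_of_real (h x)) (\<lambda>\<xi>. complex_of_real (symbol \<xi>) * fourier_real f \<xi>)"
proof -
  obtain F where F: "is_fourier (\<lambda>x. complex_of_real (f x)) F"
    and hF: "is_fourier (\<lambda>x. complex_of_real (h x)) (\<lambda>\<xi>. complex_of_real (symbol \<xi>) * F \<xi>)"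
    using h by (auto simp: is_multiplier_image_def)
  have eq: "AE \<xi> in lborel. F \<xi> = fourier_real f \<xi>"
    by (rule is_fourier_unique[OF F test_fun_fourier(4)[OF f]])
  show ?thesis
  proof (rule is_fourier_cong_AE[OF hF])
    show "AE \<xi> in lborel. complex_of_real (symbol \<xi>) * F \<xi> = complex_of_real (symbol \<xi>) * fourier_real f \<xi>"
      using eq by eventually_elim simp
    show "(\<lambda>\<xi>. complex_of_real (symbol \<xi>) * fourier_real f \<xi>) \<in> borel_measurable borel"
      by (rule L2_measurable[OF symbol_fourier_bounds(2)[OF f]])
  qed
qed

lemma multiplier_fourier:
  assumes f: "test_fun f"
  shows "is_fourier (\<lambda>x. complex_of_real (multiplier symbol f x)) (\<lambda>\<xi>. complex_of_real (symbol \<xi>) * fourier_real f \<xi>)"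
  by (rule is_multiplier_imageD[OF f multiplier_test_fun[OF f]])

lemma multiplier_L2:
  assumes f: "test_fun f"
  shows "multiplier symbol f \<in> L2"
  using L2_Re[OF is_fourier_L2(1)[OF multiplier_fourier[OF f]]] by simp

text \<open>The choice behind \<open>multiplier\<close> is made separately for every argument, so
  homogeneity is available only almost everywhere. It lets one fixed function represent the
  multiplier of \<open>\<eta> t * f x\<close> at all times.\<close>

lemma multiplier_scale:
  assumes f: "test_fun f"
  shows "AE x in lborel. multiplier symbol (\<lambda>x. c * f x) x = c * multiplier symbol f x"
proof -
  have cf: "test_fun (\<lambda>x. c * f x)" by (rule test_fun_mult[OF k_smooth_const f])
  have "is_fourier (\<lambda>x. complex_of_real c * complex_of_real (multiplier symbol f x))
      (\<lambda>\<xi>. complex_of_real c * (complex_of_real (symbol \<xi>) * fourier_real f \<xi>))"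
    by (rule is_fourier_scale[OF multiplier_fourier[OF f]])
  moreover have "fourier_real (\<lambda>x. c * f x) \<xi> = complex_of_real c * fourier_real f \<xi>" for \<xi>
    unfolding fourier_def by (simp only: of_real_mult mult.left_commute[of _ "complex_of_real c"] integral_mult_right_zero)
  ultimately have "AE x in lborel. complex_of_real (multiplier symbol (\<lambda>x. c * f x) x) = complex_of_real c * complex_of_real (multiplier symbol f x)"
    by (intro is_fourier_inject[OF multiplier_fourier[OF cf]]) (auto simp: mult_ac)
  then show ?thesis by eventually_elim (simp flip: of_real_mult)
qed

text \<open>Parseval turns the tested equation into orthogonality of \<open>A\<close> to the
  transforms of all test functions, so A = 0 almost everywhere. The modulus of
  \<open>c \<xi>\<close> is at least l + \<sigma>(\<xi>), whatever s is; cancelling |\<xi>| leaves M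
  |V| \<le> |H| / 2.\<close>

lemma resolvent_estimate:
  fixes W G :: "real \<Rightarrow> complex" and l s M :: real
  assumes W: "W \<in> L2" and G: "G \<in> L2" and M: "M > 0" and dom: "\<And>\<xi>. M * \<bar>\<xi>\<bar> \<le> l + symbol \<xi>" and l: "l > 0"
    and eq: "\<And>f. test_fun f \<Longrightarrow> (complex_of_real l + \<i> * s) * (LBINT x. W x * complex_of_real (f x))
      + (LBINT x. W x * complex_of_real (multiplier symbol f x))
      + (LBINT x. G x * complex_of_real (deriv f x)) / 2 = 0" (is "\<And>f. _ \<Longrightarrow> ?E f = 0")
  shows "M\<^sup>2 * L2_sq W \<le> L2_sq G / 4"
proof -
  obtain V where V: "is_fourier W V" using is_fourier_exists[OF W] by blast
  obtain H where H: "is_fourier G H" using is_fourier_exists[OF G] by blast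
  note V2 = is_fourier_L2(2)[OF V] and H2 = is_fourier_L2(2)[OF H]
  define c where "c \<xi> = complex_of_real (l + symbol \<xi>) + \<i> * s" for \<xi>
  define A where "A \<xi> = c \<xi> * V \<xi> - \<i> * \<xi> * H \<xi> / 2" for \<xi>
  have "AE \<xi> in lborel. A \<xi> = 0"
  proof (rule AE_zero_if_orthogonal_to_test_funs)
    fix f assume f: "test_fun f"
    note f' = test_fun_deriv[OF f]
    note tf = test_fun_fourier[OF f] and tf' = test_fun_fourier[OF f'] and mf = multiplier_fourier[OF f]
    define s1 s2 s3 where
      "s1 \<xi> = V \<xi> * cnj (fourier_real f \<xi>)" and
      "s2 \<xi> = V \<xi> * cnj (complex_of_real (symbol \<xi>) * fourier_real f \<xi>)" and
      "s3 \<xi> = H \<xi> * cnj (fourier_real (deriv f) \<xi>)" for \<xi>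
    have i: "integrable lborel s1" "integrable lborel s2" "integrable lborel s3"
      unfolding s1_def[abs_def] s2_def[abs_def] s3_def[abs_def]
      by (intro L2_mult_integrable V2 H2 L2_cnj tf tf' symbol_fourier_bounds f)+
    \<comment> \<open>\<open>deriv f\<close> contributes i \<xi> under a conjugation, which is where
      the minus sign in \<open>A\<close> comes from.\<close>
    have A_eq: "A \<xi> * cnj (fourier_real f \<xi>) = (complex_of_real l + \<i> * s) * s1 \<xi> + s2 \<xi> + s3 \<xi> / 2" for \<xi>
      by (simp add: A_def c_def s1_def s2_def s3_def fourier_deriv[OF f] algebra_simps add_divide_distrib diff_divide_distrib)
    show "integrable lborel (\<lambda>\<xi>. A \<xi> * cnj (fourier_real f \<xi>))"
      unfolding A_eq using i by (intro Bochner_Integration.integrable_add integrable_mult_right integrable_divide_zero)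
    have p: "(LBINT \<xi>. s1 \<xi>) = 2 * pi * (LBINT x. W x * complex_of_real (f x))"
      "(LBINT \<xi>. s2 \<xi>) = 2 * pi * (LBINT x. W x * complex_of_real (multiplier symbol f x))"
      "(LBINT \<xi>. s3 \<xi>) = 2 * pi * (LBINT x. G x * complex_of_real (deriv f x))"
      unfolding s1_def s2_def s3_def
      using parseval[OF V tf(4)] parseval[OF V mf] parseval[OF H tf'(4)] by simp_all
    have "(LBINT \<xi>. A \<xi> * cnj (fourier_real f \<xi>))
        = (complex_of_real l + \<i> * s) * (LBINT \<xi>. s1 \<xi>) + (LBINT \<xi>. s2 \<xi>) + (LBINT \<xi>. s3 \<xi>) / 2"
      unfolding A_eq using i by simp
    also have "\<dots> = 2 * pi * ?E f" unfolding p by (simp add: algebra_simps)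
    finally show "(LBINT \<xi>. A \<xi> * cnj (fourier_real f \<xi>)) = 0" using eq[OF f] by simp
  qed
  \<comment> \<open>The factor |\<xi>| is cancelled below, so the origin is discarded.\<close>
  moreover have "AE \<xi> in lborel. \<xi> \<noteq> (0::real)" by (rule AE_lborel_singleton)
  ultimately have ae: "AE \<xi> in lborel. M\<^sup>2 * (norm (V \<xi>))\<^sup>2 \<le> (norm (H \<xi>))\<^sup>2 / 4"
  proof eventually_elim
    case (elim \<xi>)
    have "M * \<bar>\<xi>\<bar> * norm (V \<xi>) \<le> norm (c \<xi>) * norm (V \<xi>)"
    proof (rule mult_right_mono)
      have "l + symbol \<xi> \<le> norm (c \<xi>)" using complex_Re_le_cmod[of "c \<xi>"] by (simp add: c_def)
      then show "M * \<bar>\<xi>\<bar> \<le> norm (c \<xi>)" using dom[of \<xi>] by linarith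
    qed simp
    also have "\<dots> = norm (c \<xi> * V \<xi>)" by (simp add: norm_mult)
    also have "c \<xi> * V \<xi> = \<i> * \<xi> * H \<xi> / 2" using elim(1) by (simp add: A_def)
    also have "norm (\<i> * \<xi> * H \<xi> / 2) = \<bar>\<xi>\<bar> * norm (H \<xi>) / 2" by (simp add: norm_mult norm_divide)
    finally have "\<bar>\<xi>\<bar> * (M * norm (V \<xi>)) \<le> \<bar>\<xi>\<bar> * (norm (H \<xi>) / 2)" by (simp add: mult_ac)
    then have "M * norm (V \<xi>) \<le> norm (H \<xi>) / 2" using elim(2) by simp
    then have "(M * norm (V \<xi>))\<^sup>2 \<le> (norm (H \<xi>) / 2)\<^sup>2" using M by (intro power_mono) auto
    then show ?case by (simp add: power_mult_distrib power_divide)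
  qed
  have "M\<^sup>2 * L2_sq V = (LBINT \<xi>. M\<^sup>2 * (norm (V \<xi>))\<^sup>2)" by simp
  also have "\<dots> \<le> (LBINT \<xi>. (norm (H \<xi>))\<^sup>2 / 4)"
    using ae by (intro integral_mono_AE integrable_mult_right integrable_divide_zero L2_integrable V2 H2)
  also have "\<dots> = L2_sq H / 4" by simp
  finally have "M\<^sup>2 * (2 * pi * L2_sq W) \<le> 2 * pi * L2_sq G / 4"
    unfolding plancherel[OF V] plancherel[OF H] .
  then have "2 * pi * (M\<^sup>2 * L2_sq W) \<le> 2 * pi * ((L2_sq G) / 4)"
    by (simp add: mult_ac)
  then show ?thesis using pi_gt_zero by (simp only: mult_le_cancel_left_pos)
qed

section \<open>Laplace transform in time\<close>

text \<open>The restriction to t > 0 is built in, so that a Laplace transform at l + i s is a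
  whole-line Fourier transform at s.\<close>

definition decay :: "real \<Rightarrow> real \<Rightarrow> real" where
  "decay l t = (if t > 0 then exp (- (l * t)) else 0)"

lemma decay_measurable [measurable]: "decay l \<in> borel_measurable borel"
  unfolding decay_def[abs_def] by measurable

lemma decay_nonneg: "decay l t \<ge> 0"
  by (simp add: decay_def)

lemma decay_le_1: "l > 0 \<Longrightarrow> decay l t \<le> 1"
  by (simp add: decay_def)

lemma decay_square_le: "l > 0 \<Longrightarrow> (decay l t)\<^sup>2 \<le> decay l t"
  using mult_left_mono[OF decay_le_1[of l t] decay_nonneg[of l t]] by (simp add: power2_eq_square)

lemma integrable_decay:
  assumes "l > 0"
  shows "integrable lborel (decay l)"
proof -
  interpret prob_space "density lborel (exponential_density l)"
    by (rule prob_space_exponential_density[OF assms])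
  have "(\<integral>\<^sup>+t. ennreal (exponential_density l t) \<partial>lborel) = 1"
    using emeasure_space_1 by (simp add: emeasure_density)
  then have "integrable lborel (exponential_density l)"
    using assms by (intro integrableI_nonneg) (auto simp: exponential_density_def)
  then have "integrable lborel (\<lambda>t. exponential_density l t / l)"
    by (rule integrable_divide_zero)
  then show ?thesis
    by (rule Bochner_Integration.integrable_bound)
      (use assms in \<open>auto simp: decay_def exponential_density_def mult.commute\<close>)
qed

lemma test_cutoff_tendsto:
  assumes "test_fun c"
  shows "(\<lambda>n. c (t / real (Suc n))) \<longlonglongrightarrow> c 0"
proof -
  have "(\<lambda>n. t / real (Suc n)) \<longlonglongrightarrow> 0"
    using LIMSEQ_Suc[OF lim_const_over_n] by simp
  then show ?thesis
    using test_fun_continuous[OF assms] by (intro continuous_on_tendsto_compose[of UNIV c]) auto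
qed

text \<open>The cut-off \<open>bump (t / n) / bump 0\<close> reduces exponentials to compactly supported test functions.\<close>

lemma exponential_test:
  fixes a b :: "real \<Rightarrow> real"
  assumes l: "l > 0" and [measurable]: "a \<in> borel_measurable borel" "b \<in> borel_measurable borel"
    and bounded: "\<And>t. \<bar>a t\<bar> \<le> K" "\<And>t. \<bar>b t\<bar> \<le> K" and zero: "\<And>t. t \<le> 0 \<Longrightarrow> a t = 0 \<and> b t = 0"
    and eq: "\<And>\<eta>. test_fun \<eta> \<Longrightarrow> (LBINT t. deriv \<eta> t * a t - \<eta> t * b t) = 0"
  shows "(LBINT t. exp (- l * t) * ((- l * p + s * q) * cos (s * t) + (- l * q - s * p) * sin (s * t)) * a t
     - exp (- l * t) * (p * cos (s * t) + q * sin (s * t)) * b t) = 0"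
proof -
  have K: "K \<ge> 0" using bounded(1)[of 0] by linarith
  define E where "E t = exp (- l * t) * (p * cos (s * t) + q * sin (s * t))" for t
  \<comment> \<open>Differentiation keeps the shape of \<open>E\<close> and acts linearly on the
    coefficient pair (p, q).\<close>
  define E' where "E' t = exp (- l * t) * ((- l * p + s * q) * cos (s * t) + (- l * q - s * p) * sin (s * t))" for t
  have E: "(E has_real_derivative E' t) (at t)" for t
    unfolding E_def[abs_def] E'_def by (auto intro!: derivative_eq_intros simp: algebra_simps)
  have [measurable]: "E \<in> borel_measurable borel" "E' \<in> borel_measurable borel"
    unfolding E_def[abs_def] E'_def[abs_def] by measurable
  define Q where "Q = \<bar>p\<bar> + \<bar>q\<bar> + \<bar>- l * p + s * q\<bar> + \<bar>- l * q - s * p\<bar>"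
  have trig: "\<bar>x * cos z + y * sin z\<bar> \<le> \<bar>x\<bar> + \<bar>y\<bar>" for x y z :: real
  proof -
    have "\<bar>x * cos z\<bar> \<le> \<bar>x\<bar> * 1" "\<bar>y * sin z\<bar> \<le> \<bar>y\<bar> * 1"
      unfolding abs_mult by (intro mult_left_mono abs_cos_le_one abs_sin_le_one abs_ge_zero)+
    then show ?thesis by linarith
  qed
  have Eb: "\<bar>E t\<bar> \<le> Q * exp (- l * t)" "\<bar>E' t\<bar> \<le> Q * exp (- l * t)" for t
  proof -
    have "\<bar>p * cos (s * t) + q * sin (s * t)\<bar> \<le> Q"
      "\<bar>(- l * p + s * q) * cos (s * t) + (- l * q - s * p) * sin (s * t)\<bar> \<le> Q"
      using trig[of p "s * t" q] trig[of "- l * p + s * q" "s * t" "- l * q - s * p"] unfolding Q_def by linarith+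
    then show "\<bar>E t\<bar> \<le> Q * exp (- l * t)" "\<bar>E' t\<bar> \<le> Q * exp (- l * t)"
      unfolding E_def E'_def abs_mult by (simp_all add: mult.commute mult_right_mono)
  qed
  define c where "c t = (1 / bump 0) * bump t" for t
  have b0: "bump 0 > 0" by (rule order_less_le_trans[OF exp_gt_zero bump_ge]) simp
  have c: "test_fun c" unfolding c_def[abs_def] by (rule test_fun_mult[OF k_smooth_const test_fun_bump])
  have c0: "c 0 = 1" using b0 by (simp add: c_def)
  obtain B where B: "B > 0" "\<And>x. \<bar>c x\<bar> \<le> B" "\<And>x. \<bar>x\<bar> > B \<Longrightarrow> c x = 0"
    using test_fun_bounded[OF c] by blast
  obtain B' where B': "B' > 0" "\<And>x. \<bar>deriv c x\<bar> \<le> B'" "\<And>x. \<bar>x\<bar> > B' \<Longrightarrow> deriv c x = 0"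
    using test_fun_bounded[OF test_fun_deriv[OF c]] by blast
  have [measurable]: "c \<in> borel_measurable borel" "deriv c \<in> borel_measurable borel"
    by (intro test_fun_borel test_fun_deriv c)+
  define r where "r n = 1 / real (Suc n)" for n
  have r: "0 < r n" "r n \<le> 1" for n by (auto simp: r_def)
  define e where "e n t = E t * c (0 + r n * t)" for n t
  have e: "test_fun (e n)" for n
  proof -
    have "k_smooth k E" for k
      using k_smooth_exp_trig[of k "- l" p s q] by (simp add: E_def[abs_def])
    moreover have "test_fun (\<lambda>t. c (0 + r n * t))" by (rule test_fun_affine[OF c]) (use r[of n] in auto)
    ultimately show ?thesis unfolding e_def[abs_def] by (intro test_fun_mult)
  qed
  have de: "deriv (e n) t = E' t * c (r n * t) + E t * (r n * deriv c (r n * t))" for n t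
  proof -
    have "((\<lambda>t. c (0 + r n * t)) has_real_derivative deriv c (0 + r n * t) * r n) (at t)"
    proof (rule DERIV_chain2[of c])
      show "(c has_real_derivative deriv c (0 + r n * t)) (at (0 + r n * t))" by (rule test_fun_DERIV[OF c])
      show "((\<lambda>t. 0 + r n * t) has_real_derivative r n) (at t)" by (auto intro!: derivative_eq_intros)
    qed
    from DERIV_mult[OF E this] have "(e n has_real_derivative E' t * c (0 + r n * t) + deriv c (0 + r n * t) * r n * E t) (at t)"
      by (simp add: e_def[abs_def])
    then have "deriv (e n) t = E' t * c (0 + r n * t) + deriv c (0 + r n * t) * r n * E t" by (rule DERIV_imp_deriv)
    then show ?thesis by (simp add: mult_ac)
  qed
  \<comment> \<open>The derivative of the cut-off carries the factor \<open>r n\<close> and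
    disappears in the limit. As \<open>r n\<close> \<le> 1, domination is uniform in n: B + B' comes
    from the derivative of the product and B from the product itself.\<close>
  have "(\<lambda>n. LINT t|lborel. deriv (e n) t * a t - e n t * b t) \<longlonglongrightarrow> (LBINT t. E' t * a t - E t * b t)"
  proof (rule integral_dominated_convergence[where w="\<lambda>t. (Q * (2 * B + B') * K) * decay l t"])
    show "(\<lambda>t. E' t * a t - E t * b t) \<in> borel_measurable lborel" by measurable
    show "(\<lambda>t. deriv (e n) t * a t - e n t * b t) \<in> borel_measurable lborel" for n
      unfolding de e_def by measurable
    show "integrable lborel (\<lambda>t. (Q * (2 * B + B') * K) * decay l t)"
      by (intro integrable_mult_right integrable_decay l)
    show "AE t in lborel. (\<lambda>n. deriv (e n) t * a t - e n t * b t) \<longlonglongrightarrow> E' t * a t - E t * b t"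
    proof (rule AE_I2)
      fix t
      have rl: "r \<longlonglongrightarrow> 0" unfolding r_def[abs_def] by (rule LIMSEQ_Suc[OF lim_1_over_n])
      have c1: "(\<lambda>n. c (r n * t)) \<longlonglongrightarrow> 1" and c2: "(\<lambda>n. deriv c (r n * t)) \<longlonglongrightarrow> deriv c 0"
        using test_cutoff_tendsto[OF c, of t] test_cutoff_tendsto[OF test_fun_deriv[OF c], of t] c0
        by (simp_all add: r_def)
      have "(\<lambda>n. (E' t * c (r n * t) + E t * (r n * deriv c (r n * t))) * a t - (E t * c (r n * t)) * b t)
        \<longlonglongrightarrow> (E' t * 1 + E t * (0 * deriv c 0)) * a t - (E t * 1) * b t"
        by (intro tendsto_intros c1 c2 rl)
      then show "(\<lambda>n. deriv (e n) t * a t - e n t * b t) \<longlonglongrightarrow> E' t * a t - E t * b t"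
        by (simp add: de e_def)
    qed
    show "AE t in lborel. norm (deriv (e n) t * a t - e n t * b t) \<le> (Q * (2 * B + B') * K) * decay l t" for n
    proof (rule AE_I2)
      fix t
      show "norm (deriv (e n) t * a t - e n t * b t) \<le> (Q * (2 * B + B') * K) * decay l t"
      proof (cases "t > 0")
        case False
        then show ?thesis using zero[of t] by (simp add: decay_def)
      next
        case True
        define X where "X = Q * exp (- l * t)"
        have X: "X \<ge> 0" by (simp add: X_def Q_def)
        have "\<bar>E' t * c (r n * t)\<bar> \<le> X * B" "\<bar>E t * c (r n * t)\<bar> \<le> X * B"
          unfolding abs_mult using Eb[of t] B X by (auto intro!: mult_mono simp: X_def)
        moreover have "\<bar>E t * (r n * deriv c (r n * t))\<bar> \<le> X * (1 * B')"
          unfolding abs_mult using Eb[of t] B' X r[of n] by (intro mult_mono) (auto simp: X_def)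
        ultimately have 1: "\<bar>deriv (e n) t\<bar> \<le> X * B + X * B'" and 2: "\<bar>e n t\<bar> \<le> X * B"
          unfolding de e_def by (simp_all add: abs_triangle_ineq[THEN order_trans] add_mono)
        have "\<bar>deriv (e n) t * a t - e n t * b t\<bar> \<le> \<bar>deriv (e n) t\<bar> * \<bar>a t\<bar> + \<bar>e n t\<bar> * \<bar>b t\<bar>"
          by (metis abs_mult abs_triangle_ineq4)
        also have "\<dots> \<le> (X * B + X * B') * K + X * B * K"
          using 1 2 bounded[of t] X B(1) B'(1) by (intro add_mono mult_mono) auto
        also have "\<dots> = (Q * (2 * B + B') * K) * decay l t"
          using True by (simp add: X_def decay_def algebra_simps)
        finally show ?thesis by simp
      qed
    qed
  qed
  moreover have "(LBINT t. deriv (e n) t * a t - e n t * b t) = 0" for n by (rule eq[OF e])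
  ultimately have "(LBINT t. E' t * a t - E t * b t) = 0"
    by (simp add: LIMSEQ_const_iff)
  then show ?thesis unfolding E_def E'_def .
qed

text \<open>Test functions are real, so exp (-(l + i s) t) is split: its real and imaginary parts
  are the coefficient pairs (1, 0) and (0, -1) of \<open>exponential_test\<close>.\<close>

lemma complex_exponential_test:
  fixes a b :: "real \<Rightarrow> real"
  assumes l: "l > 0" and [measurable]: "a \<in> borel_measurable borel" "b \<in> borel_measurable borel"
    and bounded: "\<And>t. \<bar>a t\<bar> \<le> K" "\<And>t. \<bar>b t\<bar> \<le> K" and zero: "\<And>t. t \<le> 0 \<Longrightarrow> a t = 0 \<and> b t = 0"
    and eq: "\<And>\<eta>. test_fun \<eta> \<Longrightarrow> (LBINT t. deriv \<eta> t * a t - \<eta> t * b t) = 0"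
  shows "(complex_of_real l + \<i> * complex_of_real s) * (LBINT t. cis (- (s * t)) * decay l t * a t)
      + (LBINT t. cis (- (s * t)) * decay l t * b t) = 0"
proof -
  have K: "K \<ge> 0" using bounded(1)[of 0] by linarith
  have int: "integrable lborel (\<lambda>t. cis (- (s * t)) * decay l t * f t)"
    if [measurable]: "f \<in> borel_measurable borel" and f: "\<And>t. \<bar>f t\<bar> \<le> K" for f :: "real \<Rightarrow> real"
  proof (rule Bochner_Integration.integrable_bound[where f="\<lambda>t. K * decay l t"])
    show "integrable lborel (\<lambda>t. K * decay l t)" by (intro integrable_mult_right integrable_decay l)
    show "AE t in lborel. norm (cis (- (s * t)) * decay l t * f t) \<le> norm (K * decay l t)"
      using f K by (intro AE_I2) (simp add: norm_mult decay_nonneg mult.commute mult_right_mono)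
  qed measurable
  define F where "F t = (- (complex_of_real l + \<i> * complex_of_real s)) * (cis (- (s * t)) * decay l t * a t)
      - cis (- (s * t)) * decay l t * b t" for t
  have iF: "integrable lborel F"
    unfolding F_def[abs_def] by (intro Bochner_Integration.integrable_diff integrable_mult_right int bounded) auto
  have cis': "cis (- (s * t)) = Complex (cos (s * t)) (- sin (s * t))" for t by (simp add: cis.ctr)
  \<comment> \<open>The coefficients stay unevaluated here and in \<open>im\<close> to match the
    shape of \<open>exponential_test\<close>.\<close>
  have re: "Re (F t) = exp (- l * t) * ((- l * 1 + s * 0) * cos (s * t) + (- l * 0 - s * 1) * sin (s * t)) * a t
     - exp (- l * t) * (1 * cos (s * t) + 0 * sin (s * t)) * b t" for t
    using zero[of t] by (cases "t > 0") (simp_all add: F_def cis' decay_def algebra_simps)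
  have im: "Im (F t) = exp (- l * t) * ((- l * 0 + s * - 1) * cos (s * t) + (- l * - 1 - s * 0) * sin (s * t)) * a t
     - exp (- l * t) * (0 * cos (s * t) + - 1 * sin (s * t)) * b t" for t
    using zero[of t] by (cases "t > 0") (simp_all add: F_def cis' decay_def algebra_simps)
  have "Re (LBINT t. F t) = 0"
    unfolding integral_Re[OF iF, symmetric] re by (rule exponential_test[OF l assms(2,3) bounded zero eq])
  moreover have "Im (LBINT t. F t) = 0"
    unfolding integral_Im[OF iF, symmetric] im by (rule exponential_test[OF l assms(2,3) bounded zero eq])
  ultimately have "(LBINT t. F t) = 0" by (simp add: complex_eq_iff)
  moreover have "(LBINT t. F t) = (- (complex_of_real l + \<i> * complex_of_real s)) * (LBINT t. cis (- (s * t)) * decay l t * a t)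
      - (LBINT t. cis (- (s * t)) * decay l t * b t)"
    unfolding F_def using int[OF assms(2) bounded(1)] int[OF assms(3) bounded(2)]
    by (subst Bochner_Integration.integral_diff) (simp_all only: integrable_mult_right integral_mult_right_zero)
  moreover have "x * y + z = - ((- x) * y - z)" for x y z :: complex by simp
  ultimately show ?thesis by (simp only: minus_zero)
qed

section \<open>Laplace transforms of families uniformly bounded in L2\<close>

text \<open>The bounds hold at every t of the whole line, so that pairings and their estimates
  involve no exceptional times. Joint measurability is what Tonelli's theorem asks for.\<close>

locale bounded_L2_family =
  fixes p :: "real \<Rightarrow> real \<Rightarrow> real" and C :: real
  assumes joint_measurable [measurable]: "case_prod p \<in> borel_measurable (lborel \<Otimes>\<^sub>M lborel)"
    and in_L2: "\<And>t. p t \<in> L2"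
    and norm_le: "\<And>t. (L2_sq (p t)) \<le> C"
begin

lemma section_measurable: "(\<lambda>t. p t x) \<in> borel_measurable borel"
  using measurable_compose[OF measurable_Pair1'[of x lborel lborel] joint_measurable] by simp

lemma C_nonneg: "C \<ge> 0"
  using norm_le[of 0] by (rule order_trans[rotated]) simp

lemma nn_norm_le: "(\<integral>\<^sup>+x. ennreal ((p t x)\<^sup>2) \<partial>lborel) \<le> ennreal C"
  using L2_nn_integral[OF in_L2[of t]] norm_le[of t] by (simp add: ennreal_leI)

text \<open>The elementary |a b| \<le> a^2 + b^2 replaces Cauchy-Schwarz, since all that matters is
  a finite bound uniform in t.\<close>

lemma pairing_le:
  assumes "f \<in> L2"
  shows "(\<integral>\<^sup>+x. ennreal \<bar>p t x * f x\<bar> \<partial>lborel) \<le> ennreal (C + (LBINT x. (f x)\<^sup>2))"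
proof -
  note [measurable] = L2_measurable[OF in_L2[of t]] L2_measurable[OF assms]
  have "(\<integral>\<^sup>+x. ennreal \<bar>p t x * f x\<bar> \<partial>lborel) \<le> (\<integral>\<^sup>+x. ennreal ((p t x)\<^sup>2) + ennreal ((f x)\<^sup>2) \<partial>lborel)"
    using norm_mult_le_squares[of "p t x" "f x" for x]
    by (intro nn_integral_mono) (simp flip: ennreal_plus)
  also have "\<dots> = (\<integral>\<^sup>+x. ennreal ((p t x)\<^sup>2) \<partial>lborel) + (\<integral>\<^sup>+x. ennreal ((f x)\<^sup>2) \<partial>lborel)"
    by (rule nn_integral_add) auto
  also have "\<dots> \<le> ennreal C + ennreal (LBINT x. (f x)\<^sup>2)"
    using L2_nn_integral[OF assms] by (intro add_mono nn_norm_le) simp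
  also have "\<dots> = ennreal (C + (LBINT x. (f x)\<^sup>2))"
    using C_nonneg by (simp add: ennreal_plus)
  finally show ?thesis .
qed

lemma abs_pairing_le:
  assumes "f \<in> L2"
  shows "\<bar>LINT x|lborel. p t x * f x\<bar> \<le> C + (LBINT x. (f x)\<^sup>2)"
proof -
  have "ennreal \<bar>LINT x|lborel. p t x * f x\<bar> \<le> (\<integral>\<^sup>+x. ennreal \<bar>p t x * f x\<bar> \<partial>lborel)"
    using integral_norm_bound_ennreal[OF L2_mult_integrable[OF in_L2[of t] assms]] by simp
  also note pairing_le[OF assms]
  finally have "ennreal \<bar>LINT x|lborel. p t x * f x\<bar> \<le> ennreal (C + (LBINT x. (f x)\<^sup>2))" .
  moreover have "0 \<le> C + (LBINT x. (f x)\<^sup>2)" using C_nonneg by simp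
  ultimately show ?thesis by (simp only: ennreal_le_iff)
qed

lemma pairing_measurable [measurable]:
  assumes "f \<in> L2"
  shows "(\<lambda>t. LINT x|lborel. p t x * f x) \<in> borel_measurable borel"
proof -
  note [measurable] = L2_measurable[OF assms]
  have "(\<lambda>t. LINT x|lborel. p t x * f x) \<in> borel_measurable lborel"
    by (rule lborel.borel_measurable_lebesgue_integral) measurable
  then show ?thesis by simp
qed

definition laplace :: "real \<Rightarrow> real \<Rightarrow> real \<Rightarrow> complex" where
  "laplace l s x = fourier_real (\<lambda>t. decay l t * p t x) s"

lemma laplace_measurable [measurable]: "(\<lambda>(s, x). laplace l s x) \<in> borel_measurable (lborel \<Otimes>\<^sub>M lborel)"
  unfolding laplace_def fourier_def case_prod_unfold
  by (rule lborel.borel_measurable_lebesgue_integral) measurable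

text \<open>Fubini: pairing with f in space commutes with the transform in time, so the identities
  obtained for each f become identities for \<open>laplace l s\<close> as a function of x.\<close>

lemma laplace_pairing:
  assumes l: "l > 0" and f: "f \<in> L2"
  shows "(LBINT t. cis (- (s * t)) * decay l t * complex_of_real (LBINT x. p t x * f x))
    = (LBINT x. laplace l s x * complex_of_real (f x))"
proof -
  note [measurable] = L2_measurable[OF f]
  define K where "K t x = cis (- (s * t)) * decay l t * complex_of_real (p t x * f x)" for t x
  have "integrable (lborel \<Otimes>\<^sub>M lborel) (case_prod K)"
  proof (rule integrable_pair_lborelI)
    show "case_prod K \<in> borel_measurable (lborel \<Otimes>\<^sub>M lborel)"
      unfolding K_def by measurable
    have "(\<integral>\<^sup>+t. \<integral>\<^sup>+x. ennreal (norm (K t x)) \<partial>lborel \<partial>lborel)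
        = (\<integral>\<^sup>+t. \<integral>\<^sup>+x. ennreal (decay l t) * ennreal \<bar>p t x * f x\<bar> \<partial>lborel \<partial>lborel)"
      by (simp add: K_def norm_mult decay_nonneg ennreal_mult abs_mult)
    also have "\<dots> = (\<integral>\<^sup>+t. ennreal (decay l t) * (\<integral>\<^sup>+x. ennreal \<bar>p t x * f x\<bar> \<partial>lborel) \<partial>lborel)"
      by (intro nn_integral_cong nn_integral_cmult) (use L2_measurable[OF in_L2] in measurable)
    also have "\<dots> \<le> (\<integral>\<^sup>+t. ennreal (decay l t) * ennreal (C + (LBINT x. (f x)\<^sup>2)) \<partial>lborel)"
      by (intro nn_integral_mono mult_left_mono pairing_le f) auto
    also have "\<dots> = (\<integral>\<^sup>+t. ennreal (decay l t) \<partial>lborel) * ennreal (C + (LBINT x. (f x)\<^sup>2))"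
      by (rule nn_integral_multc) measurable
    also have "\<dots> < \<infinity>"
      using integrable_decay[OF l] by (simp add: integrable_iff_bounded decay_nonneg ennreal_mult_less_top)
    finally show "(\<integral>\<^sup>+t. \<integral>\<^sup>+x. ennreal (norm (K t x)) \<partial>lborel \<partial>lborel) < \<infinity>" .
  qed
  from lborel_pair.Fubini_integral[OF this]
  have "(LBINT x. LINT t|lborel. K t x) = (LBINT t. LINT x|lborel. K t x)" .
  moreover have "(LBINT x. K t x) = cis (- (s * t)) * decay l t * complex_of_real (LBINT x. p t x * f x)" for t
    unfolding K_def by (simp only: integral_mult_right_zero integral_complex_of_real)
  moreover have "(LBINT t. K t x) = laplace l s x * complex_of_real (f x)" for x
  proof -
    have "(LBINT t. K t x) = (LBINT t. cis (- (s * t)) * complex_of_real (decay l t * p t x) * complex_of_real (f x))"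
      by (simp add: K_def mult.assoc)
    then show ?thesis unfolding laplace_def fourier_def by (simp only: integral_mult_left_zero)
  qed
  ultimately show ?thesis by (simp only:)
qed

lemma nn_integral_decay_le:
  "(\<integral>\<^sup>+x. \<integral>\<^sup>+t. ennreal (decay l t * (p t x)\<^sup>2) \<partial>lborel \<partial>lborel) \<le> (\<integral>\<^sup>+t. ennreal (decay l t) \<partial>lborel) * ennreal C"
proof -
  have "(\<integral>\<^sup>+x. \<integral>\<^sup>+t. ennreal (decay l t * (p t x)\<^sup>2) \<partial>lborel \<partial>lborel)
      = (\<integral>\<^sup>+t. \<integral>\<^sup>+x. ennreal (decay l t * (p t x)\<^sup>2) \<partial>lborel \<partial>lborel)"
    by (rule lborel_pair.Fubini') measurable
  also have "\<dots> = (\<integral>\<^sup>+t. ennreal (decay l t) * (\<integral>\<^sup>+x. ennreal ((p t x)\<^sup>2) \<partial>lborel) \<partial>lborel)"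
    using L2_measurable[OF in_L2] by (intro nn_integral_cong) (simp add: ennreal_mult decay_nonneg nn_integral_cmult)
  also have "\<dots> \<le> (\<integral>\<^sup>+t. ennreal (decay l t) * ennreal C \<partial>lborel)"
    by (intro nn_integral_mono mult_left_mono nn_norm_le) auto
  also have "\<dots> = (\<integral>\<^sup>+t. ennreal (decay l t) \<partial>lborel) * ennreal C"
    by (rule nn_integral_multc) measurable
  finally show ?thesis .
qed

lemma nn_integral_decay_finite:
  "l > 0 \<Longrightarrow> (\<integral>\<^sup>+x. \<integral>\<^sup>+t. ennreal (decay l t * (p t x)\<^sup>2) \<partial>lborel \<partial>lborel) < \<infinity>"
  using integrable_decay[of l]
  by (intro order_le_less_trans[OF nn_integral_decay_le])
    (simp add: integrable_iff_bounded decay_nonneg ennreal_mult_less_top)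

text \<open>The resolvent estimate is applied at each single s, so membership is required for every
  s, whereas Plancherel in s would give it for almost every one. Cauchy-Schwarz in time, with the
  weight split into two square roots, gives a bound independent of s.\<close>

lemma laplace_L2:
  assumes l: "l > 0"
  shows "laplace l s \<in> L2"
  unfolding L2_iff_nn_integral
proof
  have "(\<lambda>x. (\<lambda>(s, x). laplace l s x) (s, x)) \<in> borel_measurable borel" by measurable
  then show "laplace l s \<in> borel_measurable borel" by simp
  define L where "L = (\<integral>\<^sup>+t. ennreal (decay l t) \<partial>lborel)"
  have L: "L < \<infinity>" unfolding L_def using integrable_decay[OF l] by (simp add: integrable_iff_bounded decay_nonneg)
  have "ennreal ((norm (laplace l s x))\<^sup>2) \<le> L * (\<integral>\<^sup>+t. ennreal (decay l t * (p t x)\<^sup>2) \<partial>lborel)" for x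
  proof -
    have [measurable]: "(\<lambda>t. p t x) \<in> borel_measurable borel"
      by (rule section_measurable)
    let ?h = "\<lambda>t. cis (- (s * t)) * complex_of_real (decay l t * p t x)"
    have "ennreal (norm (laplace l s x)) \<le> (\<integral>\<^sup>+t. ennreal (norm (?h t)) \<partial>lborel)"
    proof (cases "integrable lborel ?h")
      case True
      then show ?thesis unfolding laplace_def fourier_def by (rule integral_norm_bound_ennreal)
    next
      \<comment> \<open>For exceptional x the time integral may diverge; the transform is then 0 by
        convention.\<close>
      case False
      then show ?thesis unfolding laplace_def fourier_def
        by (subst not_integrable_integral_eq[OF False]) simp
    qed
    also have "\<dots> = (\<integral>\<^sup>+t. ennreal (sqrt (decay l t)) * ennreal (sqrt (decay l t) * \<bar>p t x\<bar>) \<partial>lborel)"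
      by (intro nn_integral_cong) (simp add: norm_mult decay_nonneg abs_mult flip: ennreal_mult mult.assoc)
    finally have "(ennreal (norm (laplace l s x)))\<^sup>2 \<le> (\<integral>\<^sup>+t. ennreal (sqrt (decay l t)) * ennreal (sqrt (decay l t) * \<bar>p t x\<bar>) \<partial>lborel)\<^sup>2"
      by (rule power_mono) simp
    also have "\<dots> \<le> (\<integral>\<^sup>+t. (ennreal (sqrt (decay l t)))\<^sup>2 \<partial>lborel) * (\<integral>\<^sup>+t. (ennreal (sqrt (decay l t) * \<bar>p t x\<bar>))\<^sup>2 \<partial>lborel)"
      by (rule Cauchy_Schwarz_nn_integral) measurable
    also have "\<dots> = L * (\<integral>\<^sup>+t. ennreal (decay l t * (p t x)\<^sup>2) \<partial>lborel)"
      by (simp add: L_def ennreal_power decay_nonneg power_mult_distrib)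
    finally show ?thesis by (simp add: ennreal_power)
  qed
  then have "L2_nn (laplace l s)
      \<le> (\<integral>\<^sup>+x. L * (\<integral>\<^sup>+t. ennreal (decay l t * (p t x)\<^sup>2) \<partial>lborel) \<partial>lborel)"
    by (intro nn_integral_mono)
  also have "\<dots> = L * (\<integral>\<^sup>+x. \<integral>\<^sup>+t. ennreal (decay l t * (p t x)\<^sup>2) \<partial>lborel \<partial>lborel)"
    by (rule nn_integral_cmult) measurable
  also have "\<dots> < \<infinity>" using L nn_integral_decay_finite[OF l] by (simp add: ennreal_mult_less_top)
  finally show "L2_nn (laplace l s) < \<infinity>" .
qed

text \<open>Tonelli allows Plancherel in t at fixed x. It is applied for almost every x, namely
  where the weighted square integral in time is finite.\<close>

lemma laplace_plancherel:
  assumes l: "l > 0"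
  shows "(\<integral>\<^sup>+s. L2_nn (laplace l s) \<partial>lborel)
    = ennreal (2 * pi) * (\<integral>\<^sup>+t. \<integral>\<^sup>+x. ennreal ((decay l t * p t x)\<^sup>2) \<partial>lborel \<partial>lborel)"
proof -
  have "(\<integral>\<^sup>+s. L2_nn (laplace l s) \<partial>lborel)
      = (\<integral>\<^sup>+x. L2_nn (\<lambda>s. laplace l s x) \<partial>lborel)"
    by (rule lborel_pair.Fubini'[symmetric]) measurable
  also have "\<dots> = (\<integral>\<^sup>+x. ennreal (2 * pi) * (\<integral>\<^sup>+t. ennreal ((decay l t * p t x)\<^sup>2) \<partial>lborel) \<partial>lborel)"
  proof (rule nn_integral_cong_AE)
    have "AE x in lborel. (\<integral>\<^sup>+t. ennreal (decay l t * (p t x)\<^sup>2) \<partial>lborel) \<noteq> \<infinity>"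
      using nn_integral_decay_finite[OF l] by (intro nn_integral_PInf_AE) auto
    then show "AE x in lborel. (L2_nn (\<lambda>s. laplace l s x))
        = ennreal (2 * pi) * (\<integral>\<^sup>+t. ennreal ((decay l t * p t x)\<^sup>2) \<partial>lborel)"
    proof eventually_elim
      case (elim x)
      have [measurable]: "(\<lambda>t. p t x) \<in> borel_measurable borel"
        by (rule section_measurable)
      have iw: "integrable lborel (\<lambda>t. decay l t * (p t x)\<^sup>2)"
        using elim by (intro integrableI_nonneg) (auto simp: decay_nonneg less_top)
      let ?q = "\<lambda>t. complex_of_real (decay l t * p t x)"
      \<comment> \<open>|y| \<le> 1 + y^2 gives integrability in time, the 1 being paid for by the
        integrable weight; \<open>decay_square_le\<close> gives square integrability.\<close>
      have i1: "integrable lborel ?q"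
      proof (rule Bochner_Integration.integrable_bound[OF Bochner_Integration.integrable_add[OF integrable_decay[OF l] iw]])
        have "\<bar>y\<bar> \<le> 1 + y\<^sup>2" for y :: real
          using sum_squares_bound[of 1 "\<bar>y\<bar>"] by simp
        then have "decay l t * \<bar>p t x\<bar> \<le> decay l t * (1 + (p t x)\<^sup>2)" for t
          by (intro mult_left_mono decay_nonneg)
        then show "AE t in lborel. norm (?q t) \<le> norm (decay l t + decay l t * (p t x)\<^sup>2)"
          by (intro AE_I2) (simp add: norm_mult abs_mult decay_nonneg distrib_left)
      qed measurable
      have i2: "?q \<in> L2"
        unfolding L2_def
      proof safe
        show "integrable lborel (\<lambda>t. (norm (?q t))\<^sup>2)"
        proof (rule Bochner_Integration.integrable_bound[OF iw])
          show "AE t in lborel. norm ((norm (?q t))\<^sup>2) \<le> norm (decay l t * (p t x)\<^sup>2)"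
            by (intro AE_I2) (simp add: norm_mult abs_mult decay_nonneg power_mult_distrib mult_right_mono decay_square_le[OF l])
        qed measurable
      qed measurable
      have "L2_nn (\<lambda>s. laplace l s x) = ennreal (2 * pi * L2_sq (\<lambda>t. ?q t))"
        unfolding laplace_def by (rule plancherel_L1_L2[OF i1 i2])
      also have "\<dots> = ennreal (2 * pi) * L2_nn (\<lambda>t. ?q t)"
        by (subst L2_nn_integral[OF i2]) (simp add: ennreal_mult)
      finally show ?case by (simp add: norm_mult abs_mult power_mult_distrib)
    qed
  qed
  also have "\<dots> = ennreal (2 * pi) * (\<integral>\<^sup>+x. \<integral>\<^sup>+t. ennreal ((decay l t * p t x)\<^sup>2) \<partial>lborel \<partial>lborel)"
    by (rule nn_integral_cmult) measurable
  also have "(\<integral>\<^sup>+x. \<integral>\<^sup>+t. ennreal ((decay l t * p t x)\<^sup>2) \<partial>lborel \<partial>lborel)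
      = (\<integral>\<^sup>+t. \<integral>\<^sup>+x. ennreal ((decay l t * p t x)\<^sup>2) \<partial>lborel \<partial>lborel)"
    by (rule lborel_pair.Fubini') measurable
  finally show ?thesis .
qed

lemma integrable_decay_pairing:
  assumes l: "l > 0" and f: "f \<in> L2"
  shows "integrable lborel (\<lambda>t. cis (- (s * t)) * decay l t * complex_of_real (LBINT x. p t x * f x))"
proof (rule Bochner_Integration.integrable_bound)
  show "integrable lborel (\<lambda>t. (C + (LBINT x. (f x)\<^sup>2)) * decay l t)"
    by (intro integrable_mult_right integrable_decay l)
  have "0 \<le> C + (LBINT x. (f x)\<^sup>2)" using C_nonneg by simp
  then show "AE t in lborel. norm (cis (- (s * t)) * decay l t * complex_of_real (LBINT x. p t x * f x))
      \<le> norm ((C + (LBINT x. (f x)\<^sup>2)) * decay l t)"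
    using mult_left_mono[OF abs_pairing_le[OF f] decay_nonneg]
    by (intro AE_I2) (simp add: norm_mult decay_nonneg mult.commute[of "C + (LBINT x. (f x)\<^sup>2)"] del: integral_complex_of_real)
qed (use pairing_measurable[OF f] in measurable)

end

section \<open>The estimate for the difference of two solutions\<close>

text \<open>The time integrand for the test function \<open>\<eta> t * f x\<close>, with the
  quadratic term as an independent argument g. Being linear in (w, g), it serves a solution with its
  square as well as the difference of two solutions with the difference of their squares.\<close>

definition weak_integrand ::
  "(real \<Rightarrow> real \<Rightarrow> real) \<Rightarrow> (real \<Rightarrow> real \<Rightarrow> real) \<Rightarrow> (real \<Rightarrow> real) \<Rightarrow> (real \<Rightarrow> real) \<Rightarrow> real \<Rightarrow> real" where
  "weak_integrand w g \<eta> f t = deriv \<eta> t * (LBINT x. w t x * f x)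
    - \<eta> t * ((LBINT x. w t x * multiplier symbol f x) + (LBINT x. g t x * deriv f x) / 2)"

text \<open>With X and Y the weighted squared norms of w and g, the resolvent estimate gives M^2 X
  \<le> Y / 4 and the pointwise bound gives Y \<le> M^2 X.\<close>

lemma difference_vanishes:
  fixes w g :: "real \<Rightarrow> real \<Rightarrow> real"
  assumes w: "bounded_L2_family w C" and g: "bounded_L2_family g C'"
    and M: "M > 0" and gw: "\<And>t. AE x in lborel. \<bar>g t x\<bar> \<le> M * \<bar>w t x\<bar>"
    and zero: "\<And>t x. t \<le> 0 \<Longrightarrow> w t x = 0 \<and> g t x = 0"
    and weak: "\<And>\<eta> f. test_fun \<eta> \<Longrightarrow> test_fun f \<Longrightarrow>
      (LBINT t. weak_integrand w g \<eta> f t) = 0"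
  obtains l where "l > 0" "(\<integral>\<^sup>+t. \<integral>\<^sup>+x. ennreal ((decay l t * w t x)\<^sup>2) \<partial>lborel \<partial>lborel) = 0"
proof -
  interpret w: bounded_L2_family w C by (rule w)
  interpret g: bounded_L2_family g C' by (rule g)
  obtain l where l: "l > 0" and dom: "\<And>\<xi>. M * \<bar>\<xi>\<bar> \<le> l + symbol \<xi>"
    using symbol_dominates[OF M] by blast
  have "M\<^sup>2 * L2_sq (w.laplace l s) \<le> L2_sq (g.laplace l s) / 4" for s
  proof (rule resolvent_estimate[OF w.laplace_L2[OF l] g.laplace_L2[OF l] M dom l, of s])
    fix f assume f: "test_fun f"
    note f2 = test_fun_L2[OF f] and m2 = multiplier_L2[OF f] and d2 = test_fun_L2[OF test_fun_deriv[OF f]]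
    let ?a = "\<lambda>t. LINT x|lborel. w t x * f x"
    let ?m = "\<lambda>t. LINT x|lborel. w t x * multiplier symbol f x"
    let ?d = "\<lambda>t. LINT x|lborel. g t x * deriv f x"
    let ?b = "\<lambda>t. ?m t + ?d t / 2"
    note [measurable] = w.pairing_measurable[OF f2] w.pairing_measurable[OF m2] g.pairing_measurable[OF d2]
    \<comment> \<open>One constant must bound both functions passed to
      \<open>complex_exponential_test\<close>; the sum of the three pairing bounds does.\<close>
    define K where "K = (C + (LBINT x. (f x)\<^sup>2)) + (C + (LBINT x. (multiplier symbol f x)\<^sup>2))
      + (C' + (LBINT x. (deriv f x)\<^sup>2))"
    have "0 \<le> (LBINT x. (h x)\<^sup>2)" for h :: "real \<Rightarrow> real" by simp
    note pos = this[of f] this[of "multiplier symbol f"] this[of "deriv f"] w.C_nonneg g.C_nonneg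
    have "(complex_of_real l + \<i> * complex_of_real s) * (LBINT t. cis (- (s * t)) * decay l t * ?a t)
      + (LBINT t. cis (- (s * t)) * decay l t * ?b t) = 0"
    proof (rule complex_exponential_test[OF l, where K=K])
      show "\<bar>?a t\<bar> \<le> K" for t
        using w.abs_pairing_le[OF f2, of t] pos unfolding K_def by linarith
      show "\<bar>?b t\<bar> \<le> K" for t
        using w.abs_pairing_le[OF m2, of t] g.abs_pairing_le[OF d2, of t] pos unfolding K_def by linarith
      show "?a t = 0 \<and> ?b t = 0" if "t \<le> 0" for t using zero[OF that] by simp
      show "(LBINT t. deriv \<eta> t * ?a t - \<eta> t * ?b t) = 0" if "test_fun \<eta>" for \<eta>
        using weak[OF that f] unfolding weak_integrand_def .
    qed measurable
    also have "(LBINT t. cis (- (s * t)) * decay l t * complex_of_real (?b t))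
       = (LBINT t. cis (- (s * t)) * decay l t * complex_of_real (?m t) + (cis (- (s * t)) * decay l t * complex_of_real (?d t)) / 2)"
      by (simp add: distrib_left del: integral_complex_of_real)
    also have "\<dots> = (LBINT t. cis (- (s * t)) * decay l t * complex_of_real (?m t))
        + (LBINT t. cis (- (s * t)) * decay l t * complex_of_real (?d t)) / 2"
      using w.integrable_decay_pairing[OF l m2, of s] g.integrable_decay_pairing[OF l d2, of s]
      by (subst Bochner_Integration.integral_add) (simp_all only: integrable_divide_zero integral_divide_zero)
    finally show "(complex_of_real l + \<i> * complex_of_real s) * (LBINT x. w.laplace l s x * complex_of_real (f x))
      + (LBINT x. w.laplace l s x * complex_of_real (multiplier symbol f x))
      + (LBINT x. g.laplace l s x * complex_of_real (deriv f x)) / 2 = 0"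
      unfolding w.laplace_pairing[OF l f2] w.laplace_pairing[OF l m2] g.laplace_pairing[OF l d2]
      by (simp only: add.assoc)
  qed
  note resolvent = this
  have est: "ennreal (M\<^sup>2) * L2_nn (w.laplace l s)
      \<le> ennreal (1/4) * L2_nn (g.laplace l s)" for s
  proof -
    have "ennreal (M\<^sup>2 * L2_sq (w.laplace l s))
        \<le> ennreal (1/4 * L2_sq (g.laplace l s))"
      using resolvent[of s] by (intro ennreal_leI) simp
    then show ?thesis
      unfolding L2_nn_integral[OF w.laplace_L2[OF l]] L2_nn_integral[OF g.laplace_L2[OF l]]
      by (subst (1 2) ennreal_mult'[symmetric]) simp_all
  qed
  define X where "X = (\<integral>\<^sup>+t. \<integral>\<^sup>+x. ennreal ((decay l t * w t x)\<^sup>2) \<partial>lborel \<partial>lborel)"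
  define Y where "Y = (\<integral>\<^sup>+t. \<integral>\<^sup>+x. ennreal ((decay l t * g t x)\<^sup>2) \<partial>lborel \<partial>lborel)"
  have "ennreal (M\<^sup>2) * (ennreal (2 * pi) * X) = (\<integral>\<^sup>+s. ennreal (M\<^sup>2) * L2_nn (w.laplace l s) \<partial>lborel)"
    unfolding X_def w.laplace_plancherel[OF l, symmetric] by (rule nn_integral_cmult[symmetric]) measurable
  also have "\<dots> \<le> (\<integral>\<^sup>+s. ennreal (1/4) * L2_nn (g.laplace l s) \<partial>lborel)"
    by (intro nn_integral_mono est)
  also have "\<dots> = ennreal (1/4) * (ennreal (2 * pi) * Y)"
    unfolding Y_def g.laplace_plancherel[OF l, symmetric] by (rule nn_integral_cmult) measurable
  also have "Y \<le> ennreal (M\<^sup>2) * X"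
  proof -
    have "Y \<le> (\<integral>\<^sup>+t. \<integral>\<^sup>+x. ennreal (M\<^sup>2) * ennreal ((decay l t * w t x)\<^sup>2) \<partial>lborel \<partial>lborel)"
      unfolding Y_def
    proof (rule nn_integral_mono, rule nn_integral_mono_AE)
      fix t
      show "AE x in lborel. ennreal ((decay l t * g t x)\<^sup>2) \<le> ennreal (M\<^sup>2) * ennreal ((decay l t * w t x)\<^sup>2)"
        using gw[of t]
      proof eventually_elim
        case (elim x)
        have "\<bar>g t x\<bar>\<^sup>2 \<le> (M * \<bar>w t x\<bar>)\<^sup>2" using elim by (intro power_mono) auto
        then have "(decay l t)\<^sup>2 * (g t x)\<^sup>2 \<le> (decay l t)\<^sup>2 * (M\<^sup>2 * (w t x)\<^sup>2)"
          by (intro mult_left_mono) (simp_all add: power_mult_distrib)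
        then show ?case
          by (simp add: ennreal_mult[symmetric] power_mult_distrib mult_ac ennreal_leI)
      qed
    qed
    also have "\<dots> = (\<integral>\<^sup>+t. ennreal (M\<^sup>2) * (\<integral>\<^sup>+x. ennreal ((decay l t * w t x)\<^sup>2) \<partial>lborel) \<partial>lborel)"
      by (intro nn_integral_cong nn_integral_cmult) (use L2_measurable[OF w.in_L2] in measurable)
    also have "\<dots> = ennreal (M\<^sup>2) * X"
      unfolding X_def by (rule nn_integral_cmult) measurable
    finally show ?thesis .
  qed
  finally have le: "ennreal (M\<^sup>2) * (ennreal (2 * pi) * X) \<le> ennreal (1/4) * (ennreal (2 * pi) * (ennreal (M\<^sup>2) * X))"
    by (meson mult_left_mono order_trans zero_le)
  \<comment> \<open>In \<open>ennreal\<close> an infinite X would satisfy the inequality as well;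
    finiteness is what permits the absorption.\<close>
  have "X < \<infinity>"
  proof -
    have "X \<le> (\<integral>\<^sup>+t. \<integral>\<^sup>+x. ennreal (decay l t * (w t x)\<^sup>2) \<partial>lborel \<partial>lborel)"
      unfolding X_def
    proof (intro nn_integral_mono ennreal_leI)
      fix t x
      show "(decay l t * w t x)\<^sup>2 \<le> decay l t * (w t x)\<^sup>2"
        by (simp add: power_mult_distrib mult_right_mono decay_square_le[OF l])
    qed
    also have "\<dots> = (\<integral>\<^sup>+x. \<integral>\<^sup>+t. ennreal (decay l t * (w t x)\<^sup>2) \<partial>lborel \<partial>lborel)"
      by (rule lborel_pair.Fubini'[symmetric]) measurable
    also have "\<dots> < \<infinity>" by (rule w.nn_integral_decay_finite[OF l])
    finally show ?thesis .
  qed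
  then obtain r where r: "r \<ge> 0" "X = ennreal r" by (cases X) auto
  have "M\<^sup>2 * (2 * pi * r) \<le> 1/4 * (2 * pi * (M\<^sup>2 * r))"
    using le r(1) unfolding r(2) by (simp add: ennreal_mult[symmetric] ennreal_le_iff)
  then have "M\<^sup>2 * r \<le> 0" by (simp add: algebra_simps)
  then have "r = 0" using r(1) M by (simp add: mult_le_0_iff)
  then show ?thesis using that[OF l] r(2) by (simp add: X_def)
qed

section \<open>Weak solutions\<close>

abbreviation weak_density :: "(real \<Rightarrow> real \<Rightarrow> real) \<Rightarrow> (real \<Rightarrow> real) \<Rightarrow> (real \<Rightarrow> real) \<Rightarrow> (real \<Rightarrow> real) \<Rightarrow> real \<Rightarrow> real \<Rightarrow> real" where
  "weak_density u m \<eta> f t x \<equiv> u t x * (deriv \<eta> t * f x) - u t x * (\<eta> t * m x) - (u t x)\<^sup>2 / 2 * (\<eta> t * deriv f x)"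

text \<open>The weak formulation applies \<open>multiplier\<close> afresh at each time, and those
  choices need not be jointly measurable in (t, x). Replacing them by \<open>\<eta> t * m x\<close>
  with one fixed m leaves every space integral unchanged and makes the integrand jointly
  measurable.\<close>

lemma weak_solution_test:
  assumes meas: "time_space_measurable u" and weak: "weak_solution u0 u"
    and \<eta>: "test_fun \<eta>" and f: "test_fun f" and m: "m = multiplier symbol f"
  shows "(LINT t|time. LINT x|lborel. weak_density u m \<eta> f t x)
    = - (LBINT x. u0 x * (\<eta> 0 * f x))"
proof -
  have [measurable]: "m \<in> borel_measurable borel" using multiplier_L2[OF f] unfolding m by (rule L2_measurable)
  have [measurable]: "f \<in> borel_measurable borel" "deriv f \<in> borel_measurable borel"
    by (intro test_fun_borel test_fun_deriv f)+
  have "(LINT t|time. LINT x|lborel.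
            u t x * deriv (\<lambda>s. \<eta> s * f x) t
          - u t x * multiplier symbol (\<lambda>x. \<eta> t * f x) x
          - (u t x)\<^sup>2 / 2 * deriv (\<lambda>x. \<eta> t * f x) x)
    = (LINT t|time. LINT x|lborel. weak_density u m \<eta> f t x)"
  proof (rule Bochner_Integration.integral_cong[OF refl])
    fix t assume t: "t \<in> space time"
    have [measurable]: "u t \<in> borel_measurable borel"
      using measurable_compose[OF measurable_Pair1'[OF t, of lborel] meas[unfolded time_space_measurable_def]] by simp
    have [measurable]: "multiplier symbol (\<lambda>x. \<eta> t * f x) \<in> borel_measurable borel"
      by (intro L2_measurable multiplier_L2 test_fun_mult k_smooth_const f)
    have d1: "deriv (\<lambda>s. \<eta> s * f x) t = deriv \<eta> t * f x" for x
      by (rule DERIV_imp_deriv[OF DERIV_cmult_right[OF test_fun_DERIV[OF \<eta>]]])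
    have d2: "deriv (\<lambda>x. \<eta> t * f x) x = \<eta> t * deriv f x" for x
      by (rule DERIV_imp_deriv[OF DERIV_cmult[OF test_fun_DERIV[OF f]]])
    show "(LBINT x. u t x * deriv (\<lambda>s. \<eta> s * f x) t
          - u t x * multiplier symbol (\<lambda>x. \<eta> t * f x) x - (u t x)\<^sup>2 / 2 * deriv (\<lambda>x. \<eta> t * f x) x)
      = (LBINT x. weak_density u m \<eta> f t x)"
      unfolding d1 d2
    proof (rule integral_cong_AE)
      show "AE x in lborel. u t x * (deriv \<eta> t * f x) - u t x * multiplier symbol (\<lambda>x. \<eta> t * f x) x - (u t x)\<^sup>2 / 2 * (\<eta> t * deriv f x)
        = weak_density u m \<eta> f t x"
        using multiplier_scale[OF f, of "\<eta> t"] unfolding m by eventually_elim simp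
    qed measurable
  qed
  moreover have "(LINT t|time. LINT x|lborel.
            u t x * deriv (\<lambda>s. \<eta> s * f x) t
          - u t x * multiplier symbol (\<lambda>x. \<eta> t * f x) x
          - (u t x)\<^sup>2 / 2 * deriv (\<lambda>x. \<eta> t * f x) x) + (LBINT x. u0 x * (\<eta> 0 * f x)) = 0"
    using weak test_function_product[OF \<eta> f] unfolding weak_solution_def by blast
  ultimately show ?thesis by linarith
qed

text \<open>On a null set of times \<open>u t\<close> may be an arbitrary function; it is replaced by zero there, so
  that the bounds below hold for every \<open>t\<close>.\<close>

lemma regular_representative:
  assumes u: "u \<in> Linf_L2" "u \<in> Linf_Linf" and weak: "weak_solution u0 u"
  obtains p C where "bounded_L2_family p C" "\<And>t. AE x in lborel. \<bar>p t x\<bar> \<le> C"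
    "\<And>t x. t \<le> 0 \<Longrightarrow> p t x = 0" "AE t in time. p t = u t"
    "\<And>\<eta> f. test_fun \<eta> \<Longrightarrow> test_fun f \<Longrightarrow>
      integrable lborel (weak_integrand p (\<lambda>t x. (p t x)\<^sup>2) \<eta> f)
      \<and> (LBINT t. weak_integrand p (\<lambda>t x. (p t x)\<^sup>2) \<eta> f t) = - (LBINT x. u0 x * (\<eta> 0 * f x))"
proof -
  have meas: "time_space_measurable u" using u by (simp add: Linf_L2_def)
  then have um: "case_prod u \<in> borel_measurable (time \<Otimes>\<^sub>M lborel)" by (simp add: time_space_measurable_def)
  obtain C1 C2 where "AE t in time. u t \<in> L2 \<and> L2_norm (u t) \<le> C1" "AE t in time. AE x in lborel. \<bar>u t x\<bar> \<le> C2"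
    using u by (auto simp: Linf_L2_def Linf_Linf_def)
  then have "AE t in time. u t \<in> L2 \<and> L2_norm (u t) \<le> C1 \<and> (AE x in lborel. \<bar>u t x\<bar> \<le> C2)"
    by eventually_elim simp
  then have "AE t in lborel. t > 0 \<longrightarrow> u t \<in> L2 \<and> L2_norm (u t) \<le> C1 \<and> (AE x in lborel. \<bar>u t x\<bar> \<le> C2)"
    by (subst (asm) AE_restrict_space_iff) auto
  then obtain N where N: "N \<in> null_sets lborel"
    and good: "\<And>t. t \<notin> N \<Longrightarrow> t > 0 \<Longrightarrow> u t \<in> L2 \<and> L2_norm (u t) \<le> C1 \<and> (AE x in lborel. \<bar>u t x\<bar> \<le> C2)"
    by (auto elim!: AE_E3)
  have [measurable]: "N \<in> sets borel" using N by auto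
  define T where "T = {0<..} - N"
  have [measurable]: "T \<in> sets borel" unfolding T_def by measurable
  define p where "p t x = (if t \<in> T then u t x else 0)" for t x
  have pm: "case_prod p \<in> borel_measurable (lborel \<Otimes>\<^sub>M lborel)"
  proof -
    \<comment> \<open>u is measurable only on positive times, so it is composed with
      \<open>r\<close>, which sends the other times to 1; the indicator of \<open>T\<close> removes
      the values created there.\<close>
    define r where "r t = (if t > 0 then t else 1)" for t :: real
    have "r \<in> measurable lborel time"
      unfolding r_def[abs_def] by (intro measurable_restrict_space2) auto
    note [measurable] = um this
    have "(\<lambda>(t, x). indicator T t * u (r t) x) \<in> borel_measurable (lborel \<Otimes>\<^sub>M lborel)"
      by measurable
    moreover have "(\<lambda>(t, x). indicator T t * u (r t) x) = case_prod p"
      by (auto simp: p_def T_def r_def indicator_def fun_eq_iff)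
    ultimately show ?thesis by simp
  qed
  \<comment> \<open>One constant for two purposes: the squared L2 norm and the supremum.\<close>
  define C where "C = max (C1\<^sup>2) \<bar>C2\<bar>"
  have pL2: "p t \<in> L2" "L2_sq (p t) \<le> C" "AE x in lborel. \<bar>p t x\<bar> \<le> C" for t
  proof -
    have "p t \<in> L2 \<and> (L2_sq (p t)) \<le> C \<and> (AE x in lborel. \<bar>p t x\<bar> \<le> C)"
    proof (cases "t \<in> T")
      case True
      then have g: "u t \<in> L2" "L2_norm (u t) \<le> C1" "AE x in lborel. \<bar>u t x\<bar> \<le> C2"
        using good[of t] by (auto simp: T_def)
      have "p t = u t" using True by (auto simp: p_def)
      moreover have "L2_sq (u t) \<le> C1\<^sup>2"
        using g(2) unfolding L2_norm_def by (intro sqrt_le_D)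
      moreover have "AE x in lborel. \<bar>u t x\<bar> \<le> C" using g(3) by eventually_elim (simp add: C_def)
      ultimately show ?thesis using g(1) by (simp add: C_def)
    next
      case False
      then have "p t = (\<lambda>_. 0)" by (auto simp: p_def)
      then show ?thesis by (simp add: L2_def C_def le_max_iff_disj)
    qed
    then show "p t \<in> L2" "L2_sq (p t) \<le> C" "AE x in lborel. \<bar>p t x\<bar> \<le> C" by auto
  qed
  interpret p: bounded_L2_family p C
    by standard (fact pm pL2)+
  have p0: "p t x = 0" if "t \<le> 0" for t x using that by (simp add: p_def T_def)
  have pu: "AE t in time. p t = u t"
  proof -
    have "AE t in lborel. t \<notin> N" using N by (rule AE_not_in)
    then have "AE t in lborel. t > 0 \<longrightarrow> p t = u t"
      by eventually_elim (auto simp: p_def T_def)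
    then show ?thesis by (subst AE_restrict_space_iff) auto
  qed
  show ?thesis
  proof (rule that[OF p.bounded_L2_family_axioms pL2(3) p0 pu])
    fix \<eta> f assume \<eta>: "test_fun \<eta>" and f: "test_fun f"
    define m where "m = multiplier symbol f"
    have m2: "m \<in> L2" unfolding m_def by (rule multiplier_L2[OF f])
    note f2 = test_fun_L2[OF f] and f' = test_fun_deriv[OF f]
    have [measurable]: "m \<in> borel_measurable borel" "f \<in> borel_measurable borel" "deriv f \<in> borel_measurable borel"
      using m2 f2 test_fun_borel[OF f'] by (auto intro: L2_measurable)
    have [measurable]: "\<eta> \<in> borel_measurable borel" "deriv \<eta> \<in> borel_measurable borel"
      by (intro test_fun_borel test_fun_deriv \<eta>)+
    obtain B where B: "B > 0" "\<And>x. \<bar>deriv f x\<bar> \<le> B" "\<And>x. \<bar>x\<bar> > B \<Longrightarrow> deriv f x = 0"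
      using test_fun_bounded[OF f'] by blast
    define a where "a t = (LBINT x. p t x * f x)" for t
    define b where "b t = (LBINT x. p t x * m x)" for t
    define d where "d t = (LBINT x. (p t x)\<^sup>2 * deriv f x)" for t
    have [measurable]: "a \<in> borel_measurable borel" "b \<in> borel_measurable borel"
      unfolding a_def[abs_def] b_def[abs_def] by (intro p.pairing_measurable f2 m2)+
    have [measurable]: "d \<in> borel_measurable borel"
    proof -
      have "d \<in> borel_measurable lborel" unfolding d_def[abs_def]
        by (rule lborel.borel_measurable_lebesgue_integral) measurable
      then show ?thesis by simp
    qed
    have i3: "integrable lborel (\<lambda>x. (p t x)\<^sup>2 * deriv f x)" for t
    proof (rule Bochner_Integration.integrable_bound[OF integrable_mult_right[of B, OF L2_integrable[OF pL2(1)[of t]]]])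
      show "AE x in lborel. norm ((p t x)\<^sup>2 * deriv f x) \<le> norm (B * (norm (p t x))\<^sup>2)"
        using B by (intro AE_I2) (simp add: abs_mult mult.commute mult_right_mono)
    qed (use L2_measurable[OF pL2(1)[of t]] in measurable)
    \<comment> \<open>The quadratic term is integrable by the L2 bound on p alone,
      \<open>deriv f\<close> being bounded.\<close>
    have dC: "\<bar>d t\<bar> \<le> B * C" for t
    proof -
      have "\<bar>d t\<bar> \<le> (LBINT x. \<bar>(p t x)\<^sup>2 * deriv f x\<bar>)" unfolding d_def by (rule integral_abs_bound)
      also have "\<dots> \<le> (LBINT x. B * (norm (p t x))\<^sup>2)"
        using B by (intro integral_mono integrable_abs i3 integrable_mult_right L2_integrable pL2)
          (simp add: abs_mult mult.commute mult_right_mono)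
      also have "\<dots> \<le> B * C" using pL2(2)[of t] B(1) by simp
      finally show ?thesis .
    qed
    have int_eq: "(LBINT x. weak_density p m \<eta> f t x)
        = deriv \<eta> t * a t - \<eta> t * (b t + d t / 2)" for t
    proof -
      note i1 = L2_mult_integrable[OF pL2(1) f2, of t] and i2 = L2_mult_integrable[OF pL2(1) m2, of t]
      have "(LBINT x. weak_density p m \<eta> f t x)
        = (LBINT x. deriv \<eta> t * (p t x * f x) - \<eta> t * (p t x * m x) - \<eta> t / 2 * ((p t x)\<^sup>2 * deriv f x))"
        by (simp add: mult_ac)
      also have "\<dots> = deriv \<eta> t * a t - \<eta> t * b t - \<eta> t / 2 * d t"
        unfolding a_def b_def d_def using i1 i2 i3[of t] by simp
      finally show ?thesis by (simp add: algebra_simps)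
    qed
    have "integrable lborel (\<lambda>t. deriv \<eta> t * a t)" "integrable lborel (\<lambda>t. \<eta> t * (b t + d t / 2))"
    proof -
      have *: "integrable lborel (\<lambda>t. h t * c t)" if h: "test_fun h" and [measurable]: "c \<in> borel_measurable borel"
        and K: "\<And>t. \<bar>c t\<bar> \<le> K" for h c :: "real \<Rightarrow> real" and K
      proof (rule Bochner_Integration.integrable_bound[OF integrable_mult_right[of K, OF test_fun_integrable[OF h]]])
        have [measurable]: "h \<in> borel_measurable borel" by (rule test_fun_borel[OF h])
        show "(\<lambda>t. h t * c t) \<in> borel_measurable lborel" by measurable
        have "\<bar>c t\<bar> \<le> \<bar>K\<bar>" for t using K[of t] by linarith
        then show "AE t in lborel. norm (h t * c t) \<le> norm (K * h t)"
          by (intro AE_I2) (simp add: abs_mult mult.commute mult_right_mono)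
      qed
      show "integrable lborel (\<lambda>t. deriv \<eta> t * a t)"
        by (rule *[OF test_fun_deriv[OF \<eta>]]) (auto simp: a_def intro: p.abs_pairing_le f2)
      have "\<bar>b t + d t / 2\<bar> \<le> (C + (LBINT x. (m x)\<^sup>2)) + B * C" for t
        using p.abs_pairing_le[OF m2, of t] dC[of t] unfolding b_def by linarith
      then show "integrable lborel (\<lambda>t. \<eta> t * (b t + d t / 2))"
        by (rule *[OF \<eta>, rotated]) measurable
    qed
    then have int: "integrable lborel (\<lambda>t. deriv \<eta> t * a t - \<eta> t * (b t + d t / 2))" by simp
    \<comment> \<open>p vanishes for t \<le> 0, so the half-line integral of the weak formulation is
      a whole-line integral, the form that \<open>exponential_test\<close> expects.\<close>
    have "(LBINT t. deriv \<eta> t * a t - \<eta> t * (b t + d t / 2))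
        = (LBINT t. indicator {0<..} t *\<^sub>R (deriv \<eta> t * a t - \<eta> t * (b t + d t / 2)))"
      by (intro Bochner_Integration.integral_cong refl) (auto simp: indicator_def a_def b_def d_def p0)
    also have "\<dots> = (LINT t|time. deriv \<eta> t * a t - \<eta> t * (b t + d t / 2))"
      by (subst integral_restrict_space) auto
    also have "\<dots> = (LINT t|time. LINT x|lborel. weak_density u m \<eta> f t x)"
    proof (rule integral_cong_AE)
      show "(\<lambda>t. deriv \<eta> t * a t - \<eta> t * (b t + d t / 2)) \<in> borel_measurable time"
        by (rule measurable_restrict_space1) measurable
      note [measurable] = um
      have [measurable]: "f' \<in> borel_measurable time" if "f' \<in> borel_measurable borel" for f' :: "real \<Rightarrow> real"
        using that by (intro measurable_restrict_space1) simp
      show "(\<lambda>t. LINT x|lborel. weak_density u m \<eta> f t x) \<in> borel_measurable time"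
        by (rule lborel.borel_measurable_lebesgue_integral) measurable
      show "AE t in time. deriv \<eta> t * a t - \<eta> t * (b t + d t / 2)
          = (LBINT x. weak_density u m \<eta> f t x)"
        using pu by eventually_elim (simp add: int_eq[symmetric])
    qed
    also have "\<dots> = - (LBINT x. u0 x * (\<eta> 0 * f x))"
      by (rule weak_solution_test[OF meas weak \<eta> f m_def])
    finally show "integrable lborel (weak_integrand p (\<lambda>t x. (p t x)\<^sup>2) \<eta> f)
      \<and> (LBINT t. weak_integrand p (\<lambda>t x. (p t x)\<^sup>2) \<eta> f t) = - (LBINT x. u0 x * (\<eta> 0 * f x))"
      using int unfolding weak_integrand_def[abs_def] a_def b_def d_def m_def by blast
  qed
qed

section \<open>Uniqueness of bounded weak solutions\<close>

theorem theorem3: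
  shows "\<exists>\<rho>0>0. \<forall>\<rho>\<ge>\<rho>0. \<forall>(u0 :: real \<Rightarrow> real) (u :: real \<Rightarrow> real \<Rightarrow> real) (v :: real \<Rightarrow> real \<Rightarrow> real).
    u0 \<in> L2 \<inter> H_dot \<rho> \<longrightarrow>
    u \<in> Linf_L2 \<inter> L2_N \<longrightarrow> weak_solution u0 u \<longrightarrow> u \<in> Linf_Linf \<longrightarrow>
    v \<in> Linf_L2 \<inter> L2_N \<inter> Linf_Linf \<longrightarrow> weak_solution u0 v \<longrightarrow>
    (AE (t, x) in time \<Otimes>\<^sub>M lborel. v t x = u t x)"
proof (intro exI[of _ "1::real"] conjI allI impI)
  fix \<rho> u0 and u v :: "real \<Rightarrow> real \<Rightarrow> real"
  assume "u \<in> Linf_L2 \<inter> L2_N" and wu: "weak_solution u0 u" and "u \<in> Linf_Linf"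
    and "v \<in> Linf_L2 \<inter> L2_N \<inter> Linf_Linf" and wv: "weak_solution u0 v"
  then have u: "u \<in> Linf_L2" "u \<in> Linf_Linf" and v: "v \<in> Linf_L2" "v \<in> Linf_Linf" by auto
  from regular_representative[OF u wu] obtain p Cp where
    p: "bounded_L2_family p Cp" and pb: "\<And>t. AE x in lborel. \<bar>p t x\<bar> \<le> Cp"
    and p0: "\<And>t x. t \<le> 0 \<Longrightarrow> p t x = 0" and pu: "AE t in time. p t = u t"
    and pw: "\<And>\<eta> f. test_fun \<eta> \<Longrightarrow> test_fun f \<Longrightarrow>
      integrable lborel (weak_integrand p (\<lambda>t x. (p t x)\<^sup>2) \<eta> f)
      \<and> (LBINT t. weak_integrand p (\<lambda>t x. (p t x)\<^sup>2) \<eta> f t) = - (LBINT x. u0 x * (\<eta> 0 * f x))" by blast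
  from regular_representative[OF v wv] obtain q Cq where
    q: "bounded_L2_family q Cq" and qb: "\<And>t. AE x in lborel. \<bar>q t x\<bar> \<le> Cq"
    and q0: "\<And>t x. t \<le> 0 \<Longrightarrow> q t x = 0" and qv: "AE t in time. q t = v t"
    and qw: "\<And>\<eta> f. test_fun \<eta> \<Longrightarrow> test_fun f \<Longrightarrow>
      integrable lborel (weak_integrand q (\<lambda>t x. (q t x)\<^sup>2) \<eta> f)
      \<and> (LBINT t. weak_integrand q (\<lambda>t x. (q t x)\<^sup>2) \<eta> f t) = - (LBINT x. u0 x * (\<eta> 0 * f x))" by blast
  interpret p: bounded_L2_family p Cp by (rule p)
  interpret q: bounded_L2_family q Cq by (rule q)
  define w where "w t x = p t x - q t x" for t x
  define g where "g t x = (p t x)\<^sup>2 - (q t x)\<^sup>2" for t x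
  \<comment> \<open>|p + q| is almost everywhere at most Cp + Cq; the added 1 makes M positive even
    if both constants are 0.\<close>
  define M where "M = Cp + Cq + 1"
  have M: "M > 0" using p.C_nonneg q.C_nonneg by (simp add: M_def)
  have wL2: "w t \<in> L2" for t unfolding w_def[abs_def] by (intro L2_diff p.in_L2 q.in_L2)
  have w: "bounded_L2_family w (2 * Cp + 2 * Cq)"
  proof
    show "case_prod w \<in> borel_measurable (lborel \<Otimes>\<^sub>M lborel)" unfolding w_def by measurable
    show "w t \<in> L2" for t by (rule wL2)
    show "L2_sq (w t) \<le> 2 * Cp + 2 * Cq" for t
    proof -
      have "L2_sq (w t) \<le> (LBINT x. 2 * (norm (p t x))\<^sup>2 + 2 * (norm (q t x))\<^sup>2)"
      proof (intro integral_mono Bochner_Integration.integrable_add integrable_mult_right L2_integrable wL2 p.in_L2 q.in_L2)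
        fix x
        show "(norm (w t x))\<^sup>2 \<le> 2 * (norm (p t x))\<^sup>2 + 2 * (norm (q t x))\<^sup>2"
          using norm_add_square_le[of "p t x" "- q t x"] by (simp add: w_def)
      qed
      also have "\<dots> = 2 * L2_sq (p t) + 2 * L2_sq (q t)"
        using L2_integrable[OF p.in_L2[of t]] L2_integrable[OF q.in_L2[of t]] by simp
      also have "\<dots> \<le> 2 * Cp + 2 * Cq" by (intro add_mono mult_left_mono p.norm_le q.norm_le) auto
      finally show ?thesis .
    qed
  qed
  interpret w: bounded_L2_family w "2 * Cp + 2 * Cq" by (rule w)
  have gw: "AE x in lborel. \<bar>g t x\<bar> \<le> M * \<bar>w t x\<bar>" for t
    using pb[of t] qb[of t]
  proof eventually_elim
    case (elim x)
    have "g t x = (p t x + q t x) * w t x" by (simp add: g_def w_def power2_eq_square algebra_simps)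
    moreover have "\<bar>p t x + q t x\<bar> \<le> M" using elim unfolding M_def by linarith
    ultimately show ?case by (simp add: abs_mult mult_right_mono)
  qed
  \<comment> \<open>\<open>L2_bound\<close> asks for a bound at every x, while the sup bounds hold
    almost everywhere; hence the direct argument that g lies in L2.\<close>
  have gw2: "AE x in lborel. norm ((norm (g t x))\<^sup>2) \<le> norm (M\<^sup>2 * (norm (w t x))\<^sup>2)" for t
    using gw[of t]
  proof eventually_elim
    case (elim x)
    have "\<bar>g t x\<bar>\<^sup>2 \<le> (M * \<bar>w t x\<bar>)\<^sup>2" using elim by (intro power_mono) auto
    then show ?case by (simp add: power_mult_distrib)
  qed
  have gm: "g t \<in> borel_measurable borel" for t
    unfolding g_def[abs_def] using L2_measurable[OF p.in_L2[of t]] L2_measurable[OF q.in_L2[of t]] by measurable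
  have gi: "integrable lborel (\<lambda>x. (norm (g t x))\<^sup>2)" for t
    by (rule Bochner_Integration.integrable_bound[OF integrable_mult_right[of "M\<^sup>2", OF L2_integrable[OF wL2]] _ gw2])
      (use gm[of t] in measurable)
  have g: "bounded_L2_family g (M\<^sup>2 * (2 * Cp + 2 * Cq))"
  proof
    show "case_prod g \<in> borel_measurable (lborel \<Otimes>\<^sub>M lborel)" unfolding g_def by measurable
    show "g t \<in> L2" for t unfolding L2_def using gm gi by simp
    show "L2_sq (g t) \<le> M\<^sup>2 * (2 * Cp + 2 * Cq)" for t
    proof -
      have "L2_sq (g t) \<le> (LBINT x. M\<^sup>2 * (norm (w t x))\<^sup>2)"
        by (intro integral_mono_AE gi integrable_mult_right L2_integrable wL2) (use gw2[of t] in simp)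
      also have "\<dots> = M\<^sup>2 * L2_sq (w t)" by (rule integral_mult_right_zero)
      also have "\<dots> \<le> M\<^sup>2 * (2 * Cp + 2 * Cq)" by (intro mult_left_mono w.norm_le) simp
      finally show ?thesis .
    qed
  qed
  have zero: "w t x = 0 \<and> g t x = 0" if "t \<le> 0" for t x using p0[OF that] q0[OF that] by (simp add: w_def g_def)
  have weak: "(LBINT t. weak_integrand w g \<eta> f t) = 0"
    if \<eta>: "test_fun \<eta>" and f: "test_fun f" for \<eta> f
  proof -
    note f2 = test_fun_L2[OF f] and m2 = multiplier_L2[OF f] and f' = test_fun_deriv[OF f]
    obtain B where B: "B > 0" "\<And>x. \<bar>deriv f x\<bar> \<le> B" "\<And>x. \<bar>x\<bar> > B \<Longrightarrow> deriv f x = 0"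
      using test_fun_bounded[OF f'] by blast
    have sq: "integrable lborel (\<lambda>x. (r x)\<^sup>2 * deriv f x)" if r: "r \<in> L2" for r :: "real \<Rightarrow> real"
    proof -
      have "(\<lambda>x. r x * deriv f x) \<in> L2"
        by (rule L2_bound[OF r, of _ B])
          (use L2_measurable[OF r] test_fun_borel[OF f'] B in \<open>auto simp: abs_mult mult.commute[of B] intro!: mult_left_mono\<close>)
      from L2_mult_integrable[OF r this] show ?thesis by (simp add: power2_eq_square mult.assoc)
    qed
    have split: "(LBINT x. w t x * f x) = (LBINT x. p t x * f x) - (LBINT x. q t x * f x)"
      "(LBINT x. w t x * multiplier symbol f x) = (LBINT x. p t x * multiplier symbol f x) - (LBINT x. q t x * multiplier symbol f x)"
      "(LBINT x. g t x * deriv f x) = (LBINT x. (p t x)\<^sup>2 * deriv f x) - (LBINT x. (q t x)\<^sup>2 * deriv f x)" for t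
      unfolding w_def g_def left_diff_distrib
      by (intro Bochner_Integration.integral_diff L2_mult_integrable p.in_L2 q.in_L2 f2 m2 sq)+
    let ?F = "\<lambda>r. weak_integrand r (\<lambda>t x. (r t x)\<^sup>2) \<eta> f"
    have "(LBINT t. weak_integrand w g \<eta> f t) = (LBINT t. ?F p t - ?F q t)"
      unfolding weak_integrand_def split
      by (intro Bochner_Integration.integral_cong refl) (simp add: algebra_simps diff_divide_distrib)
    also have "\<dots> = (LBINT t. ?F p t) - (LBINT t. ?F q t)"
      by (rule Bochner_Integration.integral_diff[OF conjunct1[OF pw[OF \<eta> f]] conjunct1[OF qw[OF \<eta> f]]])
    \<comment> \<open>Both solutions produce the same initial term, which cancels in the
      difference.\<close>
    also have "\<dots> = 0" using conjunct2[OF pw[OF \<eta> f]] conjunct2[OF qw[OF \<eta> f]] by simp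
    finally show ?thesis .
  qed
  obtain l where l: "l > 0" and vanish: "(\<integral>\<^sup>+t. \<integral>\<^sup>+x. ennreal ((decay l t * w t x)\<^sup>2) \<partial>lborel \<partial>lborel) = 0"
    using difference_vanishes[OF w g M gw zero weak] by blast
  have "AE t in lborel. (\<integral>\<^sup>+x. ennreal ((decay l t * w t x)\<^sup>2) \<partial>lborel) = 0"
    using vanish by (subst (asm) nn_integral_0_iff_AE) measurable
  then have "AE t in lborel. t > 0 \<longrightarrow> (AE x in lborel. w t x = 0)"
  proof eventually_elim
    case (elim t)
    show ?case
    proof
      assume t: "t > 0"
      have "AE x in lborel. ennreal ((decay l t * w t x)\<^sup>2) = 0"
        using elim L2_measurable[OF wL2[of t]] by (subst (asm) nn_integral_0_iff_AE) auto
      then show "AE x in lborel. w t x = 0"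
        by eventually_elim (use t in \<open>simp add: decay_def ennreal_eq_0_iff\<close>)
    qed
  qed
  then have "AE t in time. AE x in lborel. w t x = 0"
    by (subst AE_restrict_space_iff) auto
  then have ae: "AE t in time. AE x in lborel. v t x = u t x"
    using pu qv
  proof eventually_elim
    case (elim t)
    from elim(1) show ?case by eventually_elim (use elim(2,3) in \<open>simp add: w_def fun_eq_iff\<close>)
  qed
  have [measurable]: "case_prod u \<in> borel_measurable (time \<Otimes>\<^sub>M lborel)" "case_prod v \<in> borel_measurable (time \<Otimes>\<^sub>M lborel)"
    using u v by (auto simp: Linf_L2_def time_space_measurable_def)
  \<comment> \<open>Passing from the iterated to the product form of almost everywhere uses that
    \<open>time\<close> is sigma-finite and that the set where u and v agree is measurable.\<close>
  interpret T: sigma_finite_measure time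
    by (rule sigma_finite_measure_restrict_space[OF sigma_finite_lborel]) simp
  interpret TL: pair_sigma_finite time lborel ..
  have "{z \<in> space (time \<Otimes>\<^sub>M lborel). case z of (t, x) \<Rightarrow> v t x = u t x} \<in> sets (time \<Otimes>\<^sub>M lborel)"
    by measurable
  then show "AE (t, x) in time \<Otimes>\<^sub>M lborel. v t x = u t x"
    by (rule TL.AE_pair_measure) (simp add: ae)
qed simp

end
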